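(* Let $\sigma$ and $\tau$ be the substitutions over $A=\{a,b,c\}$ defined by $$\sigma:\ a\mapsto aab,\ b\mapsto c,\ c\mapsto a,\qquad \tau:\ a\mapsto aba,\ b\mapsto c,\ c\mapsto a,$$ and let $\mathcal S=\{\sigma,\tau\}$. For every infinite sequence $s_0s_1s_2\cdots\in\mathcal S^{\mathbb N}$, let $$u=\lim_{n\to\infty}s_0s_1\cdots s_n(a)\in A^{\mathbb N}.$$ Then the subshift $(\overline{S^{\mathbb N}u},S)$ is measurably isomorphic to a translation on a torus.
   Context: Here $s_0s_1\cdots s_n(a)$ is the image of the letter $a$ under the composition $s_0\circ s_1\circ\cdots\circ s_n$; it is a strict prefix of $s_0s_1\cdots s_{n+1}(a)$, so the limit is a well-defined infinite word. $S$ is the shift on $A^{\mathbb N}$ (product topology) and $S^{\mathbb N}u=\{S^nu:n\in\mathbb N\}$. The subshift is considered with its (unique) shift-invariant probability measure and the torus with Lebesgue measure. *)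

theory Defs
  imports "HOL-Probability.Probability" "HOL-Library.Sublist"
begin

datatype letter = La | Lb | Lc

instantiation letter :: discrete_topology
begin

definition open_letter :: "letter set \<Rightarrow> bool"
  where "open_letter U \<longleftrightarrow> True"

instance
  by standard (simp_all add: open_letter_def)

end

type_synonym substitution = "letter \<Rightarrow> letter list"

fun sigma_subst :: substitution where
  "sigma_subst La = [La, La, Lb]"
| "sigma_subst Lb = [Lc]"
| "sigma_subst Lc = [La]"

fun tau_subst :: substitution where
  "tau_subst La = [La, Lb, La]"
| "tau_subst Lb = [Lc]"
| "tau_subst Lc = [La]"

definition apply_subst :: "substitution \<Rightarrow> letter list \<Rightarrow> letter list"
  where "apply_subst \<theta> w = concat (map \<theta> w)"

text \<open>\<open>comp_subst s n\<close> is the composition $s_0 \circ s_1 \circ \cdots \circ s_n$ ($n + 1$ factors)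
  as a map on finite words; the last substitution is applied first.\<close>

primrec comp_subst :: "(nat \<Rightarrow> substitution) \<Rightarrow> nat \<Rightarrow> letter list \<Rightarrow> letter list" where
  "comp_subst s 0 = apply_subst (s 0)"
| "comp_subst s (Suc n) = comp_subst s n \<circ> apply_subst (s (Suc n))"

text \<open>Convergence of a sequence of finite words to an infinite word: every coordinate is
  eventually defined and eventually equal to that of the limit.\<close>

definition words_tendsto :: "(nat \<Rightarrow> letter list) \<Rightarrow> (nat \<Rightarrow> letter) \<Rightarrow> bool"
  where "words_tendsto w u \<longleftrightarrow> (\<forall>i. \<forall>\<^sub>F n in sequentially. i < length (w n) \<and> w n ! i = u i)"

lemma apply_subst_append: "apply_subst \<theta> (v @ w) = apply_subst \<theta> v @ apply_subst \<theta> w"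
  by (simp add: apply_subst_def)

lemma comp_subst_append: "comp_subst s n (v @ w) = comp_subst s n v @ comp_subst s n w"
  by (induction n arbitrary: v w) (simp_all add: apply_subst_append)

lemma apply_subst_nonempty:
  assumes "\<theta> \<in> {sigma_subst, tau_subst}" "w \<noteq> []"
  shows "apply_subst \<theta> w \<noteq> []"
proof -
  obtain x v where "w = x # v" using assms(2) by (cases w) auto
  then show ?thesis using assms(1) by (cases x) (auto simp: apply_subst_def)
qed

lemma comp_subst_nonempty:
  assumes "\<And>n. s n \<in> {sigma_subst, tau_subst}" "w \<noteq> []"
  shows "comp_subst s n w \<noteq> []"
  using assms(2)
  by (induction n arbitrary: w) (simp_all add: apply_subst_nonempty[OF assms(1)])

lemma comp_subst_strict_prefix:
  assumes s: "\<And>n. s n \<in> {sigma_subst, tau_subst}"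
  shows "strict_prefix (comp_subst s n [La]) (comp_subst s (Suc n) [La])"
proof -
  obtain v where v: "apply_subst (s (Suc n)) [La] = [La] @ v" "v \<noteq> []"
    using s[of "Suc n"] by (auto simp: apply_subst_def)
  have "comp_subst s (Suc n) [La] = comp_subst s n ([La] @ v)"
    by (simp only: comp_subst.simps o_apply v(1))
  then have "comp_subst s (Suc n) [La] = comp_subst s n [La] @ comp_subst s n v"
    by (simp only: comp_subst_append)
  moreover have "comp_subst s n v \<noteq> []"
    by (rule comp_subst_nonempty[OF s v(2)])
  ultimately show ?thesis
    by (simp add: strict_prefix_def del: comp_subst.simps)
qed

lemma ex1_limit_word:
  assumes s: "\<And>n. s n \<in> {sigma_subst, tau_subst}"
  shows "\<exists>!u. words_tendsto (\<lambda>n. comp_subst s n [La]) u"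
proof -
  define w where "w = (\<lambda>n. comp_subst s n [La])"
  have strict: "strict_prefix (w n) (w (Suc n))" for n
    unfolding w_def by (rule comp_subst_strict_prefix[OF s])
  have pre: "prefix (w m) (w n)" if "m \<le> n" for m n
    using that
  proof (induction n rule: dec_induct)
    case (step k)
    have "prefix (w k) (w (Suc k))"
      using strict by (simp add: strict_prefix_def)
    then show ?case using step.IH by (rule prefix_order.order_trans[rotated])
  qed simp
  have len: "n \<le> length (w n)" for n
  proof (induction n)
    case (Suc n)
    then show ?case using prefix_length_less[OF strict[of n]] by linarith
  qed simp
  have ex: "words_tendsto w (\<lambda>i. w (Suc i) ! i)"
    unfolding words_tendsto_def
  proof
    fix i
    have "i < length (w n) \<and> w n ! i = w (Suc i) ! i" if ge: "n \<ge> Suc i" for n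
    proof -
      obtain v where v: "w n = w (Suc i) @ v"
        using pre[OF ge] by (auto simp: prefix_def)
      have "i < length (w (Suc i))" using len[of "Suc i"] by linarith
      then show ?thesis by (simp add: v nth_append)
    qed
    then show "\<forall>\<^sub>F n in sequentially. i < length (w n) \<and> w n ! i = w (Suc i) ! i"
      by (rule eventually_sequentiallyI)
  qed
  have uniq: "u = v" if u: "words_tendsto w u" and v: "words_tendsto w v" for u v
  proof
    fix i
    have "\<forall>\<^sub>F n in sequentially. u i = v i"
      using u[unfolded words_tendsto_def, rule_format, of i]
        v[unfolded words_tendsto_def, rule_format, of i]
      by eventually_elim simp
    then show "u i = v i" by simp
  qed
  have "\<exists>!u. words_tendsto w u"
    by (rule ex1I, rule ex, rule uniq, assumption, rule ex)
  then show ?thesis by (simp only: w_def)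
qed

definition left_shift :: "(nat \<Rightarrow> letter) \<Rightarrow> (nat \<Rightarrow> letter)"
  where "left_shift x = (\<lambda>i. x (Suc i))"

text \<open>The closure is taken in the product topology, which is the topology of the function type
  \<open>nat \<Rightarrow> letter\<close> in the library.\<close>

definition orbit_closure :: "(nat \<Rightarrow> letter) \<Rightarrow> (nat \<Rightarrow> letter) set"
  where "orbit_closure u = closure (range (\<lambda>n. (left_shift ^^ n) u))"

definition invariant_prob :: "'a measure \<Rightarrow> ('a \<Rightarrow> 'a) \<Rightarrow> bool"
  where "invariant_prob M T \<longleftrightarrow>
    prob_space M \<and> T \<in> measurable M M \<and> distr M M T = M"

definition shift_invariant_prob_on :: "(nat \<Rightarrow> letter) set \<Rightarrow> (nat \<Rightarrow> letter) measure \<Rightarrow> bool"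
  where "shift_invariant_prob_on X \<mu> \<longleftrightarrow>
    sets \<mu> = sets (restrict_space borel X) \<and> invariant_prob \<mu> left_shift"

text \<open>Isomorphism modulo null sets: an equivariant bimeasurable measure-preserving bijection
  between forward-invariant measurable sets of full measure.\<close>

definition measurably_isomorphic ::
  "'a measure \<Rightarrow> ('a \<Rightarrow> 'a) \<Rightarrow> 'b measure \<Rightarrow> ('b \<Rightarrow> 'b) \<Rightarrow> bool"
  where "measurably_isomorphic M T N R \<longleftrightarrow>
    (\<exists>X\<^sub>0 \<in> sets M. \<exists>Y\<^sub>0 \<in> sets N. \<exists>\<phi>.
      emeasure M (space M - X\<^sub>0) = 0 \<and> emeasure N (space N - Y\<^sub>0) = 0 \<and>
      T ` X\<^sub>0 \<subseteq> X\<^sub>0 \<and> R ` Y\<^sub>0 \<subseteq> Y\<^sub>0 \<and>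
      bij_betw \<phi> X\<^sub>0 Y\<^sub>0 \<and>
      \<phi> \<in> measurable (restrict_space M X\<^sub>0) (restrict_space N Y\<^sub>0) \<and>
      the_inv_into X\<^sub>0 \<phi> \<in> measurable (restrict_space N Y\<^sub>0) (restrict_space M X\<^sub>0) \<and>
      distr (restrict_space M X\<^sub>0) (restrict_space N Y\<^sub>0) \<phi> = restrict_space N Y\<^sub>0 \<and>
      (\<forall>x \<in> X\<^sub>0. \<phi> (T x) = R (\<phi> x)))"

text \<open>The $d$-dimensional torus $\mathbb{R}^d / \mathbb{Z}^d$ with its Lebesgue measure, on the
  fundamental domain $[0,1)^d$; points are functions that are \<open>undefined\<close> outside \<open>{..<d}\<close>.
  Addition in the quotient is coordinatewise addition modulo 1.\<close>

definition torus :: "nat \<Rightarrow> (nat \<Rightarrow> real) measure"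
  where "torus d = (\<Pi>\<^sub>M i\<in>{..<d}. restrict_space lborel {0..<1})"

definition torus_translation :: "nat \<Rightarrow> (nat \<Rightarrow> real) \<Rightarrow> (nat \<Rightarrow> real) \<Rightarrow> (nat \<Rightarrow> real)"
  where "torus_translation d \<alpha> x = (\<lambda>i\<in>{..<d}. frac (x i + \<alpha> i))"

end

theory Submission imports Defs begin

text \<open>Both substitutions have the same incidence matrix, whose eigenvalues are a Pisot unit \<open>\<beta>\<close> and a
  complex conjugate pair \<open>\<alpha>\<close>, \<open>cnj \<alpha>\<close> with \<open>|\<alpha>|\<^sup>2 = 1/\<beta>\<close>. Projecting the abelianized prefixes of \<open>u\<close>
  along the expanding direction gives a bounded walk in the complex plane. By minimality it extends to
  a continuous function on the subshift, and modulo a lattice it is a factor map onto a minimal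
  translation of a 2-torus, which is uniquely ergodic. It remains to see that almost every fibre is a
  single point. Two distinct points of a fibre, viewed as tilings of the line, contain a pair of
  overlapping tiles that do not coincide, and so do all their desubstitutions. In the other direction,
  the finiteness property of the associated numeration systems forces every overlap to produce a
  coincidence within a bounded number of substitutions, so the number of non-coincident
  overlaps after \<open>n\<close> substitutions grows like \<open>\<lambda>\<^sup>n\<close> for some \<open>\<lambda> < \<beta>\<close>. Each accounts for a disc of area of
  order \<open>\<beta>\<^sup>-\<^sup>n\<close>, hence the exceptional fibres form a null set.\<close>

section \<open>The Pisot number and the numeration systems\<close>

text \<open>The directive sequence is arbitrary, so removing one substitution changes the subshift:
  a point over \<open>s\<close> is desubstituted to a point over the shifted sequence. Hence
  statements about hulls quantify over all sequences, and every constant (\<open>radius\<close>, the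
  number of steps to a coincidence, the growth rate of the non-coincident overlaps) has to be
  uniform in them. The common matrix \<open>mat\<close> makes this possible: one pair of projections
  and one lattice serve all levels. Relative positions of tiles are kept as integer vectors.
  \<open>height\<close> decides whether tiles overlap, \<open>proj\<close> limits which vectors
  occur, and bounding both leaves finitely many overlap types. Since \<beta> * |\<alpha>|^2 = 1,
  total overlap length grows per level by the same factor by which disc areas shrink, so any fixed
  proportional loss of length yields measure zero. The hull is defined as a closed set of pairs
  because shifts and desubstitutions pass from the orbit to its closure; that it is a graph is
  derived afterwards. Property (F) does double duty: it also gives the rational independence of 1,
  \<beta>, \<beta>^2 and with it the density of the orbits on the torus.\<close>

lemma UNIV_letter: "UNIV = {La, Lb, Lc}"
  using letter.exhaust by auto

instance letter :: finite
  by standard (simp add: UNIV_letter)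

text \<open>The cubic is the characteristic polynomial of \<open>mat\<close>. The interval is this
  narrow so that the bounds \<open>beta\<close> and \<open>beta_sq\<close> can decide the signs of
  \<open>height\<close> in the finite table of states below.\<close>

lemma ex_beta: "\<exists>x::real. 22055/10000 \<le> x \<and> x \<le> 22056/10000 \<and> x^3 = 2 * x^2 + 1"
proof -
  have "\<exists>x::real. 22055/10000 \<le> x \<and> x \<le> 22056/10000 \<and> x^3 - 2 * x^2 - 1 = 0"
    by (rule IVT') (auto intro!: continuous_intros simp: power2_eq_square power3_eq_cube)
  then show ?thesis by (auto simp: algebra_simps)
qed

definition beta :: real ("\<beta>") where
  "\<beta> = (SOME x. 22055/10000 \<le> x \<and> x \<le> 22056/10000 \<and> x^3 = 2 * x^2 + 1)"

lemma beta: "22055/10000 \<le> \<beta>" "\<beta> \<le> 22056/10000" "\<beta>^3 = 2 * \<beta>^2 + 1"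
  using someI_ex[OF ex_beta] unfolding beta_def[symmetric] by auto

lemma beta_sq: "48642/10000 \<le> \<beta>^2" "\<beta>^2 \<le> 48647/10000"
  using power_mono[OF beta(1), of 2] power_mono[OF beta(2), of 2] beta
  by (auto simp: power2_eq_square)

lemma inverse_beta: "1 / \<beta> = \<beta>^2 - 2 * \<beta>"
  using beta by (auto simp: field_simps power2_eq_square power3_eq_cube)

text \<open>The roots of x^3 - 2 * x^2 - 1 have sum 2 and product 1, so the two nonreal ones have
  sum 2 - \<beta> and product 1 / \<beta>; this is the one in the upper half plane.\<close>

definition alpha :: complex ("\<alpha>") where
  "\<alpha> = Complex ((2 - \<beta>) / 2) (sqrt (1 / \<beta> - ((2 - \<beta>) / 2)^2))"

lemma alpha_sqrt_pos: "1 / \<beta> - ((2 - \<beta>) / 2)^2 > 0"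
  using beta beta_sq unfolding inverse_beta by (simp add: power2_eq_square field_simps)

lemma Im_alpha: "Im \<alpha> > 0"
  using alpha_sqrt_pos by (simp add: alpha_def)

lemma norm_alpha_sq: "(norm \<alpha>)^2 = 1 / \<beta>"
  using alpha_sqrt_pos by (simp add: alpha_def cmod_power2)

lemma norm_alpha: "0 < norm \<alpha>" "norm \<alpha> < 1"
proof -
  show "0 < norm \<alpha>" using Im_alpha by auto
  have "(norm \<alpha>)^2 < 1" unfolding norm_alpha_sq using beta by auto
  then show "norm \<alpha> < 1" by (simp add: power2_less_1_iff)
qed

lemma alpha_quadratic: "\<alpha>^2 = (2 - \<beta>) * \<alpha> - 1 / \<beta>"
proof -
  have "Re (\<alpha>^2) = Re ((2 - \<beta>) * \<alpha> - 1 / \<beta>)"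
    using alpha_sqrt_pos by (simp add: alpha_def power2_eq_square field_simps)
  moreover have "Im (\<alpha>^2) = Im ((2 - \<beta>) * \<alpha> - 1 / \<beta>)"
    by (simp add: alpha_def power2_eq_square)
  ultimately show ?thesis by (rule complex_eqI)
qed

lemma alpha_cubed: "\<alpha>^3 = 2 * \<alpha>^2 + 1"
proof -
  have ib: "1 / complex_of_real \<beta> = \<beta>^2 - 2 * \<beta>"
    by (metis inverse_beta of_real_1 of_real_diff of_real_divide of_real_mult of_real_numeral of_real_power)
  have b3: "complex_of_real \<beta>^3 = 2 * \<beta>^2 + 1"
    by (metis beta(3) of_real_1 of_real_add of_real_mult of_real_numeral of_real_power)
  define b where "b = complex_of_real \<beta>"
  have "\<alpha>^2 = (2 - b) * \<alpha> - (b^2 - 2 * b)" using alpha_quadratic ib by (simp add: b_def)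
  moreover have "b^3 = 2 * b^2 + 1" using b3 by (simp add: b_def)
  ultimately show ?thesis by algebra
qed

text \<open>A vector \<open>(x, y, z)\<close> counts the letters \<open>a\<close>, \<open>b\<close>, \<open>c\<close>. Both substitutions act on it by
  the same matrix, whose left eigenvectors for \<open>\<beta>\<close> and \<open>\<alpha>\<close> are \<open>height\<close> and \<open>proj\<close>.\<close>

type_synonym vec = "int \<times> int \<times> int"

fun unit :: "letter \<Rightarrow> vec" where
  "unit La = (1, 0, 0)"
| "unit Lb = (0, 1, 0)"
| "unit Lc = (0, 0, 1)"

definition abel :: "letter list \<Rightarrow> vec" where
  "abel w = sum_list (map unit w)"

fun mat :: "vec \<Rightarrow> vec" where
  "mat (x, y, z) = (2 * x + z, x, y)"

fun height :: "vec \<Rightarrow> real" where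
  "height (x, y, z) = of_int x * \<beta>^2 + of_int z * \<beta> + of_int y"

fun proj :: "vec \<Rightarrow> complex" where
  "proj (x, y, z) = of_int x * \<alpha>^2 + of_int z * \<alpha> + of_int y"

fun total :: "vec \<Rightarrow> int" where
  "total (x, y, z) = x + y + z"

lemma abel_simps [simp]: "abel [] = 0" "abel (x # w) = unit x + abel w" "abel (v @ w) = abel v + abel w"
  by (auto simp: abel_def)

lemma mat_add: "mat (d + e) = mat d + mat e"
  by (cases d; cases e) auto

lemma mat_zero [simp]: "mat 0 = 0"
  by (simp add: zero_prod_def)

lemma mat_eq_zero_iff [simp]: "mat d = 0 \<longleftrightarrow> d = 0"
  by (cases d) (auto simp: zero_prod_def)

lemma height_add: "height (d + e) = height d + height e"
  by (cases d; cases e) (auto simp: algebra_simps)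

lemma height_diff: "height (d - e) = height d - height e"
  by (cases d; cases e) (auto simp: algebra_simps)

lemma height_minus: "height (- d) = - height d"
  by (cases d) (auto simp: algebra_simps)

lemma height_zero [simp]: "height 0 = 0"
  by (simp add: zero_prod_def)

lemma height_mat: "height (mat d) = \<beta> * height d"
proof -
  obtain x y z where "d = (x, y, z)" by (cases d)
  moreover have "\<beta> * (of_int x * \<beta>^2) = of_int x * \<beta>^3"
    by (simp add: power2_eq_square power3_eq_cube)
  ultimately show ?thesis by (simp add: beta(3) algebra_simps power2_eq_square)
qed

lemma proj_add: "proj (d + e) = proj d + proj e"
  by (cases d; cases e) (auto simp: algebra_simps)

lemma proj_diff: "proj (d - e) = proj d - proj e"
  by (cases d; cases e) (auto simp: algebra_simps)

lemma proj_minus: "proj (- d) = - proj d"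
  by (cases d) (auto simp: algebra_simps)

lemma proj_zero [simp]: "proj 0 = 0"
  by (simp add: zero_prod_def)

lemma proj_mat: "proj (mat d) = \<alpha> * proj d"
proof -
  obtain x y z where "d = (x, y, z)" by (cases d)
  moreover have "\<alpha> * (of_int x * \<alpha>^2) = of_int x * \<alpha>^3"
    by (simp add: power2_eq_square power3_eq_cube)
  ultimately show ?thesis by (simp add: alpha_cubed algebra_simps power2_eq_square)
qed

lemma total_add: "total (d + e) = total d + total e"
  by (cases d; cases e) auto

lemma total_diff: "total (d - e) = total d - total e"
  by (cases d; cases e) auto

lemma total_abel [simp]: "total (abel w) = int (length w)"
proof (induction w)
  case (Cons x w)
  then show ?case by (cases x) (auto simp: total_add)
qed (simp add: zero_prod_def)

lemma mat_surj: "\<exists>e. mat e = d"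
proof -
  obtain x y z where "d = (x, y, z)" by (cases d)
  then have "mat (y, z, x - 2 * y) = d" by simp
  then show ?thesis ..
qed

abbreviation substs :: "substitution set" where
  "substs \<equiv> {sigma_subst, tau_subst}"

lemma abel_subst: "\<theta> \<in> substs \<Longrightarrow> abel (\<theta> i) = mat (unit i)"
  by (cases i) auto

lemma abel_apply_subst: "\<theta> \<in> substs \<Longrightarrow> abel (apply_subst \<theta> w) = mat (abel w)"
  by (induction w) (simp_all add: apply_subst_def mat_add abel_subst)

abbreviation width :: "letter \<Rightarrow> real" where
  "width i \<equiv> height (unit i)"

lemma width_ge_1: "1 \<le> width i"
  using beta beta_sq by (cases i) auto

lemma width_pos: "0 < width i"
  using width_ge_1[of i] by linarith

lemma height_abel_ge: "real (length w) \<le> height (abel w)"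
proof (induction w)
  case (Cons x w)
  then show ?case using width_ge_1[of x] by (auto simp: height_add)
qed simp

text \<open>One step of the Dumont--Thomas expansion: the point at distance \<open>d\<close> from the left end of a tile
  of type \<open>i\<close> is located in the substituted tile.\<close>

definition locate :: "substitution \<Rightarrow> vec \<Rightarrow> letter \<Rightarrow> vec \<Rightarrow> letter \<Rightarrow> bool" where
  "locate \<theta> d i e j \<longleftrightarrow> (\<exists>p q. \<theta> i = p @ j # q \<and> e = mat d - abel p \<and> 0 \<le> height e \<and> height e < width j)"

text \<open>The expansion reaches 0 whichever substitutions are chosen. If \<open>height d\<close>
  is outside the tile, \<open>locate\<close> has no successor and \<open>step\<close> holds
  vacuously; inside the tile \<open>locate_exists\<close> provides one, so there the predicate has
  content.\<close>

inductive terminating :: "vec \<Rightarrow> letter \<Rightarrow> bool" where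
  zero: "terminating 0 i"
| step: "(\<And>\<theta> e j. \<theta> \<in> substs \<Longrightarrow> locate \<theta> d i e j \<Longrightarrow> terminating e j) \<Longrightarrow> terminating d i"

lemma locate_word:
  assumes "0 \<le> h" "h < height (abel w)"
  shows "\<exists>p j q. w = p @ j # q \<and> height (abel p) \<le> h \<and> h < height (abel p) + width j"
  using assms
proof (induction w arbitrary: h)
  case (Cons x w)
  show ?case
  proof (cases "h < width x")
    case True
    then show ?thesis using Cons.prems by (intro exI[of _ "[]"]) auto
  next
    case False
    then obtain p j q where "w = p @ j # q" "height (abel p) \<le> h - width x" "h - width x < height (abel p) + width j"
      using Cons.IH[of "h - width x"] Cons.prems by (auto simp: height_add)
    then show ?thesis by (intro exI[of _ "x # p"] exI[of _ j] exI[of _ q]) (auto simp: height_add)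
  qed
qed simp

lemma locate_exists:
  assumes "\<theta> \<in> substs" "0 \<le> height d" "height d < width i"
  shows "\<exists>e j. locate \<theta> d i e j"
proof -
  have "\<beta> * height d < height (abel (\<theta> i))" "0 \<le> \<beta> * height d"
    using assms beta by (auto simp: abel_subst height_mat)
  then obtain p j q where "\<theta> i = p @ j # q" "height (abel p) \<le> \<beta> * height d" "\<beta> * height d < height (abel p) + width j"
    using locate_word by metis
  then have "locate \<theta> d i (mat d - abel p) j"
    by (auto simp: locate_def height_diff height_mat)
  then show ?thesis by blast
qed

lemma split_words:
  "[a, b, c] = p @ j # q \<longleftrightarrow> p = [] \<and> j = a \<and> q = [b, c] \<or> p = [a] \<and> j = b \<and> q = [c] \<or> p = [a, b] \<and> j = c \<and> q = []"
  "[a] = p @ j # q \<longleftrightarrow> p = [] \<and> j = a \<and> q = []"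
  by (auto simp: Cons_eq_append_conv)

lemma ex_split_words:
  "(\<exists>p q. [a, b, c] = p @ j # q \<and> P p) \<longleftrightarrow> j = a \<and> P [] \<or> j = b \<and> P [a] \<or> j = c \<and> P [a, b]"
  "(\<exists>p q. [a] = p @ j # q \<and> P p) \<longleftrightarrow> j = a \<and> P []"
  unfolding split_words by blast+

lemma locate_sigma:
  "locate sigma_subst (x, y, z) i e j \<longleftrightarrow> (case i of
       La \<Rightarrow> j = La \<and> e = (2 * x + z, x, y) \<or> j = La \<and> e = (2 * x + z - 1, x, y) \<or> j = Lb \<and> e = (2 * x + z - 2, x, y)
     | Lb \<Rightarrow> j = Lc \<and> e = (2 * x + z, x, y)
     | Lc \<Rightarrow> j = La \<and> e = (2 * x + z, x, y)) \<and> 0 \<le> height e \<and> height e < width j"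
proof -
  have "locate sigma_subst (x, y, z) i e j \<longleftrightarrow>
     (\<exists>p q. sigma_subst i = p @ j # q \<and> e = mat (x, y, z) - abel p) \<and> 0 \<le> height e \<and> height e < width j"
    unfolding locate_def by blast
  then show ?thesis
    by (cases i; simp only: sigma_subst.simps ex_split_words letter.case; simp add: zero_prod_def)
qed

lemma locate_tau:
  "locate tau_subst (x, y, z) i e j \<longleftrightarrow> (case i of
       La \<Rightarrow> j = La \<and> e = (2 * x + z, x, y) \<or> j = Lb \<and> e = (2 * x + z - 1, x, y) \<or> j = La \<and> e = (2 * x + z - 1, x - 1, y)
     | Lb \<Rightarrow> j = Lc \<and> e = (2 * x + z, x, y)
     | Lc \<Rightarrow> j = La \<and> e = (2 * x + z, x, y)) \<and> 0 \<le> height e \<and> height e < width j"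
proof -
  have "locate tau_subst (x, y, z) i e j \<longleftrightarrow>
     (\<exists>p q. tau_subst i = p @ j # q \<and> e = mat (x, y, z) - abel p) \<and> 0 \<le> height e \<and> height e < width j"
    unfolding locate_def by blast
  then show ?thesis
    by (cases i; simp only: tau_subst.simps ex_split_words letter.case; simp add: zero_prod_def)
qed

lemma terminating_zero: "terminating (0, 0, 0) i"
  using terminating.zero by (simp add: zero_prod_def)

text \<open>All states with \<open>\<bar>y\<bar>, \<bar>z\<bar> \<le> 2\<close>, sorted by the number of steps needed to reach \<open>0\<close>.\<close>

lemma terminating_1:
  "terminating (0, 0, 1) La"
  by (rule terminating.step, insert beta beta_sq, (auto simp: locate_sigma locate_tau terminating_zero )[1])+

lemma terminating_2:
  "terminating (0, 1, 0) La"
  "terminating (0, 1, 0) Lc"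
  by (rule terminating.step, insert beta beta_sq, (auto simp: locate_sigma locate_tau terminating_zero terminating_1)[1])+

lemma terminating_3:
  "terminating (1, 0, -2) La"
  "terminating (1, 0, -2) Lb"
  "terminating (1, 0, -2) Lc"
  "terminating (1, 0, -1) La"
  by (rule terminating.step, insert beta beta_sq, (auto simp: locate_sigma locate_tau terminating_zero terminating_1 terminating_2)[1])+

lemma terminating_4:
  "terminating (0, -2, 1) La"
  "terminating (0, -2, 1) Lb"
  "terminating (0, -2, 1) Lc"
  "terminating (0, -2, 2) La"
  "terminating (0, -1, 1) La"
  "terminating (0, -1, 1) Lc"
  by (rule terminating.step, insert beta beta_sq, (auto simp: locate_sigma locate_tau terminating_zero terminating_1 terminating_2 terminating_3)[1])+

lemma terminating_5:
  "terminating (-1, 1, 2) La"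
  "terminating (-1, 1, 2) Lb"
  "terminating (-1, 1, 2) Lc"
  "terminating (0, 1, 1) La"
  by (rule terminating.step, insert beta beta_sq, (auto simp: locate_sigma locate_tau terminating_zero terminating_1 terminating_2 terminating_3 terminating_4)[1])+

lemma terminating_6:
  "terminating (1, 1, -2) La"
  "terminating (1, 1, -2) Lc"
  "terminating (1, 1, -1) La"
  "terminating (1, 2, -2) La"
  by (rule terminating.step, insert beta beta_sq, (auto simp: locate_sigma locate_tau terminating_zero terminating_1 terminating_2 terminating_3 terminating_4 terminating_5)[1])+

lemma terminating_7:
  "terminating (1, -2, -1) La"
  "terminating (1, -2, -1) Lb"
  "terminating (1, -2, -1) Lc"
  "terminating (1, -2, 0) La"
  "terminating (1, -1, -1) La"
  "terminating (1, -1, -1) Lc"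
  "terminating (1, -1, 0) La"
  "terminating (2, -2, -2) La"
  by (rule terminating.step, insert beta beta_sq, (auto simp: locate_sigma locate_tau terminating_zero terminating_1 terminating_2 terminating_3 terminating_4 terminating_5 terminating_6)[1])+

lemma terminating_8:
  "terminating (0, -1, 2) La"
  "terminating (0, 0, 2) La"
  by (rule terminating.step, insert beta beta_sq, (auto simp: locate_sigma locate_tau terminating_zero terminating_1 terminating_2 terminating_3 terminating_4 terminating_5 terminating_6 terminating_7)[1])+

lemma terminating_9:
  "terminating (-1, 2, 2) La"
  "terminating (-1, 2, 2) Lc"
  "terminating (0, 2, 0) La"
  "terminating (0, 2, 0) Lc"
  "terminating (0, 2, 1) La"
  "terminating (1, 2, -1) La"
  by (rule terminating.step, insert beta beta_sq, (auto simp: locate_sigma locate_tau terminating_zero terminating_1 terminating_2 terminating_3 terminating_4 terminating_5 terminating_6 terminating_7 terminating_8)[1])+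

lemma terminating_10:
  "terminating (2, -1, -2) La"
  by (rule terminating.step, insert beta beta_sq, (auto simp: locate_sigma locate_tau terminating_zero terminating_1 terminating_2 terminating_3 terminating_4 terminating_5 terminating_6 terminating_7 terminating_8 terminating_9)[1])+

lemma terminating_small:
  assumes "\<bar>y\<bar> \<le> 2" "\<bar>z\<bar> \<le> 2" "0 \<le> height (x, y, z)" "height (x, y, z) < width i"
  shows "terminating (x, y, z) i"
proof -
  have yz: "y = -2 \<or> y = -1 \<or> y = 0 \<or> y = 1 \<or> y = 2" "z = -2 \<or> z = -1 \<or> z = 0 \<or> z = 1 \<or> z = 2"
    using assms(1,2) by arith+
  have "height (x, y, z) < \<beta>^2"
    using assms(4) beta beta_sq by (cases i) auto
  moreover have "\<bar>of_int y + of_int z * \<beta>\<bar> \<le> 2 + 2 * \<beta>"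
    using assms(1,2) beta by (intro order_trans[OF abs_triangle_ineq] add_mono) (auto simp: abs_mult intro!: mult_right_mono)
  ultimately have "of_int x * \<beta>^2 \<ge> - (2 + 2 * \<beta>)" "of_int x * \<beta>^2 < \<beta>^2 + (2 + 2 * \<beta>)"
    using assms(3) by auto
  \<comment> \<open>As 2 + 2 * \<beta> < 2 * \<beta>^2, only x = -1, 0, 1, 2 remain, and the 100
    resulting triples are looked up in the table.\<close>
  then have "of_int x * \<beta>^2 > (-2) * \<beta>^2" "of_int x * \<beta>^2 < 3 * \<beta>^2"
    using beta beta_sq by linarith+
  then have "of_int x > (-2::real)" "of_int x < (3::real)"
    by - (erule mult_right_less_imp_less, simp)+
  then have "x = -1 \<or> x = 0 \<or> x = 1 \<or> x = 2" by linarith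
  with yz show ?thesis
    using assms(3,4) beta beta_sq
    by (elim disjE; cases i)
       (simp_all add: terminating_zero terminating_1 terminating_2 terminating_3 terminating_4 terminating_5
         terminating_6 terminating_7 terminating_8 terminating_9 terminating_10)
qed

text \<open>Since \<open>z\<close> becomes the old \<open>y\<close>, two steps decrease \<open>max \<bar>y\<bar> \<bar>z\<bar>\<close> as soon as it is at least 3.\<close>

lemma locate_contract:
  assumes "locate \<theta> (x, y, z) i (x', y', z') j" "\<theta> \<in> substs"
    and "0 \<le> height (x, y, z)" "height (x, y, z) < width i"
    and m: "\<bar>y\<bar> \<le> m" "\<bar>z\<bar> \<le> m" "3 \<le> m"
  shows "\<bar>y'\<bar> \<le> m - 1 \<and> z' = y"
proof -
  have y': "(y' = x \<or> y' = x - 1) \<and> z' = y"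
    using assms(1,2) by (cases i) (auto simp: locate_sigma locate_tau)
  have h: "height (x, y, z) < \<beta>^2"
    using assms(4) beta beta_sq by (cases i) auto
  have m': "\<bar>of_int y\<bar> \<le> real_of_int m" "\<bar>of_int z\<bar> \<le> real_of_int m" "3 \<le> real_of_int m"
    using m by linarith+
  then have "\<bar>of_int y + of_int z * \<beta>\<bar> \<le> of_int m + of_int m * \<beta>"
    using beta by (intro order_trans[OF abs_triangle_ineq] add_mono) (auto simp: abs_mult intro!: mult_right_mono)
  with h have *: "of_int x * \<beta>^2 \<ge> - (of_int m + of_int m * \<beta>)" "of_int x * \<beta>^2 < \<beta>^2 + (of_int m + of_int m * \<beta>)"
    using assms(3) by auto
  have "3 * (\<beta>^2 - 1 - \<beta>) \<le> of_int m * (\<beta>^2 - 1 - \<beta>)"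
    using m'(3) beta beta_sq by (intro mult_right_mono) auto
  \<comment> \<open>The origin of the threshold 3: m * (\<beta>^2 - 1 - \<beta>) exceeds \<beta>^2
    for m = 3 but not for m = 2, which is why the states up to 2 are checked by hand.\<close>
  moreover have "3 * (\<beta>^2 - 1 - \<beta>) > \<beta>^2"
    using beta(2) beta_sq(1) by (simp add: field_simps)
  ultimately have "of_int m + of_int m * \<beta> < (of_int m - 1) * \<beta>^2"
    by (simp add: algebra_simps)
  with * have "of_int x * \<beta>^2 < of_int m * \<beta>^2" "of_int x * \<beta>^2 > (1 - of_int m) * \<beta>^2"
    by (auto simp: algebra_simps)
  then have "real_of_int x < of_int m" "real_of_int x > 1 - of_int m"
    using beta_sq by (auto simp: mult_less_cancel_right)
  then have "x < m" "x > 1 - m" by linarith+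
  with y' show ?thesis by auto
qed

lemma locate_bounds: "locate \<theta> d i e j \<Longrightarrow> 0 \<le> height e \<and> height e < width j"
  by (auto simp: locate_def)

lemma terminating_bounded:
  assumes "\<bar>y\<bar> \<le> int n + 2" "\<bar>z\<bar> \<le> int n + 2" "0 \<le> height (x, y, z)" "height (x, y, z) < width i"
  shows "terminating (x, y, z) i"
  using assms
proof (induction n arbitrary: x y z i)
  case 0
  then show ?case by (intro terminating_small) auto
next
  case (Suc n)
  define m where "m = int n + 3"
  have m: "\<bar>y\<bar> \<le> m" "\<bar>z\<bar> \<le> m" "3 \<le> m" using Suc.prems by (auto simp: m_def)
  show ?case
  proof (rule terminating.step)
    fix \<theta> e j assume 1: "\<theta> \<in> substs" "locate \<theta> (x, y, z) i e j"
    obtain x' y' z' where e: "e = (x', y', z')" by (cases e)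
    have c1: "\<bar>y'\<bar> \<le> m - 1" "z' = y"
      using locate_contract[OF 1(2)[unfolded e] 1(1) Suc.prems(3,4) m] by auto
    show "terminating e j" unfolding e
    proof (rule terminating.step)
      fix \<theta> e' k assume 2: "\<theta> \<in> substs" "locate \<theta> (x', y', z') j e' k"
      obtain x'' y'' z'' where e': "e' = (x'', y'', z'')" by (cases e')
      have "\<bar>y''\<bar> \<le> m - 1" "z'' = y'"
        using locate_contract[OF 2(2)[unfolded e'] 2(1), of m] locate_bounds[OF 1(2)] c1 m e by auto
      then show "terminating e' k"
        unfolding e' using c1 locate_bounds[OF 2(2)] by (intro Suc.IH) (auto simp: m_def e')
    qed
  qed
qed

text \<open>This is property (F), uniformly in the directive sequence.\<close>

lemma terminating_all:
  assumes "0 \<le> height d" "height d < width i"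
  shows "terminating d i"
proof -
  obtain x y z where d: "d = (x, y, z)" by (cases d)
  show ?thesis
    using assms unfolding d by (intro terminating_bounded[of _ "nat (\<bar>y\<bar> + \<bar>z\<bar>)"]) auto
qed

text \<open>At height 0 no tile can be skipped, since the remaining height would be negative. So the
  expansion just iterates \<open>mat\<close>, and as it ends in 0 and \<open>mat\<close> is
  injective, the vector was 0 from the start. This is the rational independence of 1, \<beta>,
  \<beta>^2.\<close>

lemma height_eq_zero:
  assumes "height d = 0"
  shows "d = 0"
proof -
  have "terminating d i \<Longrightarrow> height d = 0 \<Longrightarrow> d = 0" for d i
  proof (induction rule: terminating.induct)
    case (step d i)
    obtain e j where ej: "locate sigma_subst d i e j"
      using locate_exists[of sigma_subst d i] step.prems width_pos[of i] by auto
    then obtain p where p: "e = mat d - abel p" "0 \<le> height e" by (auto simp: locate_def)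
    have "height e = - height (abel p)" using p step.prems by (simp add: height_diff height_mat)
    then have "height (abel p) \<le> 0" "height e = 0"
      using p(2) height_abel_ge[of p] by linarith+
    then have "real (length p) \<le> 0" using height_abel_ge[of p] by linarith
    then have "p = []" by simp
    moreover have "e = 0" using step.IH[OF _ ej] \<open>height e = 0\<close> by simp
    ultimately show ?case using p by simp
  qed simp
  then show ?thesis using terminating_all[of d La] assms width_pos[of La] by auto
qed

primrec terminates_within :: "nat \<Rightarrow> vec \<Rightarrow> letter \<Rightarrow> bool" where
  "terminates_within 0 d i \<longleftrightarrow> d = 0"
| "terminates_within (Suc n) d i \<longleftrightarrow> (\<forall>\<theta> \<in> substs. \<forall>e j. locate \<theta> d i e j \<longrightarrow> terminates_within n e j)"

lemma terminates_within_zero: "terminates_within n 0 i"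
proof (induction n arbitrary: i)
  case (Suc n)
  \<comment> \<open>Skipping a nonempty prefix would make the height negative, so 0 is only ever
    followed by 0.\<close>
  have "e = 0" if "locate \<theta> 0 i e j" for \<theta> e j
  proof -
    obtain p where p: "e = - abel p" "0 \<le> height e" using \<open>locate \<theta> 0 i e j\<close> by (auto simp: locate_def)
    then have "height e = - height (abel p)" by (simp add: height_minus)
    then have "real (length p) \<le> 0" using height_abel_ge[of p] p(2) by linarith
    then have "p = []" by simp
    then show ?thesis using p by simp
  qed
  then show ?case using Suc unfolding terminates_within.simps by metis
qed simp

lemma terminates_within_mono: "terminates_within n d i \<Longrightarrow> n \<le> m \<Longrightarrow> terminates_within m d i"
proof (induction n arbitrary: m d i)
  case 0
  then show ?case using terminates_within_zero by simp
next
  case (Suc n)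
  then obtain k where "m = Suc k" "n \<le> k" by (cases m) auto
  then show ?case using Suc.prems Suc.IH by auto
qed

lemma finite_locate: "finite {(e, j). locate \<theta> d i e j}"
proof -
  have "{(e, j). locate \<theta> d i e j} \<subseteq> (\<lambda>k. (mat d - abel (take k (\<theta> i)), \<theta> i ! k)) ` {..<length (\<theta> i)}"
  proof clarify
    fix e j assume "locate \<theta> d i e j"
    then obtain p q where "\<theta> i = p @ j # q" "e = mat d - abel p" by (auto simp: locate_def)
    then show "(e, j) \<in> (\<lambda>k. (mat d - abel (take k (\<theta> i)), \<theta> i ! k)) ` {..<length (\<theta> i)}"
      by (intro image_eqI[of _ _ "length p"]) auto
  qed
  then show ?thesis by (rule finite_subset) auto
qed

text \<open>Each state has finitely many successors, so the well-founded tree of expansions has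
  bounded depth; the bound serves all directive sequences at once.\<close>

lemma ex_terminates_within:
  assumes "0 \<le> height d" "height d < width i"
  shows "\<exists>n. terminates_within n d i"
  using terminating_all[OF assms]
proof (induction rule: terminating.induct)
  case (zero i)
  then show ?case using terminates_within_zero by blast
next
  case (step d i)
  define A where "A = (\<Union>\<theta>\<in>substs. {(e, j). locate \<theta> d i e j})"
  have "finite A" using finite_locate by (auto simp: A_def)
  have "\<forall>x\<in>A. \<exists>n. terminates_within n (fst x) (snd x)"
  proof
    fix x assume "x \<in> A"
    then obtain \<theta> where "\<theta> \<in> substs" "locate \<theta> d i (fst x) (snd x)" unfolding A_def by fastforce
    then show "\<exists>n. terminates_within n (fst x) (snd x)" by (rule step.IH)
  qed
  then obtain N where N: "\<forall>x\<in>A. terminates_within (N x) (fst x) (snd x)" by metis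
  have "terminates_within (Suc (Max (N ` A))) d i"
    unfolding terminates_within.simps
  proof (intro ballI allI impI)
    fix \<theta> e j assume "\<theta> \<in> substs" "locate \<theta> d i e j"
    then have "(e, j) \<in> A" by (auto simp: A_def)
    then have "terminates_within (N (e, j)) e j" "N (e, j) \<le> Max (N ` A)"
      using N \<open>finite A\<close> by auto
    then show "terminates_within (Max (N ` A)) e j" by (rule terminates_within_mono)
  qed
  then show ?case by blast
qed

section \<open>Overlaps and coincidences\<close>

text \<open>Length of the intersection of the intervals [x, x + a] and [y, y + b].\<close>

definition seg :: "real \<Rightarrow> real \<Rightarrow> real \<Rightarrow> real \<Rightarrow> real" where
  "seg x a y b = max 0 (min (x + a) (y + b) - max x y)"

lemma seg_commute: "seg x a y b = seg y b x a"
  by (auto simp: seg_def min.commute max.commute)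

lemma seg_translate: "seg (x + t) a (y + t) b = seg x a y b"
  unfolding seg_def by (simp add: min_def max_def)

lemma seg_nonneg: "0 \<le> seg x a y b"
  by (simp add: seg_def)

lemma seg_add: "0 \<le> a \<Longrightarrow> 0 \<le> a' \<Longrightarrow> 0 \<le> b \<Longrightarrow> seg x (a + a') y b = seg x a y b + seg (x + a) a' y b"
  unfolding seg_def min_def max_def by auto

lemma seg_scale: "0 \<le> c \<Longrightarrow> seg (c * x) (c * a) (c * y) (c * b) = c * seg x a y b"
  unfolding seg_def
  by (simp add: max_mult_distrib_left min_mult_distrib_left distrib_left right_diff_distrib)

lemma height_abel_nonneg: "0 \<le> height (abel w)"
  using height_abel_ge[of w] by linarith

lemma sum_seg:
  assumes "0 \<le> b"
  shows "(\<Sum>k<length v. seg (x + height (abel (take k v))) (width (v ! k)) y b) = seg x (height (abel v)) y b"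
proof (induction v arbitrary: x)
  case Nil
  then show ?case using assms by (simp add: seg_def)
next
  case (Cons i v)
  have "seg x (height (abel (i # v))) y b = seg x (width i) y b + seg (x + width i) (height (abel v)) y b"
    using width_pos[of i] height_abel_nonneg[of v] assms by (simp add: height_add seg_add)
  then show ?case
    by (simp add: Cons[symmetric] sum.lessThan_Suc_shift height_add add.assoc del: sum.lessThan_Suc)
qed

text \<open>The overlap \<open>Ov d i j\<close> consists of a tile of type \<open>i\<close> at the origin and a tile of type \<open>j\<close>
  at \<open>d\<close>; along the expanding direction they meet in an interval of length \<open>overlap (Ov d i j)\<close>.\<close>

datatype overlap_type = Ov vec letter letter

fun overlap :: "overlap_type \<Rightarrow> real" where
  "overlap (Ov d i j) = seg 0 (width i) (height d) (width j)"

text \<open>The \<open>k\<close>-th tile of the first substituted tile becomes the new origin, hence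
  the subtraction. All pairs of subtiles count as children, including those that do not meet; they
  have overlap 0.\<close>

fun child :: "substitution \<Rightarrow> overlap_type \<Rightarrow> nat \<Rightarrow> nat \<Rightarrow> overlap_type" where
  "child \<theta> (Ov d i j) k l = Ov (mat d + abel (take l (\<theta> j)) - abel (take k (\<theta> i))) (\<theta> i ! k) (\<theta> j ! l)"

fun children :: "substitution \<Rightarrow> overlap_type \<Rightarrow> (nat \<times> nat) set" where
  "children \<theta> (Ov d i j) = {..<length (\<theta> i)} \<times> {..<length (\<theta> j)}"

fun coincident :: "overlap_type \<Rightarrow> bool" where
  "coincident (Ov d i j) \<longleftrightarrow> d = 0 \<and> i = j"

fun swap_overlap :: "overlap_type \<Rightarrow> overlap_type" where
  "swap_overlap (Ov d i j) = Ov (- d) j i"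

lemma finite_children [simp]: "finite (children \<theta> o')"
  by (cases o') auto

lemma overlap_nonneg: "0 \<le> overlap o'"
  by (cases o') (simp add: seg_nonneg)

text \<open>Substitution stretches both intervals by \<beta> and cuts each into subtiles, and the
  length of an intersection is additive in either interval.\<close>

lemma sum_overlap_children:
  assumes "\<theta> \<in> substs"
  shows "(\<Sum>(k, l)\<in>children \<theta> o'. overlap (child \<theta> o' k l)) = \<beta> * overlap o'"
proof -
  obtain d i j where o': "o' = (Ov d i j)" by (cases o')
  have "overlap (child \<theta> o' k l) = seg (0 + height (abel (take k (\<theta> i)))) (width (\<theta> i ! k))
      (\<beta> * height d + height (abel (take l (\<theta> j)))) (width (\<theta> j ! l))" for k l
    using seg_translate[of 0 "height (abel (take k (\<theta> i)))"]
    by (simp add: o' height_add height_diff height_mat seg_translate[of 0 "height (abel (take k (\<theta> i)))", symmetric])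
  then have "(\<Sum>(k, l)\<in>children \<theta> o'. overlap (child \<theta> o' k l)) =
     (\<Sum>k<length (\<theta> i). \<Sum>l<length (\<theta> j). seg (0 + height (abel (take k (\<theta> i)))) (width (\<theta> i ! k))
      (\<beta> * height d + height (abel (take l (\<theta> j)))) (width (\<theta> j ! l)))"
    by (simp add: o' sum.cartesian_product)
  also have "\<dots> = (\<Sum>l<length (\<theta> j). \<Sum>k<length (\<theta> i). seg (0 + height (abel (take k (\<theta> i)))) (width (\<theta> i ! k))
      (\<beta> * height d + height (abel (take l (\<theta> j)))) (width (\<theta> j ! l)))"
    by (rule sum.swap)
  also have "\<dots> = (\<Sum>l<length (\<theta> j). seg (\<beta> * height d + height (abel (take l (\<theta> j)))) (width (\<theta> j ! l)) 0 (height (abel (\<theta> i))))"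
    by (subst sum_seg) (use width_pos in \<open>auto simp: less_imp_le seg_commute intro!: sum.cong\<close>)
  also have "\<dots> = seg (\<beta> * height d) (height (abel (\<theta> j))) 0 (height (abel (\<theta> i)))"
    by (rule sum_seg[OF height_abel_nonneg])
  also have "\<dots> = seg (\<beta> * height d) (\<beta> * width j) (\<beta> * 0) (\<beta> * width i)"
    using assms by (simp add: abel_subst height_mat)
  also have "\<dots> = \<beta> * overlap o'"
    using beta(1) by (subst seg_scale) (auto simp: o' seg_commute)
  finally show ?thesis .
qed

text \<open>Total length of the overlaps that descend from \<open>o'\<close> without any coincident ancestor.\<close>

primrec mass :: "substitution list \<Rightarrow> overlap_type \<Rightarrow> real" where
  "mass [] o' = (if coincident o' then 0 else overlap o')"
| "mass (\<theta> # ss) o' = (if coincident o' then 0 else \<Sum>(k, l)\<in>children \<theta> o'. mass ss (child \<theta> o' k l))"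

lemma mass_nonneg: "0 \<le> mass ss o'"
  by (induction ss arbitrary: o') (auto intro!: sum_nonneg simp: overlap_nonneg simp del: insert_iff)

lemma mass_le: "set ss \<subseteq> substs \<Longrightarrow> mass ss o' \<le> \<beta> ^ length ss * overlap o'"
proof (induction ss arbitrary: o')
  case (Cons \<theta> ss)
  have "(\<Sum>(k, l)\<in>children \<theta> o'. mass ss (child \<theta> o' k l)) \<le>
    (\<Sum>(k, l)\<in>children \<theta> o'. \<beta> ^ length ss * overlap (child \<theta> o' k l))"
    using Cons by (auto intro!: sum_mono)
  also have "\<dots> = \<beta> ^ length ss * (\<Sum>(k, l)\<in>children \<theta> o'. overlap (child \<theta> o' k l))"
    by (simp add: sum_distrib_left case_prod_unfold)
  also have "\<dots> = \<beta> ^ length (\<theta> # ss) * overlap o'"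
    using Cons.prems by (subst sum_overlap_children) auto
  finally show ?case using beta(1) overlap_nonneg[of o'] by auto
qed (simp add: overlap_nonneg)

lemma overlap_swap: "overlap (swap_overlap o') = overlap o'"
proof -
  obtain d i j where o': "o' = (Ov d i j)" by (cases o')
  have "overlap (swap_overlap o') = seg 0 (width j) (- height d) (width i)"
    by (simp add: o' height_minus)
  also have "\<dots> = seg (height d) (width j) 0 (width i)"
    using seg_translate[of 0 "height d" "width j" "- height d" "width i"] by simp
  finally show ?thesis by (simp add: o' seg_commute)
qed

lemma mass_swap: "mass ss (swap_overlap o') = mass ss o'"
proof (induction ss arbitrary: o')
  case Nil
  then show ?case using overlap_swap[of o'] by (cases o') auto
next
  case (Cons \<theta> ss)
  obtain d i j where o': "o' = (Ov d i j)" by (cases o')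
  have mat_minus: "mat (- d) = - mat d" by (cases d) auto
  have "mass ss (child \<theta> (swap_overlap o') l k) = mass ss (child \<theta> o' k l)" for k l
    using Cons[of "child \<theta> o' k l"] by (simp add: o' mat_minus algebra_simps)
  then have "(\<Sum>l<length (\<theta> j). \<Sum>k<length (\<theta> i). mass ss (child \<theta> (swap_overlap o') l k)) =
    (\<Sum>k<length (\<theta> i). \<Sum>l<length (\<theta> j). mass ss (child \<theta> o' k l))"
    by (subst sum.swap) simp
  then have "(\<Sum>(k, l)\<in>children \<theta> (swap_overlap o'). mass ss (child \<theta> (swap_overlap o') k l)) =
    (\<Sum>(k, l)\<in>children \<theta> o'. mass ss (child \<theta> o' k l))"
    by (simp add: o' sum.cartesian_product)
  moreover have "coincident (swap_overlap o') = coincident o'" by (auto simp: o')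
  ultimately show ?case by simp
qed

section \<open>Coincidences cause a definite loss of overlap length\<close>

definition deficient :: "substitution list \<Rightarrow> overlap_type \<Rightarrow> bool" where
  "deficient ss o' \<longleftrightarrow> mass ss o' \<le> \<beta> ^ length ss * overlap o' - 1"

text \<open>A loss in one child is not compensated elsewhere: by \<open>mass_le\<close> the other
  children contribute at most their full length.\<close>

lemma deficient_Cons:
  assumes ss: "set (\<theta> # ss) \<subseteq> substs" and kl: "(k, l) \<in> children \<theta> o'"
    and def: "deficient ss (child \<theta> o' k l)"
  shows "deficient (\<theta> # ss) o'"
proof -
  have "(\<Sum>(k, l)\<in>children \<theta> o'. mass ss (child \<theta> o' k l)) =
    (\<Sum>(k, l)\<in>children \<theta> o' - {(k, l)}. mass ss (child \<theta> o' k l)) + mass ss (child \<theta> o' k l)"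
    using kl by (subst sum.remove[OF _ kl]) auto
  also have "\<dots> \<le> (\<Sum>(k, l)\<in>children \<theta> o' - {(k, l)}. \<beta> ^ length ss * overlap (child \<theta> o' k l))
       + (\<beta> ^ length ss * overlap (child \<theta> o' k l) - 1)"
    using def ss by (intro add_mono sum_mono) (auto simp: deficient_def intro: mass_le)
  also have "\<dots> = (\<Sum>(k, l)\<in>children \<theta> o'. \<beta> ^ length ss * overlap (child \<theta> o' k l)) - 1"
    using kl by (subst sum.remove[OF _ kl, of "\<lambda>(k, l). \<beta> ^ length ss * overlap (child \<theta> o' k l)"]) auto
  also have "\<dots> = \<beta> ^ length ss * (\<Sum>(k, l)\<in>children \<theta> o'. overlap (child \<theta> o' k l)) - 1"
    by (simp add: sum_distrib_left case_prod_unfold)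
  also have "\<dots> = \<beta> ^ length (\<theta> # ss) * overlap o' - 1"
    using ss by (subst sum_overlap_children) auto
  finally have *: "(\<Sum>(k, l)\<in>children \<theta> o'. mass ss (child \<theta> o' k l)) \<le> \<beta> ^ length (\<theta> # ss) * overlap o' - 1" .
  moreover have "0 \<le> (\<Sum>(k, l)\<in>children \<theta> o'. mass ss (child \<theta> o' k l))"
    by (auto intro!: sum_nonneg mass_nonneg)
  ultimately show ?thesis by (auto simp: deficient_def)
qed

text \<open>The constant 1 in \<open>deficient\<close> is the smallest tile width. A coincidence
  discards the whole inflated tile, whose length is at least that.\<close>

lemma deficient_coincident: "deficient ss (Ov 0 i i)"
proof -
  have "mass ss (Ov 0 i i) = 0" by (cases ss) auto
  moreover have "1 * 1 \<le> \<beta> ^ length ss * width i"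
    using beta(1) width_ge_1[of i] by (intro mult_mono) auto
  moreover have "overlap (Ov 0 i i) = width i" using width_pos[of i] by (simp add: seg_def)
  ultimately show ?thesis by (simp add: deficient_def)
qed

lemma subst_first:
  "\<theta> \<in> substs \<Longrightarrow> \<theta>' \<in> substs \<Longrightarrow> \<theta>' (\<theta> i ! 0) ! 0 = La" "\<theta> \<in> substs \<Longrightarrow> \<theta> i \<noteq> []"
  by (cases i; auto)+

text \<open>First letters evolve by a to a, b to c, c to a under both substitutions, so after two of
  them every image begins with a. Two tiles with a common left end thus produce coincident first
  subtiles.\<close>

lemma deficient_zero:
  assumes "set ss \<subseteq> substs" "2 \<le> length ss"
  shows "deficient ss (Ov 0 i j)"
proof -
  obtain \<theta> \<theta>' ss' where ss: "ss = \<theta> # \<theta>' # ss'"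
    using assms(2) by (metis Suc_le_length_iff numeral_2_eq_2)
  have th: "\<theta> \<in> substs" "\<theta>' \<in> substs" using assms by (auto simp: ss)
  have "deficient ss' (child \<theta>' (child \<theta> (Ov 0 i j) 0 0) 0 0)"
    using th by (simp add: subst_first deficient_coincident del: insert_iff)
  then show ?thesis
    using assms(1) subst_first(2) th unfolding ss by (intro deficient_Cons[of _ _ 0 0]) (auto simp del: insert_iff)
qed

text \<open>The left end of the second tile stays the left end of its first subtile, while
  \<open>locate\<close> follows the subtile of the first tile that contains this point. After
  \<open>n\<close> steps the left ends agree, and two more substitutions give the
  coincidence.\<close>

lemma deficient_terminates:
  assumes "terminates_within n d i" "0 \<le> height d" "height d < width i" "set ss \<subseteq> substs" "n + 2 \<le> length ss"
  shows "deficient ss (Ov d i j)"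
  using assms
proof (induction n arbitrary: d i j ss)
  case 0
  then show ?case by (simp add: deficient_zero)
next
  case (Suc n)
  then obtain \<theta> ss' where ss: "ss = \<theta> # ss'" by (cases ss) auto
  then have th: "\<theta> \<in> substs" "set ss' \<subseteq> substs" using Suc.prems by auto
  obtain e i' where e: "locate \<theta> d i e i'" using locate_exists th(1) Suc.prems by blast
  then obtain p q where p: "\<theta> i = p @ i' # q" "e = mat d - abel p" "0 \<le> height e" "height e < width i'"
    by (auto simp: locate_def)
  have "deficient ss' (Ov e i' (\<theta> j ! 0))"
  proof (rule Suc.IH)
    show "terminates_within n e i'" using Suc.prems(1) th(1) e unfolding terminates_within.simps by blast
  qed (use Suc.prems p th in \<open>auto simp: ss simp del: insert_iff\<close>)
  also have "(Ov e i' (\<theta> j ! 0)) = child \<theta> (Ov d i j) (length p) 0"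
    using p by simp
  finally show ?case
    unfolding ss using Suc.prems(4) subst_first(2)[OF th(1)] p
    by (intro deficient_Cons[of _ _ "length p" 0]) (auto simp: ss simp del: insert_iff)
qed

text \<open>When the second tile begins first, the roles of the two tiles are exchanged by
  \<open>swap_overlap\<close>, under which mass is invariant.\<close>

lemma ex_deficient:
  assumes "0 < overlap o'"
  shows "\<exists>n. \<forall>ss. set ss \<subseteq> substs \<longrightarrow> n \<le> length ss \<longrightarrow> deficient ss o'"
proof -
  obtain d i j where o': "o' = (Ov d i j)" by (cases o')
  have h: "- width j < height d" "height d < width i"
    using assms by (auto simp: o' seg_def max_def min_def split: if_splits)
  show ?thesis
  proof (cases "0 \<le> height d")
    case True
    then show ?thesis
      using ex_terminates_within[OF True h(2)] deficient_terminates[OF _ True h(2)] o' by blast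
  next
    case False
    have h': "0 \<le> height (- d)" "height (- d) < width j" using False h by (auto simp: height_minus)
    obtain n where n: "terminates_within n (- d) j" using ex_terminates_within[OF h'] by blast
    have "deficient ss o'" if "set ss \<subseteq> substs" "n + 2 \<le> length ss" for ss
      using deficient_terminates[OF n h' that, of i] mass_swap[of ss o'] overlap_swap[of o']
      by (simp add: deficient_def o')
    then show ?thesis by blast
  qed
qed

lemma width_le_5: "width i \<le> 5"
  using beta beta_sq by (cases i) auto

lemma overlap_le_5: "overlap o' \<le> 5"
proof -
  obtain d i j where o': "o' = (Ov d i j)" by (cases o')
  show ?thesis using width_le_5[of i] by (auto simp: o' seg_def)
qed

lemma overlap_height: "0 < overlap (Ov d i j) \<Longrightarrow> \<bar>height d\<bar> < 5"
  using width_le_5[of i] width_le_5[of j]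
  by (auto simp: seg_def max_def min_def split: if_splits)

text \<open>An absolute loss of 1 is a proportional loss of at least 1 / 5, because no overlap is
  longer than 5. Finiteness of \<open>A\<close> allows a single number of steps.\<close>

lemma ex_mass_contraction:
  assumes "finite A"
  shows "\<exists>n>0. \<forall>o'\<in>A. \<forall>ss. set ss \<subseteq> substs \<longrightarrow> length ss = n \<longrightarrow> mass ss o' \<le> (\<beta> ^ n - 1 / 5) * overlap o'"
proof -
  have "\<forall>o'. \<exists>n. 0 < overlap o' \<longrightarrow> (\<forall>ss. set ss \<subseteq> substs \<longrightarrow> n \<le> length ss \<longrightarrow> deficient ss o')"
    using ex_deficient by blast
  then obtain N where N: "\<And>o' ss. 0 < overlap o' \<Longrightarrow> set ss \<subseteq> substs \<Longrightarrow> N o' \<le> length ss \<Longrightarrow> deficient ss o'"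
    by metis
  define n where "n = Suc (\<Sum>o'\<in>A. N o')"
  have "mass ss o' \<le> (\<beta> ^ n - 1 / 5) * overlap o'" if "o' \<in> A" "set ss \<subseteq> substs" "length ss = n" for o' ss
  proof (cases "overlap o' = 0")
    case True
    then show ?thesis using mass_le[OF that(2), of o'] by simp
  next
    case False
    then have "0 < overlap o'" using overlap_nonneg[of o'] by linarith
    moreover have "N o' \<le> n" unfolding n_def using member_le_sum[OF that(1), of N] assms by simp
    ultimately have "deficient ss o'" using N that by simp
    then show ?thesis using overlap_le_5[of o'] that(3) by (simp add: deficient_def algebra_simps)
  qed
  then show ?thesis by (intro exI[of _ n]) (simp add: n_def)
qed

text \<open>The bound for \<open>ss'\<close> is applied to each descendant left over by
  \<open>ss\<close>, and closure of \<open>A\<close> under \<open>child\<close> keeps these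
  descendants within its range.\<close>

lemma mass_append:
  assumes closed: "\<And>o' \<theta> k l. o' \<in> A \<Longrightarrow> \<theta> \<in> substs \<Longrightarrow> (k, l) \<in> children \<theta> o' \<Longrightarrow> child \<theta> o' k l \<in> A"
    and B: "\<And>o'. o' \<in> A \<Longrightarrow> mass ss' o' \<le> B * overlap o'"
    and "set ss \<subseteq> substs" "o' \<in> A"
  shows "mass (ss @ ss') o' \<le> B * mass ss o'"
  using assms(3,4)
proof (induction ss arbitrary: o')
  case Nil
  moreover have "mass ss' o' = 0" if "coincident o'" using that by (cases ss') auto
  ultimately show ?case using B by auto
next
  case (Cons \<theta> ss)
  have "(\<Sum>(k, l)\<in>children \<theta> o'. mass (ss @ ss') (child \<theta> o' k l)) \<le>
    (\<Sum>(k, l)\<in>children \<theta> o'. B * mass ss (child \<theta> o' k l))"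
    using Cons.prems by (intro sum_mono) (auto intro!: Cons.IH closed)
  also have "\<dots> = B * (\<Sum>(k, l)\<in>children \<theta> o'. mass ss (child \<theta> o' k l))"
    by (simp add: sum_distrib_left case_prod_unfold)
  finally show ?case by simp
qed

lemma mass_power:
  assumes closed: "\<And>o' \<theta> k l. o' \<in> A \<Longrightarrow> \<theta> \<in> substs \<Longrightarrow> (k, l) \<in> children \<theta> o' \<Longrightarrow> child \<theta> o' k l \<in> A"
    and B: "\<And>o' ss. o' \<in> A \<Longrightarrow> set ss \<subseteq> substs \<Longrightarrow> length ss = n \<Longrightarrow> mass ss o' \<le> B * overlap o'"
    and "0 \<le> B" "set ss \<subseteq> substs" "length ss = m * n" "o' \<in> A"
  shows "mass ss o' \<le> B ^ m * overlap o'"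
  using assms(4-6)
proof (induction m arbitrary: o' ss)
  case 0
  then show ?case by (auto simp: overlap_nonneg)
next
  case (Suc m)
  define s1 where "s1 = take n ss"
  define s2 where "s2 = drop n ss"
  have s12: "ss = s1 @ s2" "set s1 \<subseteq> substs" "set s2 \<subseteq> substs" "length s1 = n" "length s2 = m * n"
    using Suc.prems set_take_subset[of n ss] set_drop_subset[of n ss] unfolding s1_def s2_def by auto
  have "mass (s1 @ s2) o' \<le> B ^ m * mass s1 o'"
    by (rule mass_append[of A]) (use closed Suc.IH s12 Suc.prems in auto)
  also have "\<dots> \<le> B ^ m * (B * overlap o')"
    using B s12 Suc.prems assms(3) by (intro mult_left_mono) auto
  finally show ?case using s12 by (simp add: mult.assoc mult.left_commute)
qed

section \<open>Finitely many overlap types and the count of offsets\<close>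

definition bounded_overlaps :: "real \<Rightarrow> overlap_type set" where
  "bounded_overlaps B = (\<lambda>(d, i, j). Ov d i j) ` ({d. norm (proj d) \<le> B \<and> \<bar>height d\<bar> \<le> 5} \<times> UNIV \<times> UNIV)"

lemma mem_bounded_overlaps: "Ov d i j \<in> bounded_overlaps B \<longleftrightarrow> norm (proj d) \<le> B \<and> \<bar>height d\<bar> \<le> 5"
proof -
  have "inj (\<lambda>(d, i, j). Ov d i j)" by (auto simp: inj_def)
  from inj_image_mem_iff[OF this, of "(d, i, j)"] show ?thesis by (simp add: bounded_overlaps_def)
qed

text \<open>The difference of the two projections is (\<alpha> - \<beta>) * (x * (\<alpha> +
  \<beta>) + z). Its size bounds x through the imaginary part, then z, and finally
  \<open>height\<close> bounds y.\<close>

lemma finite_bounded_vec: "finite {d. norm (proj d) \<le> B \<and> \<bar>height d\<bar> \<le> C}" (is "finite ?S")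
proof -
  define T where "T = (B + C) / norm (\<alpha> - \<beta>)"
  define X where "X = T / Im \<alpha>"
  define Z where "Z = T + X * norm (\<alpha> + \<beta>)"
  define Y where "Y = C + X * \<beta>^2 + Z * \<beta>"
  have ne: "\<alpha> - complex_of_real \<beta> \<noteq> 0"
    using Im_alpha by (metis Im_complex_of_real less_irrefl right_minus_eq)
  have "?S \<subseteq> {-\<lceil>X\<rceil>..\<lceil>X\<rceil>} \<times> {-\<lceil>Y\<rceil>..\<lceil>Y\<rceil>} \<times> {-\<lceil>Z\<rceil>..\<lceil>Z\<rceil>}"
  proof
    fix d assume d: "d \<in> ?S"
    obtain x y z where xyz: "d = (x, y, z)" by (cases d)
    define w where "w = of_int x * (\<alpha> + \<beta>) + of_int z"
    have "proj d - height d = (\<alpha> - \<beta>) * w"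
      by (simp add: xyz w_def algebra_simps power2_eq_square)
    moreover have "norm (proj d - height d) \<le> B + C"
      using d norm_triangle_ineq4[of "proj d" "height d"] by simp
    ultimately have "norm (\<alpha> - \<beta>) * norm w \<le> B + C" by (simp only: norm_mult)
    then have w: "norm w \<le> T"
      using ne by (simp add: T_def field_simps)
    have "\<bar>of_int x * Im \<alpha>\<bar> \<le> T"
      using w abs_Im_le_cmod[of w] by (simp add: w_def)
    then have x: "\<bar>of_int x\<bar> \<le> X"
      using Im_alpha by (simp add: X_def abs_mult field_simps)
    have "norm (of_int z :: complex) \<le> norm w + norm (of_int x * (\<alpha> + \<beta>))"
      using norm_triangle_ineq4[of w "of_int x * (\<alpha> + \<beta>)"] by (simp add: w_def)
    also have "\<dots> \<le> Z"
      using w x by (auto simp: Z_def norm_mult intro!: add_mono mult_right_mono)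
    finally have z: "\<bar>of_int z\<bar> \<le> Z" by simp
    have "\<bar>of_int y\<bar> = \<bar>height d - of_int x * \<beta>^2 - of_int z * \<beta>\<bar>" by (simp add: xyz)
    also have "\<dots> \<le> \<bar>height d\<bar> + \<bar>of_int x * \<beta>^2\<bar> + \<bar>of_int z * \<beta>\<bar>" by linarith
    also have "\<dots> \<le> Y"
      using d x z beta by (auto simp: Y_def abs_mult intro!: add_mono mult_right_mono)
    finally have y: "\<bar>of_int y\<bar> \<le> Y" .
    have "\<bar>k\<bar> \<le> \<lceil>t\<rceil>" if "\<bar>of_int k\<bar> \<le> t" for k :: int and t :: real
      using that by linarith
    with x y z show "d \<in> {-\<lceil>X\<rceil>..\<lceil>X\<rceil>} \<times> {-\<lceil>Y\<rceil>..\<lceil>Y\<rceil>} \<times> {-\<lceil>Z\<rceil>..\<lceil>Z\<rceil>}"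
      unfolding xyz by (fastforce simp: abs_le_iff)
  qed
  then show ?thesis by (rule finite_subset) simp
qed

lemma finite_bounded_overlaps: "finite (bounded_overlaps B)"
  using finite_bounded_vec by (simp add: bounded_overlaps_def)

lemma norm_proj_take:
  assumes "\<theta> \<in> substs"
  shows "norm (proj (abel (take k (\<theta> i)))) \<le> 4"
proof -
  have u: "norm (proj (unit x)) \<le> 1" for x
    using norm_alpha by (cases x) (auto simp: norm_power power_le_one)
  have "norm (proj (abel w)) \<le> real (length w)" for w
  proof (induction w)
    case (Cons x w)
    then show ?case
      using norm_triangle_ineq[of "proj (unit x)" "proj (abel w)"] u[of x] by (simp add: proj_add)
  qed simp
  from this[of "take k (\<theta> i)"] show ?thesis
    using assms by (cases i) auto
qed

text \<open>The fixed point of r = |\<alpha>| * r + 4, where 4 bounds the projected prefixes in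
  \<open>norm_proj_take\<close>. A relative position involves two such prefixes, so the
  corresponding invariant bound is 2 * \<open>radius\<close>.\<close>

definition radius :: real where "radius = 4 / (1 - norm \<alpha>)"

lemma radius: "norm \<alpha> * radius + 4 = radius" "0 < radius"
  using norm_alpha by (auto simp: radius_def field_simps)

lemma sum_nonneg_eq_zero: "finite A \<Longrightarrow> (\<And>x. x \<in> A \<Longrightarrow> 0 \<le> f x) \<Longrightarrow> sum f A \<le> 0 \<Longrightarrow> x \<in> A \<Longrightarrow> f x = (0::real)"
  by (metis order_antisym sum_nonneg sum_nonneg_eq_0_iff)

lemma overlap_child_pos:
  assumes "\<theta> \<in> substs" "(k, l) \<in> children \<theta> o'" "0 < overlap (child \<theta> o' k l)"
  shows "0 < overlap o'"
proof (rule ccontr)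
  assume "\<not> 0 < overlap o'"
  then have "overlap o' = 0" using overlap_nonneg[of o'] by linarith
  then have "(\<Sum>(k, l)\<in>children \<theta> o'. overlap (child \<theta> o' k l)) \<le> 0"
    using assms(1) by (subst sum_overlap_children) auto
  then show False
    using sum_nonneg_eq_zero[of "children \<theta> o'" "\<lambda>(k, l). overlap (child \<theta> o' k l)" "(k, l)"]
      overlap_nonneg assms by auto
qed

text \<open>\<open>bounded_overlaps\<close> alone is not closed under \<open>child\<close>, as
  disjoint subtiles may be far apart. Types of overlap 0 are added: their children again have
  overlap 0 and they contribute no mass.\<close>

definition relevant :: "overlap_type set" where
  "relevant = bounded_overlaps (2 * radius) \<union> {o'. overlap o' = 0}"

lemma child_relevant:
  assumes "o' \<in> relevant" "\<theta> \<in> substs" "(k, l) \<in> children \<theta> o'"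
  shows "child \<theta> o' k l \<in> relevant"
proof (cases "overlap (child \<theta> o' k l) = 0")
  case False
  then have pos: "0 < overlap (child \<theta> o' k l)" using overlap_nonneg by (metis order_le_less)
  then have "0 < overlap o'" by (rule overlap_child_pos[OF assms(2,3)])
  moreover obtain d i j where o': "o' = Ov d i j" by (cases o')
  ultimately have d: "norm (proj d) \<le> 2 * radius" using assms(1) by (auto simp: relevant_def mem_bounded_overlaps)
  define e where "e = mat d + abel (take l (\<theta> j)) - abel (take k (\<theta> i))"
  have "norm (proj e) \<le> norm \<alpha> * norm (proj d) + norm (proj (abel (take l (\<theta> j)))) + norm (proj (abel (take k (\<theta> i))))"
    unfolding e_def proj_diff proj_add proj_mat
    by (intro order_trans[OF norm_triangle_ineq4] add_mono order_trans[OF norm_triangle_ineq]) (auto simp: norm_mult)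
  also have "\<dots> \<le> norm \<alpha> * (2 * radius) + 4 + 4"
    using assms(2) d by (intro add_mono norm_proj_take mult_left_mono) auto
  also have "\<dots> = 2 * radius" using radius by simp
  finally have "norm (proj e) \<le> 2 * radius" .
  moreover have "\<bar>height e\<bar> < 5"
    using pos unfolding o' child.simps e_def[symmetric] by (rule overlap_height)
  ultimately have "Ov e (\<theta> i ! k) (\<theta> j ! l) \<in> bounded_overlaps (2 * radius)"
    by (simp add: mem_bounded_overlaps)
  then show ?thesis by (simp add: relevant_def o' e_def)
qed (simp add: relevant_def)

text \<open>Positions, inside the inflation of an overlap, of the non-coincident overlaps
  of the bottom level.\<close>

primrec offsets :: "substitution list \<Rightarrow> overlap_type \<Rightarrow> complex set" where
  "offsets [] o' = (if coincident o' \<or> overlap o' = 0 then {} else {0})"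
| "offsets (\<theta> # ss) o' = (if coincident o' \<or> overlap o' = 0 then {} else
     \<Union>(k, l)\<in>children \<theta> o'. (\<lambda>e. \<alpha> ^ length ss * proj (abel (take k (\<theta> (case o' of Ov d i j \<Rightarrow> i)))) + e) ` offsets ss (child \<theta> o' k l))"

lemma finite_offsets: "finite (offsets ss o')"
  by (induction ss arbitrary: o') auto

text \<open>Each offset stems from a bottom-level overlap of length at least \<open>c\<close>, so
  counting is controlled by mass.\<close>

lemma card_offsets:
  assumes "\<And>o'. o' \<in> relevant \<Longrightarrow> 0 < overlap o' \<Longrightarrow> c \<le> overlap o'"
    and "set ss \<subseteq> substs" "o' \<in> relevant" "0 < c"
  shows "real (card (offsets ss o')) * c \<le> mass ss o'"
  using assms(2,3)
proof (induction ss arbitrary: o')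
  case Nil
  then show ?case using assms(1)[of o'] overlap_nonneg[of o'] by (auto simp: order_le_less)
next
  case (Cons \<theta> ss)
  show ?case
  proof (cases "coincident o' \<or> overlap o' = 0")
    case True
    then show ?thesis using mass_nonneg[of "\<theta> # ss" o'] by simp
  next
    case False
    let ?f = "\<lambda>k e. \<alpha> ^ length ss * proj (abel (take k (\<theta> (case o' of Ov d i j \<Rightarrow> i)))) + e"
    have "card (offsets (\<theta> # ss) o') \<le> (\<Sum>(k, l)\<in>children \<theta> o'. card (?f k ` offsets ss (child \<theta> o' k l)))"
      using False card_UN_le[of "children \<theta> o'" "\<lambda>(k, l). ?f k ` offsets ss (child \<theta> o' k l)"]
      by (simp add: case_prod_unfold)
    also have "\<dots> \<le> (\<Sum>(k, l)\<in>children \<theta> o'. card (offsets ss (child \<theta> o' k l)))"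
      using finite_offsets by (auto intro!: sum_mono card_image_le)
    finally have "real (card (offsets (\<theta> # ss) o')) * c \<le> real (\<Sum>(k, l)\<in>children \<theta> o'. card (offsets ss (child \<theta> o' k l))) * c"
      using assms(4) by (intro mult_right_mono of_nat_mono) auto
    also have "\<dots> = (\<Sum>(k, l)\<in>children \<theta> o'. real (card (offsets ss (child \<theta> o' k l))) * c)"
      by (simp add: sum_distrib_right case_prod_unfold)
    also have "\<dots> \<le> (\<Sum>(k, l)\<in>children \<theta> o'. mass ss (child \<theta> o' k l))"
      using Cons by (intro sum_mono) (auto intro!: child_relevant simp del: insert_iff)
    finally show ?thesis using False by simp
  qed
qed

lemma ex_card_offsets_bound:
  "\<exists>n>0. \<exists>C B. 0 \<le> B \<and> B < \<beta> ^ n \<and> (\<forall>m ss o'. o' \<in> bounded_overlaps (2 * radius) \<longrightarrow> set ss \<subseteq> substs \<longrightarrow> length ss = m * n \<longrightarrow>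
     real (card (offsets ss o')) \<le> C * B ^ m)"
proof -
  define O' where "O' = bounded_overlaps (2 * radius)"
  have fin: "finite O'" by (simp only: O'_def finite_bounded_overlaps)
  \<comment> \<open>The inserted 1 only guarantees that the minimum is taken over a nonempty
    set.\<close>
  define c where "c = Min (insert 1 (overlap ` {o'\<in>O'. 0 < overlap o'}))"
  have "finite (insert 1 (overlap ` {o'\<in>O'. 0 < overlap o'}))" using fin by simp
  note c = Min_in[OF this, folded c_def] Min_le[OF this, folded c_def]
  have c0: "0 < c" using c(1) by auto
  have c1: "c \<le> overlap o'" if "o' \<in> relevant" "0 < overlap o'" for o'
    using c(2)[of "overlap o'"] that by (auto simp: relevant_def O'_def)
  obtain n where n: "n > 0" "\<And>o' ss. o' \<in> O' \<Longrightarrow> set ss \<subseteq> substs \<Longrightarrow> length ss = n \<Longrightarrow> mass ss o' \<le> (\<beta> ^ n - 1 / 5) * overlap o'"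
    using ex_mass_contraction[OF fin] by blast
  define B where "B = \<beta> ^ n - 1 / 5"
  have "1 \<le> \<beta> ^ n" using beta(1) by (intro one_le_power) auto
  then have B: "0 \<le> B" "B < \<beta> ^ n" by (auto simp: B_def)
  have *: "mass ss o' \<le> B * overlap o'" if "o' \<in> relevant" "set ss \<subseteq> substs" "length ss = n" for o' ss
  proof (cases "overlap o' = 0")
    case True
    then show ?thesis using mass_le[OF that(2), of o'] by simp
  next
    case False
    then show ?thesis using n(2) that by (simp add: B_def relevant_def O'_def)
  qed
  have "real (card (offsets ss o')) \<le> (5 / c) * B ^ m"
    if o': "o' \<in> bounded_overlaps (2 * radius)" and ss: "set ss \<subseteq> substs" "length ss = m * n" for m ss o'
  proof -
    have rel: "o' \<in> relevant" using o' by (simp add: relevant_def)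
    have "real (card (offsets ss o')) * c \<le> mass ss o'" by (rule card_offsets[OF c1 ss(1) rel c0])
    also have "\<dots> \<le> B ^ m * overlap o'"
      by (rule mass_power[OF child_relevant * B(1) ss rel])
    also have "\<dots> \<le> B ^ m * 5" using B overlap_le_5 by (intro mult_left_mono) auto
    finally show ?thesis using c0 by (simp add: field_simps)
  qed
  with n(1) B show ?thesis by blast
qed

section \<open>The subshift and its walk\<close>

text \<open>The discrete metric on letters makes the space of infinite words metrizable, in
  particular Hausdorff, so that its compact subsets are closed.\<close>

instantiation letter :: metric_space
begin

definition dist_letter :: "letter \<Rightarrow> letter \<Rightarrow> real" where
  "dist_letter x y = (if x = y then 0 else 1)"

definition uniformity_letter :: "(letter \<times> letter) filter" where
  "uniformity_letter = (INF e\<in>{0 <..}. principal {(x, y). dist x y < e})"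

instance
proof
  fix U :: "letter set"
  have "open U" by (rule discrete_topology_class.open_discrete)
  moreover have "\<forall>x\<in>U. \<forall>\<^sub>F (x', y) in uniformity. x' = x \<longrightarrow> y \<in> U"
    unfolding uniformity_letter_def
    by (intro ballI eventually_INF1[of 1]) (auto simp: dist_letter_def eventually_principal)
  ultimately show "open U \<longleftrightarrow> (\<forall>x\<in>U. \<forall>\<^sub>F (x', y) in uniformity. x' = x \<longrightarrow> y \<in> U)" by blast
qed (auto simp: uniformity_letter_def dist_letter_def)

end

definition pre :: "(nat \<Rightarrow> letter) \<Rightarrow> nat \<Rightarrow> letter list" where
  "pre x n = map x [0..<n]"

text \<open>The images of letters under the two substitutions are nonempty, so the first i + 1
  letters of \<open>x\<close> already determine the letter with index i of the image.\<close>

definition inf_subst :: "substitution \<Rightarrow> (nat \<Rightarrow> letter) \<Rightarrow> nat \<Rightarrow> letter" where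
  "inf_subst \<theta> x i = apply_subst \<theta> (pre x (Suc i)) ! i"

lemma length_pre [simp]: "length (pre x n) = n"
  by (simp add: pre_def)

lemma pre_nth [simp]: "i < n \<Longrightarrow> pre x n ! i = x i"
  by (simp add: pre_def)

lemma pre_Suc: "pre x (Suc n) = pre x n @ [x n]"
  by (simp add: pre_def)

lemma shift_funpow: "(left_shift ^^ n) x = (\<lambda>i. x (n + i))"
  by (induction n) (auto simp: left_shift_def)

lemma pre_add: "pre x (n + m) = pre x n @ pre ((left_shift ^^ n) x) m"
  by (induction m) (simp_all add: pre_Suc shift_funpow, simp add: pre_def)

lemma pre_cong: "(\<And>i. i < n \<Longrightarrow> x i = y i) \<Longrightarrow> pre x n = pre y n"
  by (simp add: pre_def)

lemma apply_subst_simps [simp]: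
  "apply_subst \<theta> [] = []" "apply_subst \<theta> (i # w) = \<theta> i @ apply_subst \<theta> w"
  by (simp_all add: apply_subst_def)

lemma length_apply_subst:
  assumes "\<theta> \<in> substs"
  shows "length w \<le> length (apply_subst \<theta> w)"
proof (induction w)
  case (Cons i w)
  have "\<theta> i \<noteq> []" using subst_first(2)[OF assms] .
  then have "1 \<le> length (\<theta> i)" by (cases "\<theta> i") auto
  then show ?case using Cons by auto
qed simp

lemma inf_subst_nth:
  assumes "\<theta> \<in> substs" "i < length (apply_subst \<theta> (pre x n))"
  shows "inf_subst \<theta> x i = apply_subst \<theta> (pre x n) ! i"
proof (cases "n \<le> Suc i")
  case True
  then have "pre x (Suc i) = pre x n @ pre ((left_shift ^^ n) x) (Suc i - n)"
    using pre_add[of x n "Suc i - n"] by simp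
  then show ?thesis using assms(2) by (simp add: inf_subst_def apply_subst_append nth_append)
next
  case False
  then have "pre x n = pre x (Suc i) @ pre ((left_shift ^^ Suc i) x) (n - Suc i)"
    using pre_add[of x "Suc i" "n - Suc i"] by simp
  moreover have "i < length (apply_subst \<theta> (pre x (Suc i)))"
    using length_apply_subst[OF assms(1), of "pre x (Suc i)"] by simp
  ultimately show ?thesis by (simp add: inf_subst_def apply_subst_append nth_append)
qed

lemma pre_inf_subst:
  assumes "\<theta> \<in> substs"
  shows "pre (inf_subst \<theta> x) (length (apply_subst \<theta> (pre x n))) = apply_subst \<theta> (pre x n)"
  by (rule nth_equalityI) (use inf_subst_nth[OF assms] in auto)

lemma shift_inf_subst:
  assumes "\<theta> \<in> substs"
  shows "(left_shift ^^ length (apply_subst \<theta> (pre x n))) (inf_subst \<theta> x) = inf_subst \<theta> ((left_shift ^^ n) x)"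
proof
  fix i
  have "i < length (apply_subst \<theta> (pre ((left_shift ^^ n) x) (Suc i)))"
    using length_apply_subst[OF assms, of "pre ((left_shift ^^ n) x) (Suc i)"] by simp
  then have "inf_subst \<theta> x (length (apply_subst \<theta> (pre x n)) + i) = apply_subst \<theta> (pre x (n + Suc i)) ! (length (apply_subst \<theta> (pre x n)) + i)"
    by (intro inf_subst_nth[OF assms]) (simp add: pre_add apply_subst_append del: add_Suc_right)
  then show "(left_shift ^^ length (apply_subst \<theta> (pre x n))) (inf_subst \<theta> x) i = inf_subst \<theta> ((left_shift ^^ n) x) i"
    by (simp add: shift_funpow[of "length (apply_subst \<theta> (pre x n))"] pre_add apply_subst_append nth_append inf_subst_def[of \<theta> _ i] del: add_Suc_right)
qed

lemma pre_inf_subst_take: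
  assumes "\<theta> \<in> substs" "k \<le> length (\<theta> (x 0))"
  shows "pre (inf_subst \<theta> x) k = take k (\<theta> (x 0))"
proof -
  have "pre (inf_subst \<theta> x) (length (\<theta> (x 0))) = \<theta> (x 0)"
    using pre_inf_subst[OF assms(1), of x 1] by (simp add: pre_def)
  moreover have "pre y k = take k (pre y n)" if "k \<le> n" for y n
    using that by (simp add: pre_def take_map min_def)
  ultimately show ?thesis using assms(2) by metis
qed

lemma inf_subst_block:
  assumes "\<theta> \<in> substs" "k < length (\<theta> (x 0))"
  shows "inf_subst \<theta> x k = \<theta> (x 0) ! k"
  using inf_subst_nth[OF assms(1), of k x 1] assms(2) by (simp add: pre_def)

lemma position_split:
  assumes "\<theta> \<in> substs"
  shows "\<exists>n k. N = length (apply_subst \<theta> (pre x n)) + k \<and> k < length (\<theta> (x n))"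
proof (induction N)
  case 0
  then show ?case using subst_first(2)[OF assms, of "x 0"] by (intro exI[of _ 0]) (simp add: pre_def)
next
  case (Suc N)
  then obtain n k where nk: "N = length (apply_subst \<theta> (pre x n)) + k" "k < length (\<theta> (x n))" by auto
  show ?case
  proof (cases "Suc k < length (\<theta> (x n))")
    case True
    then show ?thesis using nk by (intro exI[of _ n] exI[of _ "Suc k"]) auto
  next
    case False
    then show ?thesis using nk subst_first(2)[OF assms, of "x (Suc n)"]
      by (intro exI[of _ "Suc n"] exI[of _ 0]) (auto simp: pre_Suc apply_subst_append)
  qed
qed

section \<open>The projected walk and its boundedness\<close>

definition walk :: "(nat \<Rightarrow> letter) \<Rightarrow> nat \<Rightarrow> complex" where
  "walk x n = proj (abel (pre x n))"

lemma walk_0 [simp]: "walk x 0 = 0"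
  by (simp add: walk_def pre_def)

lemma walk_Suc: "walk x (Suc n) = walk x n + proj (unit (x n))"
  by (simp add: walk_def pre_Suc proj_add)

lemma walk_add: "walk x (n + m) = walk x n + walk ((left_shift ^^ n) x) m"
  by (simp add: walk_def pre_add proj_add)

lemma walk_inf_subst:
  assumes "\<theta> \<in> substs" "k \<le> length (\<theta> (x n))"
  shows "walk (inf_subst \<theta> x) (length (apply_subst \<theta> (pre x n)) + k) = \<alpha> * walk x n + proj (abel (take k (\<theta> (x n))))"
proof -
  have "walk (inf_subst \<theta> x) (length (apply_subst \<theta> (pre x n)) + k) =
    walk (inf_subst \<theta> x) (length (apply_subst \<theta> (pre x n))) + walk (inf_subst \<theta> ((left_shift ^^ n) x)) k"
    by (simp only: walk_add shift_inf_subst[OF assms(1)])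
  moreover have "walk (inf_subst \<theta> ((left_shift ^^ n) x)) k = proj (abel (take k (\<theta> (x n))))"
    using assms(2) pre_inf_subst_take[OF assms(1), of k "(left_shift ^^ n) x"] by (simp add: walk_def shift_funpow)
  moreover have "walk (inf_subst \<theta> x) (length (apply_subst \<theta> (pre x n))) = \<alpha> * walk x n"
    using assms(1) by (simp add: walk_def pre_inf_subst abel_apply_subst proj_mat del: insert_iff)
  ultimately show ?thesis by simp
qed

definition directive :: "(nat \<Rightarrow> substitution) \<Rightarrow> bool" where
  "directive s \<longleftrightarrow> (\<forall>n. s n \<in> substs)"

lemma directiveD: "directive s \<Longrightarrow> s n \<in> substs"
  by (simp add: directive_def)

lemma directive_shift: "directive s \<Longrightarrow> directive (\<lambda>m. s (n + m))"
  by (simp add: directive_def)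

definition limit_word :: "(nat \<Rightarrow> substitution) \<Rightarrow> nat \<Rightarrow> letter" where
  "limit_word s = (THE u. words_tendsto (\<lambda>n. comp_subst s n [La]) u)"

lemma limit_word: "directive s \<Longrightarrow> words_tendsto (\<lambda>n. comp_subst s n [La]) (limit_word s)"
  unfolding limit_word_def by (rule theI'[OF ex1_limit_word]) (simp only: directiveD)

lemma limit_word_unique: "directive s \<Longrightarrow> words_tendsto (\<lambda>n. comp_subst s n [La]) u \<Longrightarrow> u = limit_word s"
  using ex1_limit_word[of s] limit_word[of s] unfolding directive_def by blast

text \<open>The recursive definition adds the innermost factor; desubstitution has to remove the
  outermost one.\<close>

lemma comp_subst_Suc: "comp_subst s (Suc n) w = apply_subst (s 0) (comp_subst (\<lambda>m. s (Suc m)) n w)"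
  by (induction n arbitrary: w) auto

lemma words_tendsto_prefix:
  assumes "words_tendsto w u"
  shows "\<forall>\<^sub>F n in sequentially. N \<le> length (w n) \<and> take N (w n) = pre u N"
proof -
  have "\<forall>\<^sub>F n in sequentially. \<forall>i\<in>{..<N}. i < length (w n) \<and> w n ! i = u i"
    using assms by (subst eventually_ball_finite_distrib) (auto simp: words_tendsto_def)
  moreover have "N \<le> length (w n) \<and> take N (w n) = pre u N" if *: "\<forall>i\<in>{..<N}. i < length (w n) \<and> w n ! i = u i" for n
  proof -
    have "N \<le> length (w n)"
    proof (rule ccontr)
      assume "\<not> N \<le> length (w n)"
      then show False using *[THEN bspec, of "length (w n)"] by auto
    qed
    then show ?thesis using * by (auto intro!: nth_equalityI)
  qed
  ultimately show ?thesis by (rule eventually_mono)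
qed

lemma limit_word_desubstitute:
  assumes "directive s"
  shows "limit_word s = inf_subst (s 0) (limit_word (\<lambda>m. s (1 + m)))"
proof (rule limit_word_unique[OF assms, symmetric])
  define u where "u = limit_word (\<lambda>m. s (1 + m))"
  have th: "s 0 \<in> substs" by (rule directiveD[OF assms])
  have u: "words_tendsto (\<lambda>n. comp_subst (\<lambda>m. s (1 + m)) n [La]) u"
    unfolding u_def by (rule limit_word[OF directive_shift[OF assms]])
  show "words_tendsto (\<lambda>n. comp_subst s n [La]) (inf_subst (s 0) u)"
    unfolding words_tendsto_def
  proof
    fix i
    have "i < length (comp_subst s (Suc n) [La]) \<and> comp_subst s (Suc n) [La] ! i = inf_subst (s 0) u i"
      if eq: "take (Suc i) (comp_subst (\<lambda>m. s (1 + m)) n [La]) = pre u (Suc i)" for n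
    proof -
      obtain r where r: "comp_subst (\<lambda>m. s (1 + m)) n [La] = pre u (Suc i) @ r"
        using eq by (metis append_take_drop_id)
      have "i < length (apply_subst (s 0) (pre u (Suc i)))"
        using length_apply_subst[OF th, of "pre u (Suc i)"] by simp
      moreover have "comp_subst s (Suc n) [La] = apply_subst (s 0) (pre u (Suc i)) @ apply_subst (s 0) r"
        using r by (simp only: comp_subst_Suc apply_subst_append[symmetric]) simp
      ultimately show ?thesis by (simp add: nth_append inf_subst_def del: comp_subst.simps)
    qed
    then have "\<forall>\<^sub>F n in sequentially. i < length (comp_subst s (Suc n) [La]) \<and> comp_subst s (Suc n) [La] ! i = inf_subst (s 0) u i"
      using words_tendsto_prefix[OF u, of "Suc i"] by (auto elim!: eventually_mono simp del: comp_subst.simps)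
    then show "\<forall>\<^sub>F n in sequentially. i < length (comp_subst s n [La]) \<and> comp_subst s n [La] ! i = inf_subst (s 0) u i"
      by (rule eventually_sequentially_Suc[THEN iffD1, of "\<lambda>n. i < length (comp_subst s n [La]) \<and> comp_subst s n [La] ! i = inf_subst (s 0) u i"])
  qed
qed

lemma limit_word_0: "directive s \<Longrightarrow> limit_word s 0 = La"
proof -
  have first: "\<theta> \<in> substs \<Longrightarrow> \<theta> La ! 0 = La" for \<theta> by auto
  assume s: "directive s"
  have "comp_subst s n [La] \<noteq> [] \<and> comp_subst s n [La] ! 0 = La" for n
    using s
  proof (induction n arbitrary: s)
    case 0
    then show ?case using first directiveD[of s 0] subst_first(2) by (simp del: insert_iff)
  next
    case (Suc n)
    have "directive (\<lambda>m. s (Suc m))" using Suc.prems by (simp add: directive_def)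
    from Suc.IH[OF this] obtain r where "comp_subst (\<lambda>m. s (Suc m)) n [La] = La # r"
      by (metis nth_Cons_0 neq_Nil_conv)
    then have "comp_subst s (Suc n) [La] = s 0 La @ apply_subst (s 0) r"
      by (simp only: comp_subst_Suc apply_subst_simps)
    then show ?case using first directiveD[OF Suc.prems, of 0] subst_first(2)
      by (simp add: nth_append del: insert_iff comp_subst.simps)
  qed
  then have "words_tendsto (\<lambda>n. comp_subst s n [La]) u \<Longrightarrow> u 0 = La" for u
    unfolding words_tendsto_def by (metis (mono_tags, lifting) eventually_sequentially order_refl)
  then show ?thesis using limit_word[OF s] by blast
qed

text \<open>Position \<open>N\<close> lies in the image of some letter with index \<open>n\<close>,
  and the walk at \<open>N\<close> is \<alpha> times the desubstituted walk at \<open>n\<close> plus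
  a bounded prefix. The induction runs over positions, with the directive sequence shifted at each
  step.\<close>

lemma norm_walk_limit_word:
  assumes "directive s"
  shows "norm (walk (limit_word s) N) \<le> radius"
  using assms
proof (induction N arbitrary: s rule: less_induct)
  case (less N)
  define u where "u = limit_word (\<lambda>m. s (1 + m))"
  have th: "s 0 \<in> substs" by (rule directiveD[OF less.prems])
  obtain n k where nk: "N = length (apply_subst (s 0) (pre u n)) + k" "k < length (s 0 (u n))"
    using position_split[OF th] by blast
  have W: "walk (limit_word s) N = \<alpha> * walk u n + proj (abel (take k (s 0 (u n))))"
    unfolding limit_word_desubstitute[OF less.prems] u_def[symmetric] nk(1)
    using nk(2) th by (intro walk_inf_subst) auto
  have "norm (walk u n) \<le> radius"
  \<comment> \<open>For n = 0 there need not be any decrease. For n > 0 the first letter a has an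
    image of length 3 and the others are nonempty, so n < N.\<close>
  proof (cases n)
    case 0
    then show ?thesis using radius by simp
  next
    case (Suc m)
    have "u 0 = La" unfolding u_def by (rule limit_word_0[OF directive_shift[OF less.prems]])
    have "pre u (1 + m) = pre u 1 @ pre ((left_shift ^^ 1) u) m" by (rule pre_add)
    also have "pre u 1 = [La]" using \<open>u 0 = La\<close> by (simp add: pre_def)
    finally have "apply_subst (s 0) (pre u n) = s 0 La @ apply_subst (s 0) (pre ((left_shift ^^ 1) u) m)"
      by (simp add: Suc)
    moreover have "length (s 0 La) = 3" using th by auto
    ultimately have "n < N"
      using nk(1) length_apply_subst[OF th, of "pre ((left_shift ^^ 1) u) m"] Suc by simp
    then show ?thesis unfolding u_def by (rule less.IH[OF _ directive_shift[OF less.prems]])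
  qed
  then have "norm \<alpha> * norm (walk u n) \<le> norm \<alpha> * radius" by (rule mult_left_mono) simp
  then show ?case
    unfolding W using norm_triangle_ineq[of "\<alpha> * walk u n" "proj (abel (take k (s 0 (u n))))"]
      norm_proj_take[OF th, of k "u n"] radius(1) by (simp add: norm_mult)
qed

text \<open>The pairs (word, position of the walk); minimality will show that this is the graph of a function.\<close>

definition ext_hull :: "(nat \<Rightarrow> substitution) \<Rightarrow> ((nat \<Rightarrow> letter) \<times> complex) set" where
  "ext_hull s = closure (range (\<lambda>n. ((left_shift ^^ n) (limit_word s), walk (limit_word s) n)))"

section \<open>Compactness of the hull and desubstitution of its points\<close>

lemma compact_UNIV_word: "compact (UNIV :: (nat \<Rightarrow> letter) set)"
proof -
  have "compact_space (product_topology (\<lambda>_::nat. euclidean :: letter topology) UNIV)"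
    unfolding compact_space_product_topology by (simp add: compact_space_def finite_imp_compact)
  then show ?thesis
    unfolding euclidean_product_topology compact_space_def by simp
qed

lemma open_cylinder: "open {y :: nat \<Rightarrow> letter. \<forall>i<n. y i = x i}"
proof -
  have "{y. \<forall>i<n. y i = x i} = (\<Inter>i\<in>{..<n}. (\<lambda>y. y i) -` {x i})" by auto
  also have "open \<dots>"
    by (intro open_INT ballI open_vimage discrete_topology_class.open_discrete) auto
  finally show ?thesis .
qed

lemma continuous_on_cylinder:
  fixes f :: "(nat \<Rightarrow> letter) \<Rightarrow> 'b :: topological_space"
  assumes "\<And>x y. (\<forall>i<n. x i = y i) \<Longrightarrow> f x = f y"
  shows "continuous_on UNIV f"
  unfolding continuous_on_open_vimage[OF open_UNIV]
proof (intro allI impI)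
  fix B :: "'b set"
  show "open (f -` B \<inter> UNIV)"
  proof (rule topological_space_class.openI)
    fix x assume "x \<in> f -` B \<inter> UNIV"
    then have "f y \<in> B" if "\<forall>i<n. y i = x i" for y using assms[OF that] by simp
    then have "{y. \<forall>i<n. y i = x i} \<subseteq> f -` B \<inter> UNIV" by blast
    then show "\<exists>T. open T \<and> x \<in> T \<and> T \<subseteq> f -` B \<inter> UNIV"
      by (intro exI[of _ "{y. \<forall>i<n. y i = x i}"]) (simp add: open_cylinder)
  qed
qed

lemma continuous_left_shift: "continuous_on UNIV (left_shift ^^ n)"
  unfolding shift_funpow[abs_def] by (intro continuous_on_coordinatewise_then_product continuous_on_product_coordinates)

lemma continuous_inf_subst: "continuous_on UNIV (inf_subst \<theta>)"
proof (rule continuous_on_coordinatewise_then_product)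
  fix i show "continuous_on UNIV (\<lambda>x. inf_subst \<theta> x i)"
  proof (rule continuous_on_cylinder[of "Suc i"])
    fix x y :: "nat \<Rightarrow> letter" assume "\<forall>j<Suc i. x j = y j"
    then have "pre x (Suc i) = pre y (Suc i)" by (intro pre_cong) auto
    then show "inf_subst \<theta> x i = inf_subst \<theta> y i" by (simp only: inf_subst_def)
  qed
qed

lemma hull_orbit: "((left_shift ^^ n) (limit_word s), walk (limit_word s) n) \<in> ext_hull s"
  unfolding ext_hull_def by (rule subsetD[OF closure_subset rangeI])

lemma closed_hull: "closed (ext_hull s)"
  by (simp add: ext_hull_def)

lemma hull_subset_closed:
  assumes "closed C" "\<And>n. ((left_shift ^^ n) (limit_word s), walk (limit_word s) n) \<in> C"
  shows "ext_hull s \<subseteq> C"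
  unfolding ext_hull_def by (rule closure_minimal[OF _ assms(1)]) (use assms(2) in blast)

lemma norm_hull:
  assumes "directive s" "(x, z) \<in> ext_hull s"
  shows "norm z \<le> radius"
proof -
  have "ext_hull s \<subseteq> UNIV \<times> cball 0 radius"
    by (rule hull_subset_closed) (simp_all add: closed_Times norm_walk_limit_word[OF assms(1)])
  from subsetD[OF this assms(2)] show ?thesis by simp
qed

lemma compact_hull: "directive s \<Longrightarrow> compact (ext_hull s)"
proof -
  assume "directive s"
  then have "ext_hull s \<subseteq> UNIV \<times> cball 0 radius" using norm_hull by (intro subrelI) simp
  moreover have "compact ((UNIV :: (nat \<Rightarrow> letter) set) \<times> cball (0 :: complex) radius)"
    by (intro compact_Times compact_UNIV_word compact_cball)
  ultimately show ?thesis using closed_hull by (metis closed_Int_compact inf.absorb_iff1)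
qed

lemma hull_left_shift:
  assumes "(x, z) \<in> ext_hull s"
  shows "(left_shift x, z + proj (unit (x 0))) \<in> ext_hull s"
proof -
  define f where "f = (\<lambda>p :: (nat \<Rightarrow> letter) \<times> complex. (left_shift (fst p), snd p + proj (unit (fst p 0))))"
  have c1: "continuous_on UNIV (\<lambda>x :: nat \<Rightarrow> letter. proj (unit (x 0)))"
    by (rule continuous_on_cylinder[of 1]) simp
  have c2: "continuous_on UNIV left_shift" using continuous_left_shift[of 1] by simp
  have "continuous_on UNIV f"
    unfolding f_def
    by (intro continuous_on_Pair continuous_on_add continuous_on_snd continuous_on_id
        continuous_on_compose2[OF c1] continuous_on_compose2[OF c2] continuous_on_fst) auto
  then have "closed (f -` ext_hull s)" using closed_hull by (simp add: closed_vimage)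
  moreover have "((left_shift ^^ n) (limit_word s), walk (limit_word s) n) \<in> f -` ext_hull s" for n
    using hull_orbit[of "Suc n" s] by (simp add: f_def walk_Suc shift_funpow[of n])
  ultimately have "ext_hull s \<subseteq> f -` ext_hull s" by (rule hull_subset_closed)
  from subsetD[OF this assms] show ?thesis by (simp add: f_def)
qed

lemma hull_shift: "(x, z) \<in> ext_hull s \<Longrightarrow> ((left_shift ^^ n) x, z + walk x n) \<in> ext_hull s"
proof (induction n)
  case (Suc n)
  from hull_left_shift[OF Suc.IH[OF Suc.prems]] show ?case
    by (simp add: walk_Suc shift_funpow[of n] add.assoc)
qed simp

text \<open>Each orbit point comes from an orbit point of the shifted sequence by substituting and
  cutting inside the first image block, at one of at most three places. The pairs obtained in this
  way from the whole hull form a compact set, so the existence of a desubstitution survives the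
  closure.\<close>

lemma hull_desubstitute:
  assumes s: "directive s" and xz: "(x, z) \<in> ext_hull s"
  obtains x' z' k where "(x', z') \<in> ext_hull (\<lambda>m. s (1 + m))" "k < length (s 0 (x' 0))"
    "x = (left_shift ^^ k) (inf_subst (s 0) x')" "z = \<alpha> * z' + proj (abel (take k (s 0 (x' 0))))"
    "x 0 = s 0 (x' 0) ! k"
proof -
  define \<theta> where "\<theta> = s 0"
  define s' where "s' = (\<lambda>m. s (1 + m))"
  have th: "\<theta> \<in> substs" unfolding \<theta>_def by (rule directiveD[OF s])
  have s': "directive s'" unfolding s'_def by (rule directive_shift[OF s])
  define f where "f = (\<lambda>k (p :: (nat \<Rightarrow> letter) \<times> complex).
    ((left_shift ^^ k) (inf_subst \<theta> (fst p)), \<alpha> * snd p + proj (abel (take k (\<theta> (fst p 0))))))"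
  \<comment> \<open>Whether the cut \<open>k\<close> falls inside the first block depends only on
    the first letter, so this is a closed condition.\<close>
  define A where "A = (\<lambda>k. ext_hull s' \<inter> (\<lambda>p. fst p 0) -` {i. k < length (\<theta> i)})"
  have c1: "continuous_on UNIV (\<lambda>x :: nat \<Rightarrow> letter. proj (abel (take k (\<theta> (x 0)))))" for k
    by (rule continuous_on_cylinder[of 1]) simp
  have c2: "continuous_on UNIV (\<lambda>p :: (nat \<Rightarrow> letter) \<times> complex. fst p 0)"
    by (rule continuous_on_product_then_coordinatewise[OF continuous_on_fst[OF continuous_on_id]])
  have cf: "continuous_on UNIV (f k)" for k
    unfolding f_def
    by (intro continuous_on_Pair continuous_on_add continuous_on_mult continuous_on_const continuous_on_snd continuous_on_id
        continuous_on_compose2[OF c1] continuous_on_compose2[OF continuous_left_shift]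
        continuous_on_compose2[OF continuous_inf_subst] continuous_on_fst) auto
  have cA: "compact (A k)" for k
  proof -
    have "closed ((\<lambda>p :: (nat \<Rightarrow> letter) \<times> complex. fst p 0) -` {i. k < length (\<theta> i)})"
      using c2 by (intro closed_vimage) (auto simp: closed_def discrete_topology_class.open_discrete)
    then show ?thesis unfolding A_def by (rule compact_Int_closed[OF compact_hull[OF s']])
  qed
  have comp: "compact (\<Union>k<3. f k ` A k)"
    by (intro compact_UN compact_continuous_image[OF continuous_on_subset[OF cf subset_UNIV] cA]) simp
  have t2: "closed (\<Union>k<3. f k ` A k)"
    by (rule compact_imp_closed[OF comp])
  have "((left_shift ^^ N) (limit_word s), walk (limit_word s) N) \<in> (\<Union>k<3. f k ` A k)" for N
  proof -
    define u where "u = limit_word s'"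
    have u: "limit_word s = inf_subst \<theta> u"
      using limit_word_desubstitute[OF s] by (simp add: u_def s'_def \<theta>_def)
    obtain n k where nk: "N = length (apply_subst \<theta> (pre u n)) + k" "k < length (\<theta> (u n))"
      using position_split[OF th] by blast
    have "length (\<theta> (u n)) \<le> 3" using th by (cases "u n") auto
    then have "k < 3" using nk by simp
    moreover have "((left_shift ^^ n) u, walk u n) \<in> A k"
      using hull_orbit[of n s'] nk(2) by (simp add: A_def u_def shift_funpow)
    moreover have "((left_shift ^^ N) (limit_word s), walk (limit_word s) N) = f k ((left_shift ^^ n) u, walk u n)"
    proof -
      have "(left_shift ^^ N) (inf_subst \<theta> u) = (left_shift ^^ k) ((left_shift ^^ length (apply_subst \<theta> (pre u n))) (inf_subst \<theta> u))"
        by (simp only: nk(1) add.commute[of _ k] funpow_add o_apply)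
      also have "\<dots> = (left_shift ^^ k) (inf_subst \<theta> ((left_shift ^^ n) u))"
        by (simp only: shift_inf_subst[OF th])
      finally have "(left_shift ^^ N) (limit_word s) = (left_shift ^^ k) (inf_subst \<theta> ((left_shift ^^ n) u))"
        by (simp only: u)
      moreover have "walk (limit_word s) N = \<alpha> * walk u n + proj (abel (take k (\<theta> (u n))))"
        unfolding u nk(1) using nk(2) by (intro walk_inf_subst[OF th]) simp
      moreover have "((left_shift ^^ n) u) 0 = u n" by (simp add: shift_funpow)
      ultimately show ?thesis by (simp add: f_def)
    qed
    ultimately show ?thesis by (intro UN_I[of k] image_eqI[of _ _ "((left_shift ^^ n) u, walk u n)"]) auto
  qed
  then have "ext_hull s \<subseteq> (\<Union>k<3. f k ` A k)" by (intro hull_subset_closed t2)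
  from subsetD[OF this xz] obtain k p where "p \<in> A k" "(x, z) = f k p" by (elim UN_E imageE)
  then have *: "(fst p, snd p) \<in> ext_hull s'" "k < length (\<theta> (fst p 0))" "x = (left_shift ^^ k) (inf_subst \<theta> (fst p))" "z = \<alpha> * snd p + proj (abel (take k (\<theta> (fst p 0))))"
    by (auto simp: A_def f_def)
  moreover have "x 0 = \<theta> (fst p 0) ! k"
    using *(2,3) inf_subst_block[OF th, of k "fst p"] by (simp add: shift_funpow)
  ultimately show ?thesis using that unfolding \<theta>_def s'_def by blast
qed

section \<open>Minimality: every prefix of the limit word occurs in every point\<close>

definition occurs :: "letter list \<Rightarrow> (nat \<Rightarrow> letter) \<Rightarrow> bool" where
  "occurs w x \<longleftrightarrow> (\<exists>m. pre ((left_shift ^^ m) x) (length w) = w)"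

lemma shift_shift: "(left_shift ^^ m) ((left_shift ^^ n) x) = (left_shift ^^ (m + n)) x"
  by (simp add: funpow_add)

lemma length_block_le:
  assumes "\<theta> \<in> substs" "1 \<le> n"
  shows "length (\<theta> (x 0)) \<le> length (apply_subst \<theta> (pre x n))"
proof -
  have "pre x n = pre x 1 @ pre ((left_shift ^^ 1) x) (n - 1)"
    using pre_add[of x 1 "n - 1"] assms(2) by simp
  moreover have "pre x 1 = [x 0]" by (simp add: pre_def)
  ultimately show ?thesis by (simp add: apply_subst_append)
qed

text \<open>The cut after \<open>k\<close> letters may destroy the image of the first letter of
  \<open>x\<close>. Requiring the occurrence in \<open>left_shift x\<close> keeps its image behind
  the cut.\<close>

lemma occurs_subst:
  assumes th: "\<theta> \<in> substs" and k: "k \<le> length (\<theta> (x 0))" and occ: "occurs w (left_shift x)"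
  shows "occurs (apply_subst \<theta> w) ((left_shift ^^ k) (inf_subst \<theta> x))"
proof -
  obtain m where "pre ((left_shift ^^ m) (left_shift x)) (length w) = w"
    using occ by (auto simp: occurs_def)
  then have w: "pre ((left_shift ^^ Suc m) x) (length w) = w"
    by (simp only: funpow_Suc_right o_apply)
  define L where "L = length (apply_subst \<theta> (pre x (Suc m)))"
  have "k \<le> L" using length_block_le[OF th, of "Suc m" x] k by (simp add: L_def)
  then have "(left_shift ^^ (L - k)) ((left_shift ^^ k) (inf_subst \<theta> x)) = (left_shift ^^ L) (inf_subst \<theta> x)"
    by (simp only: shift_shift le_add_diff_inverse2)
  also have "\<dots> = inf_subst \<theta> ((left_shift ^^ Suc m) x)"
    unfolding L_def by (rule shift_inf_subst[OF th])
  finally have "pre ((left_shift ^^ (L - k)) ((left_shift ^^ k) (inf_subst \<theta> x))) (length (apply_subst \<theta> w)) = apply_subst \<theta> w"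
    using pre_inf_subst[OF th, of "(left_shift ^^ Suc m) x" "length w"] unfolding w by (simp only:)
  then show ?thesis unfolding occurs_def by blast
qed

lemma first_letter_occurs:
  assumes th: "\<theta> \<in> substs" and k: "k < length (\<theta> (x 0))" and j: "1 \<le> j"
  shows "\<exists>m\<ge>1. ((left_shift ^^ k) (inf_subst \<theta> x)) m = \<theta> (x j) ! 0"
proof -
  define L where "L = length (apply_subst \<theta> (pre x j))"
  have L: "k < L" using length_block_le[OF th j, of x] k by (simp add: L_def)
  have "inf_subst \<theta> x L = ((left_shift ^^ L) (inf_subst \<theta> x)) 0" by (simp add: shift_funpow)
  also have "\<dots> = inf_subst \<theta> ((left_shift ^^ j) x) 0"
    unfolding L_def by (simp only: shift_inf_subst[OF th])
  also have "\<dots> = \<theta> (x j) ! 0"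
    using inf_subst_block[OF th, of 0 "(left_shift ^^ j) x"] subst_first(2)[OF th] by (simp add: shift_funpow)
  finally have "((left_shift ^^ k) (inf_subst \<theta> x)) (L - k) = \<theta> (x j) ! 0"
    using L by (simp add: shift_funpow)
  then show ?thesis using L by (intro exI[of _ "L - k"]) simp
qed

text \<open>Two levels are needed: no image of a letter begins with b, and the image of a letter
  other than b begins with a. Letters of index at least 1 are used at both levels, since only their
  images are certain to be uncut.\<close>

lemma occurs_La:
  assumes "directive s" "(x, z) \<in> ext_hull s"
  shows "occurs [La] x"
proof -
  obtain x' z' k where 1: "(x', z') \<in> ext_hull (\<lambda>m. s (1 + m))" "k < length (s 0 (x' 0))"
    "x = (left_shift ^^ k) (inf_subst (s 0) x')"
    using hull_desubstitute[OF assms] by metis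
  obtain x'' z'' l where 2: "(x'', z'') \<in> ext_hull (\<lambda>m. s (1 + (1 + m)))" "l < length (s (1 + 0) (x'' 0))"
    "x' = (left_shift ^^ l) (inf_subst (s (1 + 0)) x'')"
    using hull_desubstitute[OF directive_shift[OF assms(1)] 1(1)] by metis
  obtain j where j: "1 \<le> j" "x' j = s (1 + 0) (x'' 1) ! 0"
    using first_letter_occurs[OF directiveD[OF assms(1)], of l "1 + 0" x'' 1] 2(2,3) by auto
  have "\<theta> i ! 0 \<noteq> Lb" "i \<noteq> Lb \<Longrightarrow> \<theta> i ! 0 = La" if "\<theta> \<in> substs" for \<theta> i
    using that by (cases i; auto)+
  then have "s 0 (x' j) ! 0 = La" using directiveD[OF assms(1)] j(2) by metis
  then obtain m where "x m = La"
    using first_letter_occurs[OF directiveD[OF assms(1)], of k 0 x' j] j(1) 1(2,3) by auto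
  then show ?thesis by (auto simp: occurs_def pre_def shift_funpow intro!: exI[of _ m])
qed

lemma occurs_comp_subst:
  assumes "directive s" "(x, z) \<in> ext_hull s"
  shows "occurs (comp_subst s n [La]) x"
  using assms
proof (induction n arbitrary: s x z)
  case 0
  obtain x' z' k where 1: "(x', z') \<in> ext_hull (\<lambda>m. s (1 + m))" "k < length (s 0 (x' 0))"
    "x = (left_shift ^^ k) (inf_subst (s 0) x')"
    using hull_desubstitute[OF 0] by metis
  have "occurs [La] (left_shift x')"
    by (rule occurs_La[OF directive_shift[OF 0(1)] hull_left_shift[OF 1(1)]])
  from occurs_subst[OF directiveD[OF 0(1)] _ this, of k] show ?case
    using 1(2,3) by simp
next
  case (Suc n)
  obtain x' z' k where 1: "(x', z') \<in> ext_hull (\<lambda>m. s (1 + m))" "k < length (s 0 (x' 0))"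
    "x = (left_shift ^^ k) (inf_subst (s 0) x')"
    using hull_desubstitute[OF Suc.prems] by metis
  have "occurs (comp_subst (\<lambda>m. s (1 + m)) n [La]) (left_shift x')"
    by (rule Suc.IH[OF directive_shift[OF Suc.prems(1)] hull_left_shift[OF 1(1)]])
  from occurs_subst[OF directiveD[OF Suc.prems(1)] _ this, of k 0] show ?case
    using 1(2,3) by (simp add: comp_subst_Suc del: comp_subst.simps)
qed

lemma pre_take: "n \<le> m \<Longrightarrow> pre x n = take n (pre x m)"
  by (simp add: pre_def take_map min_def)

lemma prefix_occurs:
  assumes "directive s" "(x, z) \<in> ext_hull s"
  shows "\<exists>m. pre ((left_shift ^^ m) x) N = pre (limit_word s) N"
proof -
  obtain n where n: "N \<le> length (comp_subst s n [La])" "take N (comp_subst s n [La]) = pre (limit_word s) N"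
    using eventually_happens[OF words_tendsto_prefix[OF limit_word[OF assms(1)], of N]] by auto
  obtain m where "pre ((left_shift ^^ m) x) (length (comp_subst s n [La])) = comp_subst s n [La]"
    using occurs_comp_subst[OF assms, of n] by (auto simp: occurs_def)
  then have "pre ((left_shift ^^ m) x) N = take N (comp_subst s n [La])"
    using pre_take[OF n(1)] by metis
  then show ?thesis using n(2) by auto
qed

text \<open>Two points of the hull over the same word differ by a vector \<open>d\<close>; by minimality, the
  oscillation of the walk in direction \<open>d\<close> exceeds itself by \<open>|d|\<^sup>2\<close>.\<close>

lemma hull_unique:
  assumes s: "directive s" and "(x, z) \<in> ext_hull s" "(x, z') \<in> ext_hull s"
  shows "z = z'"
proof -
  define d where "d = z' - z"
  define u where "u = limit_word s"
  define A where "A = range (\<lambda>n. inner (walk u n) d)"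
  have bnd: "\<bar>inner (walk u n) d\<bar> \<le> radius * norm d" for n
    unfolding u_def
    by (rule order_trans[OF Cauchy_Schwarz_ineq2 mult_right_mono[OF norm_walk_limit_word[OF s]]]) simp
  have bdd: "bdd_above A" "bdd_below A" "A \<noteq> {}"
    unfolding A_def using abs_le_D1[OF bnd] abs_le_D2[OF bnd]
    by (auto intro!: bdd_aboveI2 bdd_belowI2[of _ "- (radius * norm d)"] simp: minus_le_iff)
  have range: "Inf A \<le> inner w d \<and> inner w d \<le> Sup A" if "(y, w) \<in> ext_hull s" for y w
  proof -
    have cl: "closed {p :: (nat \<Rightarrow> letter) \<times> complex. Inf A \<le> inner (snd p) d \<and> inner (snd p) d \<le> Sup A}"
      by (intro closed_Collect_conj closed_Collect_le continuous_intros)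
    have "ext_hull s \<subseteq> {p. Inf A \<le> inner (snd p) d \<and> inner (snd p) d \<le> Sup A}"
      by (rule hull_subset_closed[OF cl]) (auto simp: A_def u_def[symmetric] intro!: cInf_lower cSup_upper bdd[unfolded A_def])
    from subsetD[OF this that] show ?thesis by simp
  qed
  \<comment> \<open>A prefix of \<open>u\<close> containing a near-maximum \<open>n0\<close> and a
    near-minimum \<open>n1\<close> of the walk in direction \<open>d\<close> recurs in
    \<open>x\<close>. There it can be started at two points of the hull that differ by
    \<open>d\<close>, and both walks must stay within the range of \<open>A\<close>.\<close>
  have "inner d d \<le> 0 + e" if e: "0 < e" for e
  proof -
    obtain n0 where n0: "Sup A - e / 2 < inner (walk u n0) d"
      using less_cSupD[of A "Sup A - e / 2"] bdd e by (auto simp: A_def)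
    obtain n1 where n1: "inner (walk u n1) d < Inf A + e / 2"
      using cInf_lessD[of A "Inf A + e / 2"] bdd e by (auto simp: A_def)
    obtain m where m: "pre ((left_shift ^^ m) x) (max n0 n1) = pre u (max n0 n1)"
      using prefix_occurs[OF s assms(2)] unfolding u_def by blast
    define y where "y = (left_shift ^^ m) x"
    define w where "w = z + walk x m"
    have w: "(y, w) \<in> ext_hull s" "(y, w + d) \<in> ext_hull s"
      using hull_shift[OF assms(2), of m] hull_shift[OF assms(3), of m]
      by (simp_all add: y_def w_def d_def add.commute)
    have eq: "walk y n = walk u n" if "n \<le> max n0 n1" for n
      using m pre_take[OF that] unfolding walk_def y_def by metis
    \<comment> \<open>This gives inner w d + |d|^2 < e / 2, and the next bound gives inner w d > - e
      / 2.\<close>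
    have "inner (w + d + walk u n0) d \<le> Sup A"
      using range[OF hull_shift[OF w(2), of n0]] eq[of n0] by simp
    moreover have "Inf A \<le> inner (w + walk u n1) d"
      using range[OF hull_shift[OF w(1), of n1]] eq[of n1] by simp
    ultimately show ?thesis using n0 n1 by (simp add: inner_add_left)
  qed
  then have "inner d d \<le> 0" by (rule field_le_epsilon)
  then have "d = 0" using inner_ge_zero[of d] by (metis inner_eq_zero_iff order_antisym)
  then show ?thesis by (simp add: d_def)
qed

text \<open>Distinct tiles of one word have disjoint interiors, so two equal tiles meet only in
  matching subtiles. Read backwards, desubstituting a non-coincident overlap never meets a
  coincidence, as the recursion of \<open>offsets\<close> requires.\<close>

lemma coincident_child:
  assumes "coincident o'" "(k, l) \<in> children \<theta> o'" "0 < overlap (child \<theta> o' k l)"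
  shows "coincident (child \<theta> o' k l)"
proof -
  obtain i where o': "o' = Ov 0 i i" using assms(1) by (cases o') auto
  let ?w = "\<theta> i"
  have kl: "k < length ?w" "l < length ?w" using assms(2) by (auto simp: o')
  have mono: "height (abel (take k ?w)) + width (?w ! k) \<le> height (abel (take l ?w))"
    if "k < l" "l < length ?w" for k l
  proof -
    have "take l ?w = take (Suc k) ?w @ take (l - Suc k) (drop (Suc k) ?w)"
      using that by (metis Suc_leI le_add_diff_inverse take_add)
    moreover have "take (Suc k) ?w = take k ?w @ [?w ! k]"
      using that by (intro take_Suc_conv_app_nth) simp
    ultimately show ?thesis
      using height_abel_nonneg[of "take (l - Suc k) (drop (Suc k) ?w)"] by (simp add: height_add)
  qed
  have "k = l"
  proof (rule ccontr)
    assume "k \<noteq> l"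
    then consider "k < l" | "l < k" by linarith
    then have "overlap (child \<theta> o' k l) = 0"
      using mono[of k l] mono[of l k] kl by cases (auto simp: o' height_add height_diff seg_def)
    then show False using assms(3) by simp
  qed
  then show ?thesis by (simp add: o')
qed

text \<open>The first tiles of \<open>x\<close> and \<open>y\<close>, at relative position \<open>d\<close>, overlap without coinciding; \<open>z\<close> is the
  walk position of \<open>x\<close>.\<close>

definition meeting :: "(nat \<Rightarrow> substitution) \<Rightarrow> vec \<Rightarrow> complex \<Rightarrow> (nat \<Rightarrow> letter) \<Rightarrow> (nat \<Rightarrow> letter) \<Rightarrow> bool" where
  "meeting s d z x y \<longleftrightarrow> (x, z) \<in> ext_hull s \<and> (y, z + proj d) \<in> ext_hull s \<and>
     0 < overlap (Ov d (x 0) (y 0)) \<and> \<not> coincident (Ov d (x 0) (y 0))"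

lemma meeting_desubstitute:
  assumes s: "directive s" and m: "meeting s d z x y"
  obtains d' z' x' y' k l where "meeting (\<lambda>m. s (1 + m)) d' z' x' y'"
    "(k, l) \<in> children (s 0) (Ov d' (x' 0) (y' 0))"
    "Ov d (x 0) (y 0) = child (s 0) (Ov d' (x' 0) (y' 0)) k l"
    "z = \<alpha> * z' + proj (abel (take k (s 0 (x' 0))))"
proof -
  have th: "s 0 \<in> substs" by (rule directiveD[OF s])
  have h: "(x, z) \<in> ext_hull s" "(y, z + proj d) \<in> ext_hull s" using m by (auto simp: meeting_def)
  obtain x' z' k where x': "(x', z') \<in> ext_hull (\<lambda>m. s (1 + m))" "k < length (s 0 (x' 0))"
    "z = \<alpha> * z' + proj (abel (take k (s 0 (x' 0))))" "x 0 = s 0 (x' 0) ! k"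
    using hull_desubstitute[OF s h(1)] by metis
  obtain y' w' l where y': "(y', w') \<in> ext_hull (\<lambda>m. s (1 + m))" "l < length (s 0 (y' 0))"
    "z + proj d = \<alpha> * w' + proj (abel (take l (s 0 (y' 0))))" "y 0 = s 0 (y' 0) ! l"
    using hull_desubstitute[OF s h(2)] by metis
  \<comment> \<open>\<open>mat\<close> has determinant 1, so the relative position can be
    desubstituted within the integer vectors; the hull equations then yield its projection after
    cancelling \<alpha>.\<close>
  obtain d' where d': "mat d' = d - abel (take l (s 0 (y' 0))) + abel (take k (s 0 (x' 0)))"
    using mat_surj by metis
  have "\<alpha> * (w' - z') = \<alpha> * proj d'"
    unfolding proj_mat[symmetric] d' proj_add proj_diff using x'(3) y'(3) by (simp add: algebra_simps)
  then have "w' - z' = proj d'" using norm_alpha(1) by (metis mult_left_cancel zero_less_norm_iff)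
  then have w': "w' = z' + proj d'" by (simp add: algebra_simps)
  have kl: "(k, l) \<in> children (s 0) (Ov d' (x' 0) (y' 0))" using x'(2) y'(2) by simp
  have eq: "Ov d (x 0) (y 0) = child (s 0) (Ov d' (x' 0) (y' 0)) k l"
    by (simp add: d' x'(4) y'(4))
  have pos: "0 < overlap (child (s 0) (Ov d' (x' 0) (y' 0)) k l)"
    using m eq by (simp only: meeting_def)
  have "meeting (\<lambda>m. s (1 + m)) d' z' x' y'"
    unfolding meeting_def
  proof (intro conjI)
    show "0 < overlap (Ov d' (x' 0) (y' 0))" by (rule overlap_child_pos[OF th kl pos])
    show "\<not> coincident (Ov d' (x' 0) (y' 0))"
      using coincident_child[OF _ kl pos] m eq by (metis meeting_def)
  qed (use x'(1) y'(1) w' in simp_all)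
  then show ?thesis using that kl eq x'(3) by blast
qed

lemma meeting_bounded:
  assumes "directive s" "meeting s d z x y"
  shows "Ov d (x 0) (y 0) \<in> bounded_overlaps (2 * radius)"
proof -
  have "norm (proj d) \<le> norm (z + proj d) + norm z"
    using norm_triangle_ineq4[of "z + proj d" z] by simp
  also have "\<dots> \<le> 2 * radius"
    using norm_hull[OF assms(1), of x z] norm_hull[OF assms(1), of y "z + proj d"] assms(2) by (simp add: meeting_def)
  finally show ?thesis
    using assms(2) overlap_height[of d "x 0" "y 0"] by (simp add: meeting_def mem_bounded_overlaps del: overlap.simps)
qed

text \<open>Iterated desubstitution writes z as \<alpha> ^ n * z' plus an offset. The list is
  reversed because \<open>offsets\<close> starts from the top overlap, to which the substitution
  with index n - 1 is applied first.\<close>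

lemma meeting_offsets:
  assumes "directive s" "meeting s d z x y"
  shows "\<exists>d' z' x' y'. meeting (\<lambda>m. s (n + m)) d' z' x' y' \<and>
    z - \<alpha> ^ n * z' \<in> offsets (rev (map s [0..<n])) (Ov d' (x' 0) (y' 0))"
proof (induction n)
  case 0
  have "z - \<alpha> ^ 0 * z \<in> offsets (rev (map s [0..<0])) (Ov d (x 0) (y 0))"
    using assms(2) by (simp add: meeting_def del: overlap.simps coincident.simps)
  moreover have "(\<lambda>m. s (0 + m)) = s" by simp
  ultimately show ?case using assms(2) by (intro exI[of _ d] exI[of _ z] exI[of _ x] exI[of _ y]) simp
next
  case (Suc n)
  then obtain d1 z1 x1 y1 where 1: "meeting (\<lambda>m. s (n + m)) d1 z1 x1 y1"
    "z - \<alpha> ^ n * z1 \<in> offsets (rev (map s [0..<n])) (Ov d1 (x1 0) (y1 0))" by blast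
  obtain d' z' x' y' k l where 2: "meeting (\<lambda>m. s (n + (1 + m))) d' z' x' y'"
    "(k, l) \<in> children (s (n + 0)) (Ov d' (x' 0) (y' 0))"
    "Ov d1 (x1 0) (y1 0) = child (s (n + 0)) (Ov d' (x' 0) (y' 0)) k l"
    "z1 = \<alpha> * z' + proj (abel (take k (s (n + 0) (x' 0))))"
    by (rule meeting_desubstitute[OF directive_shift[OF assms(1)] 1(1)])
  define e where "e = z - \<alpha> ^ n * z1"
  have e: "e \<in> offsets (rev (map s [0..<n])) (child (s n) (Ov d' (x' 0) (y' 0)) k l)"
    using 1(2) 2(3) by (simp add: e_def)
  have "z - \<alpha> ^ Suc n * z' = \<alpha> ^ n * proj (abel (take k (s n (x' 0)))) + e"
    using 2(4) by (simp add: e_def algebra_simps)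
  then have "z - \<alpha> ^ Suc n * z' \<in> (\<Union>(k, l)\<in>children (s n) (Ov d' (x' 0) (y' 0)).
      (\<lambda>e. \<alpha> ^ n * proj (abel (take k (s n (x' 0)))) + e) ` offsets (rev (map s [0..<n])) (child (s n) (Ov d' (x' 0) (y' 0)) k l))"
    using 2(2) e by (intro UN_I[of "(k, l)"]) (simp_all only: prod.case add_0_right image_eqI)
  then have "z - \<alpha> ^ Suc n * z' \<in> offsets (rev (map s [0..<Suc n])) (Ov d' (x' 0) (y' 0))"
    using 2(1) by (simp add: meeting_def del: overlap.simps coincident.simps child.simps children.simps)
  moreover have "meeting (\<lambda>m. s (Suc n + m)) d' z' x' y'" using 2(1) by simp
  ultimately show ?case by blast
qed

section \<open>Covering the exceptional points by small discs\<close>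

definition bad :: "(nat \<Rightarrow> substitution) \<Rightarrow> complex set" where
  "bad s = {z. \<exists>d x y. meeting s d z x y}"

text \<open>In the decomposition of z into \<alpha> ^ n * z' and an offset, z' lies again in a hull
  and is bounded by \<open>radius\<close> whatever the sequence.\<close>

lemma bad_cover:
  assumes s: "directive s"
  shows "bad s \<subseteq> (\<Union>o'\<in>bounded_overlaps (2 * radius). \<Union>e\<in>offsets (rev (map s [0..<n])) o'. cball e (norm \<alpha> ^ n * radius))"
proof
  fix z assume "z \<in> bad s"
  then obtain d x y where "meeting s d z x y" by (auto simp: bad_def)
  from meeting_offsets[OF s this, of n] obtain d' z' x' y' where
    1: "meeting (\<lambda>m. s (n + m)) d' z' x' y'" "z - \<alpha> ^ n * z' \<in> offsets (rev (map s [0..<n])) (Ov d' (x' 0) (y' 0))"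
    by blast
  have "norm z' \<le> radius" using norm_hull[OF directive_shift[OF s]] 1(1) by (auto simp: meeting_def)
  then have "z \<in> cball (z - \<alpha> ^ n * z') (norm \<alpha> ^ n * radius)"
    by (simp add: dist_norm norm_minus_commute norm_mult norm_power mult_left_mono)
  then show "z \<in> (\<Union>o'\<in>bounded_overlaps (2 * radius). \<Union>e\<in>offsets (rev (map s [0..<n])) o'. cball e (norm \<alpha> ^ n * radius))"
    using meeting_bounded[OF directive_shift[OF s] 1(1)] 1(2) by blast
qed

text \<open>With m * n substitutions there are O(B ^ m) discs, and since |\<alpha>|^2 = 1 / \<beta>
  each has squared radius of order \<beta> ^ (- m * n). The total decays like \<open>q\<close> to
  the power m.\<close>

lemma bad_cover_small:
  assumes s: "directive s" and "0 < \<epsilon>"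
  shows "\<exists>C r. finite C \<and> 0 < r \<and> r \<le> 1 \<and> real (card C) * r\<^sup>2 \<le> \<epsilon> \<and> bad s \<subseteq> (\<Union>e\<in>C. cball e r)"
proof -
  obtain n K B where nKB: "0 < n" "0 \<le> B" "B < \<beta> ^ n"
    "\<And>m ss o'. o' \<in> bounded_overlaps (2 * radius) \<Longrightarrow> set ss \<subseteq> substs \<Longrightarrow> length ss = m * n \<Longrightarrow> real (card (offsets ss o')) \<le> K * B ^ m"
    using ex_card_offsets_bound by blast
  define N where "N = card (bounded_overlaps (2 * radius))"
  define q where "q = B / \<beta> ^ n"
  have q: "0 \<le> q" "q < 1" using nKB(2,3) beta(1) by (auto simp: q_def)
  define r where "r = (\<lambda>m. norm \<alpha> ^ (m * n) * radius)"
  have "(\<lambda>m. real N * K * q ^ m * radius\<^sup>2) \<longlonglongrightarrow> real N * K * 0 * radius\<^sup>2"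
    using q by (intro tendsto_intros LIMSEQ_power_zero) auto
  then have 1: "\<forall>\<^sub>F m in sequentially. real N * K * q ^ m * radius\<^sup>2 < \<epsilon>"
    using assms(2) by (intro order_tendstoD(2)) auto
  have an: "0 < norm \<alpha> ^ n" "norm \<alpha> ^ n < 1" using norm_alpha nKB(1) by (auto simp: power_less_one_iff)
  have "(\<lambda>m. (norm \<alpha> ^ n) ^ m * radius) \<longlonglongrightarrow> 0 * radius"
    using an by (intro tendsto_intros LIMSEQ_power_zero) auto
  then have 2: "\<forall>\<^sub>F m in sequentially. (norm \<alpha> ^ n) ^ m * radius < 1"
    by (intro order_tendstoD(2)) auto
  obtain m where m: "real N * K * q ^ m * radius\<^sup>2 < \<epsilon>" "(norm \<alpha> ^ n) ^ m * radius < 1"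
    using eventually_happens[OF eventually_conj[OF 1 2]] by auto
  define ss where "ss = rev (map s [0..<m * n])"
  have ss: "set ss \<subseteq> substs" "length ss = m * n" using s by (auto simp: ss_def directive_def)
  define C where "C = (\<Union>o'\<in>bounded_overlaps (2 * radius). offsets ss o')"
  have "finite C" unfolding C_def using finite_bounded_overlaps finite_offsets by blast
  have "real (card C) \<le> real (\<Sum>o'\<in>bounded_overlaps (2 * radius). card (offsets ss o'))"
    unfolding C_def by (intro of_nat_mono card_UN_le finite_bounded_overlaps)
  also have "\<dots> \<le> (\<Sum>o'\<in>bounded_overlaps (2 * radius). K * B ^ m)"
    unfolding of_nat_sum by (intro sum_mono nKB(4)) (use ss in auto)
  also have "\<dots> = real N * K * B ^ m" by (simp add: N_def)
  finally have C: "real (card C) \<le> real N * K * B ^ m" .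
  have r: "(r m)\<^sup>2 = (1 / \<beta>) ^ (m * n) * radius\<^sup>2"
    by (simp add: r_def power_mult_distrib norm_alpha_sq[symmetric] flip: power_mult) (simp add: mult.commute)
  have "real (card C) * (r m)\<^sup>2 \<le> real N * K * B ^ m * (r m)\<^sup>2"
    using C by (intro mult_right_mono) auto
  also have "\<dots> = real N * K * q ^ m * radius\<^sup>2"
    unfolding r q_def by (simp add: power_divide power_mult mult.commute[of m n])
  finally have "real (card C) * (r m)\<^sup>2 \<le> \<epsilon>" using m(1) by simp
  moreover have "0 < r m" "r m \<le> 1"
    using norm_alpha(1) radius(2) m(2) by (auto simp: r_def power_mult[symmetric] mult.commute[of n m])
  moreover have "bad s \<subseteq> (\<Union>e\<in>C. cball e (r m))"
    using bad_cover[OF s, of "m * n"] unfolding C_def ss_def r_def by blast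
  ultimately show ?thesis using \<open>finite C\<close> by blast
qed

section \<open>Translations of the torus\<close>

abbreviation unit_interval :: "real measure" where
  "unit_interval \<equiv> restrict_space lborel {0..<1}"

lemma prob_space_unit_interval: "prob_space unit_interval"
  by (rule prob_spaceI) (simp add: emeasure_restrict_space space_restrict_space)

lemma prob_space_torus: "prob_space (torus d)"
  unfolding torus_def by (intro prob_space_PiM prob_space_unit_interval)

lemma space_torus: "space (torus d) = ({..<d} \<rightarrow>\<^sub>E {0..<1})"
  by (simp add: torus_def space_PiM space_restrict_space)

lemma sets_unit_interval: "A \<in> sets unit_interval \<longleftrightarrow> A \<in> sets borel \<and> A \<subseteq> {0..<1}"
  by (subst sets_restrict_space_iff) auto

lemma measurable_torus_component: "i < d \<Longrightarrow> (\<lambda>x. x i) \<in> borel_measurable (torus d)"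
proof -
  assume "i < d"
  then have "(\<lambda>x. x i) \<in> measurable (torus d) unit_interval"
    unfolding torus_def by (intro measurable_component_singleton) auto
  then show ?thesis by (simp add: measurable_restrict_space2_iff)
qed

lemma measurable_torusI:
  assumes "\<And>i. i < d \<Longrightarrow> f i \<in> borel_measurable M" "\<And>i x. i < d \<Longrightarrow> x \<in> space M \<Longrightarrow> f i x \<in> {0..<1}"
  shows "(\<lambda>x. \<lambda>i\<in>{..<d}. f i x) \<in> measurable M (torus d)"
  unfolding torus_def
  by (intro measurable_restrict measurable_restrict_space2) (use assms in auto)

lemma emeasure_torus_box:
  assumes "\<And>i. i < d \<Longrightarrow> A i \<in> sets borel \<and> A i \<subseteq> {0..<1}"
  shows "emeasure (torus d) (Pi\<^sub>E {..<d} A) = (\<Prod>i<d. emeasure lborel (A i))"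
proof -
  interpret product_sigma_finite "\<lambda>_::nat. unit_interval"
    by (intro product_sigma_finite.intro prob_space_imp_sigma_finite prob_space_unit_interval)
  have "emeasure (torus d) (Pi\<^sub>E {..<d} A) = (\<Prod>i<d. emeasure unit_interval (A i))"
    unfolding torus_def by (rule emeasure_PiM) (use assms in \<open>auto simp: sets_unit_interval\<close>)
  also have "\<dots> = (\<Prod>i<d. emeasure lborel (A i))"
    using assms by (intro prod.cong refl emeasure_restrict_space) auto
  finally show ?thesis .
qed

lemma sets_torus_box:
  assumes "\<And>i. i < d \<Longrightarrow> A i \<in> sets borel \<and> A i \<subseteq> {0..<1}"
  shows "Pi\<^sub>E {..<d} A \<in> sets (torus d)"
  unfolding torus_def by (rule sets_PiM_I_finite) (use assms in \<open>auto simp: sets_unit_interval\<close>)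

text \<open>Boxes with a corner at the origin are stable under intersection, and they generate the
  product sigma-algebra because they contain the sublevel sets of each coordinate.\<close>

lemma torus_measure_eqI:
  assumes "prob_space M" "prob_space N" "sets M = sets (torus d)" "sets N = sets (torus d)"
    and eq: "\<And>q. (\<And>i. i < d \<Longrightarrow> 0 \<le> q i \<and> q i \<le> 1) \<Longrightarrow>
      emeasure M (Pi\<^sub>E {..<d} (\<lambda>i. {0..<q i})) = emeasure N (Pi\<^sub>E {..<d} (\<lambda>i. {0..<q i}))"
  shows "M = N"
proof -
  define E where "E = {Pi\<^sub>E {..<d} (\<lambda>i. {0..<q i}) | q :: nat \<Rightarrow> real. \<forall>i<d. 0 \<le> q i \<and> q i \<le> 1}"
  define \<Omega> where "\<Omega> = space (torus d)"
  have sub: "E \<subseteq> sets (torus d)"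
    unfolding E_def by (auto intro!: sets_torus_box)
  have EP: "E \<subseteq> Pow \<Omega>" using sub sets.sets_into_space unfolding \<Omega>_def by blast
  have coord: "{x \<in> \<Omega>. x i \<in> A} \<in> sigma_sets \<Omega> E" if i: "i < d" and A: "A \<in> sets borel" for i A
  proof -
    have "(\<lambda>x. x i) \<in> borel_measurable (sigma \<Omega> E)"
    proof (rule borel_measurableI_less)
      fix y :: real
      \<comment> \<open>The side length is clamped to [0, 1] as demanded by \<open>E\<close>; for
        points of the unit cube this does not change the condition x i < y.\<close>
      have "{x \<in> \<Omega>. x i < y} = Pi\<^sub>E {..<d} (\<lambda>k. {0..<(if k = i then max 0 (min y 1) else 1)})"
      proof (rule set_eqI)
        fix x :: "nat \<Rightarrow> real"
        have *: "x k \<in> {0..<(if k = i then max 0 (min y 1) else 1)} \<longleftrightarrow> x k \<in> {0..<1} \<and> (k = i \<longrightarrow> x i < y)" for k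
          by (cases "k = i") (simp_all add: less_max_iff_disj, linarith)
        show "x \<in> {x \<in> \<Omega>. x i < y} \<longleftrightarrow> x \<in> Pi\<^sub>E {..<d} (\<lambda>k. {0..<(if k = i then max 0 (min y 1) else 1)})"
          unfolding \<Omega>_def space_torus PiE_iff mem_Collect_eq * using i by blast
      qed
      then have "{x \<in> \<Omega>. x i < y} \<in> E"
        unfolding E_def by (intro CollectI exI[of _ "\<lambda>k. if k = i then max 0 (min y 1) else 1"]) simp
      then show "{x \<in> space (sigma \<Omega> E). x i < y} \<in> sets (sigma \<Omega> E)"
        using EP by (simp add: space_measure_of sets_measure_of)
    qed
    from measurable_sets[OF this A] show ?thesis
      using EP by (simp add: space_measure_of sets_measure_of vimage_def Int_def conj_commute)
  qed
  have gen: "sets (torus d) = sigma_sets \<Omega> E"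
  proof
    show "sigma_sets \<Omega> E \<subseteq> sets (torus d)"
      unfolding \<Omega>_def by (rule sets.sigma_sets_subset[OF sub])
    have "{{f \<in> \<Pi>\<^sub>E i\<in>{..<d}. space unit_interval. f i \<in> A} |i A. i \<in> {..<d} \<and> A \<in> sets unit_interval} \<subseteq> sigma_sets \<Omega> E"
      using coord by (auto simp: sets_unit_interval \<Omega>_def space_torus space_restrict_space)
    moreover have "(\<Pi>\<^sub>E i\<in>{..<d}. space unit_interval) = \<Omega>" by (simp add: \<Omega>_def space_torus space_restrict_space)
    ultimately show "sets (torus d) \<subseteq> sigma_sets \<Omega> E"
      unfolding torus_def sets_PiM_single by (simp add: sigma_sets_mono)
  qed
  have int: "Int_stable E"
  proof (rule Int_stableI)
    fix a b assume "a \<in> E" "b \<in> E"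
    then obtain q r where "a = Pi\<^sub>E {..<d} (\<lambda>i. {0..<q i})" "b = Pi\<^sub>E {..<d} (\<lambda>i. {0..<r i})"
       "\<forall>i<d. 0 \<le> q i \<and> q i \<le> 1" "\<forall>i<d. 0 \<le> r i \<and> r i \<le> 1" by (auto simp: E_def)
    moreover have "Pi\<^sub>E {..<d} (\<lambda>i. {0..<q i}) \<inter> Pi\<^sub>E {..<d} (\<lambda>i. {0..<r i}) = Pi\<^sub>E {..<d} (\<lambda>i. {0..<min (q i) (r i)})"
      by (auto simp: PiE_Int)
    ultimately show "a \<inter> b \<in> E"
      unfolding E_def by (intro CollectI exI[of _ "\<lambda>i. min (q i) (r i)"]) (simp add: min_def)
  qed
  have O: "\<Omega> \<in> E" unfolding E_def \<Omega>_def space_torus by (intro CollectI exI[of _ "\<lambda>_. 1"]) simp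
  show ?thesis
  proof (rule measure_eqI_generator_eq[OF int EP])
    show "range (\<lambda>_::nat. \<Omega>) \<subseteq> E" "(\<Union>i::nat. \<Omega>) = \<Omega>" using O by auto
    show "emeasure M \<Omega> \<noteq> \<infinity>"
      using finite_measure.emeasure_finite[OF prob_space.finite_measure[OF assms(1)]] by simp
    show "emeasure M X = emeasure N X" if "X \<in> E" for X
      using that eq unfolding E_def by blast
  qed (use assms gen in simp_all)
qed

lemma lborel_frac_translate:
  assumes q: "0 \<le> q" "q \<le> 1"
  shows "emeasure lborel {x \<in> {0..<1}. frac (x + a) < q} = ennreal q"
proof -
  define b where "b = frac a"
  have b: "0 \<le> b" "b < 1" by (auto simp: b_def frac_lt_1)
  have fr: "frac (x + a) = (if x + b < 1 then x + b else x + b - 1)" if "0 \<le> x" "x < 1" for x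
    using that b frac_add[of x a] frac_eq[of x] unfolding b_def by auto
  show ?thesis
  proof (cases "q \<le> b")
    case True
    have "{x \<in> {0..<1}. frac (x + a) < q} = {1 - b..<1 - b + q}"
      using b q True by (auto simp: fr split: if_splits)
    then show ?thesis using q by simp
  next
    case False
    have "{x \<in> {0..<1}. frac (x + a) < q} = {0..<q - b} \<union> {1 - b..<1}"
      using b q False by (auto simp: fr split: if_splits)
    moreover have "emeasure lborel ({0..<q - b} \<union> {1 - b..<1}) = ennreal (q - b) + ennreal b"
      using q b False by (subst plus_emeasure[symmetric]) auto
    ultimately show ?thesis using False b by (simp add: ennreal_plus[symmetric] del: ennreal_plus)
  qed
qed

lemma borel_measurable_frac:
  assumes [measurable]: "f \<in> borel_measurable M"
  shows "(\<lambda>x. frac (f x :: real)) \<in> borel_measurable M"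
  unfolding frac_def by measurable

lemma measurable_torus_translation: "torus_translation d a \<in> measurable (torus d) (torus d)"
proof -
  have "(\<lambda>x. \<lambda>i\<in>{..<d}. frac (x i + a i)) \<in> measurable (torus d) (torus d)"
    by (intro measurable_torusI borel_measurable_frac borel_measurable_add measurable_torus_component)
      (auto simp: frac_lt_1)
  then show ?thesis by (simp add: torus_translation_def[abs_def])
qed

lemma distr_torus_translation: "distr (torus d) (torus d) (torus_translation d a) = torus d"
proof (rule torus_measure_eqI[of _ _ d])
  show "prob_space (distr (torus d) (torus d) (torus_translation d a))"
    by (rule prob_space.prob_space_distr[OF prob_space_torus measurable_torus_translation])
  fix q :: "nat \<Rightarrow> real" assume q: "\<And>i. i < d \<Longrightarrow> 0 \<le> q i \<and> q i \<le> 1"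
  have fm: "{x \<in> {0..<1}. frac (x + a i) < q i} \<in> sets borel" for i
    by (simp add: frac_def)
  have "emeasure (distr (torus d) (torus d) (torus_translation d a)) (Pi\<^sub>E {..<d} (\<lambda>i. {0..<q i})) =
    emeasure (torus d) (torus_translation d a -` (Pi\<^sub>E {..<d} (\<lambda>i. {0..<q i})) \<inter> space (torus d))"
    using q by (intro emeasure_distr measurable_torus_translation sets_torus_box) auto
  also have "torus_translation d a -` (Pi\<^sub>E {..<d} (\<lambda>i. {0..<q i})) \<inter> space (torus d) =
    Pi\<^sub>E {..<d} (\<lambda>i. {x \<in> {0..<1}. frac (x + a i) < q i})"
    unfolding space_torus torus_translation_def set_eq_iff vimage_def Int_iff mem_Collect_eq PiE_iff
    by (simp add: Ball_def) blast
  also have "emeasure (torus d) \<dots> = (\<Prod>i<d. emeasure lborel {x \<in> {0..<1}. frac (x + a i) < q i})"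
    using fm by (intro emeasure_torus_box) auto
  also have "\<dots> = (\<Prod>i<d. emeasure lborel {0..<q i})"
    using q lborel_frac_translate by (intro prod.cong refl) auto
  also have "\<dots> = emeasure (torus d) (Pi\<^sub>E {..<d} (\<lambda>i. {0..<q i}))"
    using q by (intro emeasure_torus_box[symmetric]) auto
  finally show "emeasure (distr (torus d) (torus d) (torus_translation d a)) (Pi\<^sub>E {..<d} (\<lambda>i. {0..<q i})) =
    emeasure (torus d) (Pi\<^sub>E {..<d} (\<lambda>i. {0..<q i}))" .
qed (auto simp: prob_space_torus)

section \<open>Unique ergodicity of translations with dense orbits\<close>

lemma additive_linear:
  fixes f :: "real \<Rightarrow> real"
  assumes nonneg: "\<And>x. 0 \<le> x \<Longrightarrow> x \<le> 1 \<Longrightarrow> 0 \<le> f x"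
    and add: "\<And>x y. 0 \<le> x \<Longrightarrow> 0 \<le> y \<Longrightarrow> x + y \<le> 1 \<Longrightarrow> f (x + y) = f x + f y"
    and c: "0 \<le> c" "c \<le> 1"
  shows "f c = c * f 1"
proof (cases "c = 1")
  case False
  have mono: "f x \<le> f y" if "0 \<le> x" "x \<le> y" "y \<le> 1" for x y
    using add[of x "y - x"] nonneg[of "y - x"] that by auto
  have mult: "f (real k * x) = real k * f x" if "0 \<le> x" "real k * x \<le> 1" for k x
    using that(2)
  proof (induction k)
    case 0
    then show ?case using add[of 0 0] by simp
  next
    case (Suc k)
    have "0 \<le> real k * x" using that(1) by simp
    then have "f (real k * x + x) = f (real k * x) + f x"
      using Suc.prems that(1) by (intro add) (auto simp: algebra_simps)
    moreover have "real k * x \<le> 1" using Suc.prems that(1) by (simp add: algebra_simps)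
    ultimately show ?case using Suc.IH by (simp add: algebra_simps)
  qed
  have frac1: "f (real j / real N) = real j / real N * f 1" if "j \<le> N" "0 < N" for j N
    using mult[of "1 / real N" N] mult[of "1 / real N" j] that by (auto simp: field_simps)
  \<comment> \<open>Monotonicity squeezes f c between the values at the neighbouring multiples of 1
    / N. The case c = 1 is split off so that the upper neighbour still lies in the unit
    interval.\<close>
  have est: "\<bar>f c - c * f 1\<bar> \<le> f 1 / real N" if "0 < N" for N
  proof -
    define j where "j = nat \<lfloor>c * real N\<rfloor>"
    have j: "real j \<le> c * real N" "c * real N < real j + 1"
      using c by (auto simp: j_def)
    have "real j < real N" using j(1) c False that by (smt (verit) mult_less_cancel_right2 of_nat_0_less_iff)
    then have jN: "Suc j \<le> N" by simp
    have "real j / real N \<le> c" "c \<le> real (Suc j) / real N" "real (Suc j) / real N \<le> 1"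
      using j that jN by (auto simp: field_simps)
    then have "real j / real N * f 1 \<le> f c" "f c \<le> real (Suc j) / real N * f 1"
      using mono[of "real j / real N" c] mono[of c "real (Suc j) / real N"] frac1[of j N] frac1[of "Suc j" N] c jN that
      by auto
    moreover have "real j / real N * f 1 \<le> c * f 1" "c * f 1 \<le> real (Suc j) / real N * f 1"
      using mult_right_mono[OF \<open>real j / real N \<le> c\<close> nonneg[of 1]]
        mult_right_mono[OF \<open>c \<le> real (Suc j) / real N\<close> nonneg[of 1]] by simp_all
    moreover have "real (Suc j) / real N * f 1 = real j / real N * f 1 + f 1 / real N"
      by (simp add: add_divide_distrib distrib_right)
    ultimately show ?thesis by linarith
  qed
  have "(\<lambda>N. f 1 / real N) \<longlonglongrightarrow> 0"
    by (rule lim_const_over_n)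
  then have "\<bar>f c - c * f 1\<bar> \<le> 0"
    by (rule tendsto_lowerbound) (auto intro!: eventually_sequentiallyI[of 1] est)
  then show ?thesis by simp
qed simp

text \<open>For sides in (0, 1] this is a product of half-open circle arcs from \<open>t i\<close>
  to \<open>t i + b i\<close>; \<open>frac\<close> takes care of wrapping around.\<close>

definition arc_box :: "nat \<Rightarrow> (nat \<Rightarrow> real) \<Rightarrow> (nat \<Rightarrow> real) \<Rightarrow> (nat \<Rightarrow> real) set" where
  "arc_box d t b = {x \<in> space (torus d). \<forall>i<d. frac (x i - t i) < b i}"

lemma sets_arc_box: "arc_box d t b \<in> sets (torus d)"
proof -
  have "arc_box d t b = Pi\<^sub>E {..<d} (\<lambda>i. {x \<in> {0..<1}. frac (x - t i) < b i})"
    unfolding arc_box_def space_torus set_eq_iff mem_Collect_eq PiE_iff by blast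
  moreover have "{x \<in> {0..<1}. frac (x - t i) < b i} \<in> sets borel" for i
    by (simp add: frac_def)
  ultimately show ?thesis by (simp only:) (rule sets_torus_box, auto)
qed

lemma arc_box_update:
  assumes "j < d"
  shows "arc_box d t (b(j := c)) =
    {x \<in> space (torus d). \<forall>i<d. i \<noteq> j \<longrightarrow> frac (x i - t i) < b i} \<inter> {x. frac (x j - t j) < c}"
proof -
  have "(\<forall>i<d. frac (z i - t i) < (b(j := c)) i) \<longleftrightarrow> (\<forall>i<d. i \<noteq> j \<longrightarrow> frac (z i - t i) < b i) \<and> frac (z j - t j) < c" for z
    using assms by (metis fun_upd_apply)
  then show ?thesis unfolding arc_box_def by blast
qed

lemma frac_mod_eq: "x = y + of_int m \<Longrightarrow> frac x = frac (y :: real)"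
  by (simp add: frac_def)

text \<open>Density of the orbit of 0 in the form given by Kronecker's theorem, with multiples that
  may be negative.\<close>

definition dense_translation :: "nat \<Rightarrow> (nat \<Rightarrow> real) \<Rightarrow> bool" where
  "dense_translation d a \<longleftrightarrow> (\<forall>t. \<forall>\<epsilon>>0. \<exists>k::int. \<exists>m::nat \<Rightarrow> int. \<forall>i<d. \<bar>of_int k * a i - of_int (m i) - t i\<bar> < \<epsilon>)"

text \<open>Modulo integers, t' lies before t by less than \<eta>, so the arc from t shortened by
  \<eta> fits into the arc from t'. Sides of at most 1 prevent wrapping around.\<close>

lemma arc_box_shrink:
  assumes "\<And>i. i < d \<Longrightarrow> \<bar>t' i - of_int (m i) - (t i - \<eta> / 2)\<bar> < \<eta> / 2" "\<And>i. i < d \<Longrightarrow> b i \<le> 1"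
  shows "arc_box d t (\<lambda>i. b i - \<eta>) \<subseteq> arc_box d t' b"
proof -
  have "frac (y - t' i) < b i" if i: "i < d" and y: "frac (y - t i) < b i - \<eta>" for y i
  proof -
    define \<delta> where "\<delta> = t i - (t' i - of_int (m i))"
    have \<delta>: "0 < \<delta>" "\<delta> < \<eta>" using assms(1)[OF i] unfolding \<delta>_def by linarith+
    have "y - t' i = (frac (y - t i) + \<delta>) + of_int (\<lfloor>y - t i\<rfloor> - m i)"
      by (simp add: \<delta>_def frac_def)
    then have "frac (y - t' i) = frac (frac (y - t i) + \<delta>)" by (rule frac_mod_eq)
    also have "\<dots> = frac (y - t i) + \<delta>"
      using y \<delta> assms(2)[OF i] frac_ge_0[of "y - t i"] by (intro frac_eq[THEN iffD2]) auto
    finally show ?thesis using y \<delta> by simp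
  qed
  then show ?thesis by (auto simp: arc_box_def)
qed

text \<open>Half-open arcs are increasing unions of the shortened ones, so the loss allowed in
  \<open>arc_box_shrink\<close> disappears in the limit.\<close>

lemma measure_arc_box_limit:
  assumes M: "prob_space M" "sets M = sets (torus d)"
    and le: "\<And>n. measure M (arc_box d t (\<lambda>i. b i - 1 / real (Suc n))) \<le> c"
  shows "measure M (arc_box d t b) \<le> c"
proof -
  interpret prob_space M by fact
  define A where "A = (\<lambda>n. arc_box d t (\<lambda>i. b i - 1 / real (Suc n)))"
  have "incseq A"
  proof (rule incseq_SucI)
    fix n
    have "1 / real (Suc (Suc n)) \<le> 1 / real (Suc n)" by (simp add: frac_le)
    then show "A n \<subseteq> A (Suc n)" unfolding A_def arc_box_def by fastforce
  qed
  moreover have "range A \<subseteq> sets M" using sets_arc_box M(2) by (auto simp: A_def)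
  ultimately have lim: "(\<lambda>n. measure M (A n)) \<longlonglongrightarrow> measure M (\<Union>n. A n)"
    by (intro finite_Lim_measure_incseq)
  have "(\<Union>n. A n) = arc_box d t b"
  proof
    show "(\<Union>n. A n) \<subseteq> arc_box d t b"
      unfolding A_def arc_box_def by (auto, smt (verit) divide_nonneg_nonneg of_nat_0_le_iff)
    show "arc_box d t b \<subseteq> (\<Union>n. A n)"
    proof
      fix x assume x: "x \<in> arc_box d t b"
      have "\<forall>\<^sub>F n in sequentially. \<forall>i\<in>{..<d}. frac (x i - t i) < b i - 1 / real (Suc n)"
      proof (subst eventually_ball_finite_distrib, simp, intro ballI)
        fix i assume "i \<in> {..<d}"
        have "(\<lambda>n. b i - 1 / real (Suc n)) \<longlonglongrightarrow> b i - 0"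
          by (intro tendsto_intros LIMSEQ_Suc[OF lim_1_over_n])
        then show "\<forall>\<^sub>F n in sequentially. frac (x i - t i) < b i - 1 / real (Suc n)"
          using x \<open>i \<in> {..<d}\<close> by (intro order_tendstoD(1)) (auto simp: arc_box_def)
      qed
      from eventually_happens[OF this] obtain n where "\<forall>i\<in>{..<d}. frac (x i - t i) < b i - 1 / real (Suc n)" by auto
      then have "x \<in> A n" using x by (auto simp: A_def arc_box_def)
      then show "x \<in> (\<Union>n. A n)" by blast
    qed
  qed
  with lim have "(\<lambda>n. measure M (A n)) \<longlonglongrightarrow> measure M (arc_box d t b)" by simp
  then show ?thesis by (rule tendsto_upperbound) (use le in \<open>simp_all add: A_def\<close>)
qed

text \<open>The measure of a box of arcs does not depend on its position, hence it is additive, and so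
  linear, in each side length.\<close>

lemma translation_uniquely_ergodic:
  assumes dense: "dense_translation d a" and M: "sets M = sets (torus d)" and inv: "invariant_prob M (torus_translation d a)"
  shows "M = torus d"
proof -
  interpret prob_space M using inv by (simp add: invariant_prob_def)
  have R: "torus_translation d a \<in> measurable M M" "distr M M (torus_translation d a) = M"
    using inv by (auto simp: invariant_prob_def)
  have sp: "space M = space (torus d)" by (rule sets_eq_imp_space_eq[OF M])
  have sets: "arc_box d t b \<in> sets M" for t b using sets_arc_box M by simp
  have step: "measure M (arc_box d (\<lambda>i. t i + a i) b) = measure M (arc_box d t b)" for t b
  proof -
    have "frac (frac (y + a i) - (t i + a i)) = frac (y - t i)" for y i
      by (rule frac_mod_eq[of _ _ "- \<lfloor>y + a i\<rfloor>"]) (simp add: frac_def)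
    then have "torus_translation d a -` arc_box d (\<lambda>i. t i + a i) b \<inter> space M = arc_box d t b"
      using measurable_space[OF R(1)] by (auto simp: arc_box_def sp torus_translation_def)
    then show ?thesis using measure_distr[OF R(1) sets] R(2) by metis
  qed
  have orbit: "measure M (arc_box d (\<lambda>i. of_int k * a i) b) = measure M (arc_box d (\<lambda>_. 0) b)" for k b
  proof (induction k rule: int_induct[where k = 0])
    case (step1 k)
    then show ?case using step[of "\<lambda>i. of_int k * a i" b] by (simp add: algebra_simps)
  next
    case (step2 k)
    then show ?case using step[of "\<lambda>i. of_int (k - 1) * a i" b] by (simp add: algebra_simps)
  qed simp
  \<comment> \<open>Shortening all sides by 1 / (n + 1) makes room to replace \<open>t\<close> by an
    orbit point, for which \<open>orbit\<close> applies. The point is sought half a unit of slack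
    before \<open>t\<close> for one inequality and after it for the other.\<close>
  have any: "measure M (arc_box d t b) = measure M (arc_box d (\<lambda>_. 0) b)" if b: "\<And>i. i < d \<Longrightarrow> b i \<le> 1" for t b
  proof (rule antisym)
    show "measure M (arc_box d t b) \<le> measure M (arc_box d (\<lambda>_. 0) b)"
    proof (rule measure_arc_box_limit[OF prob_space_axioms M])
      fix n
      obtain k m where km: "\<forall>i<d. \<bar>of_int k * a i - of_int (m i) - (t i - 1 / real (Suc n) / 2)\<bar> < 1 / real (Suc n) / 2"
        using dense[unfolded dense_translation_def, rule_format, of "1 / real (Suc n) / 2" "\<lambda>i. t i - 1 / real (Suc n) / 2"] by auto
      have "arc_box d t (\<lambda>i. b i - 1 / real (Suc n)) \<subseteq> arc_box d (\<lambda>i. of_int k * a i) b"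
        using km b by (intro arc_box_shrink[of d _ m]) auto
      then have "measure M (arc_box d t (\<lambda>i. b i - 1 / real (Suc n))) \<le> measure M (arc_box d (\<lambda>i. of_int k * a i) b)"
        by (intro finite_measure_mono sets)
      then show "measure M (arc_box d t (\<lambda>i. b i - 1 / real (Suc n))) \<le> measure M (arc_box d (\<lambda>_. 0) b)"
        by (simp only: orbit)
    qed
    show "measure M (arc_box d (\<lambda>_. 0) b) \<le> measure M (arc_box d t b)"
    proof (rule measure_arc_box_limit[OF prob_space_axioms M])
      fix n
      obtain k m where km: "\<forall>i<d. \<bar>of_int k * a i - of_int (m i) - (t i + 1 / real (Suc n) / 2)\<bar> < 1 / real (Suc n) / 2"
        using dense[unfolded dense_translation_def, rule_format, of "1 / real (Suc n) / 2" "\<lambda>i. t i + 1 / real (Suc n) / 2"] by auto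
      have "arc_box d (\<lambda>i. of_int k * a i) (\<lambda>i. b i - 1 / real (Suc n)) \<subseteq> arc_box d t b"
      proof (rule arc_box_shrink[of d _ "\<lambda>i. - m i"])
        fix i assume "i < d"
        have "t i - of_int (- m i) - (of_int k * a i - 1 / real (Suc n) / 2) = - (of_int k * a i - of_int (m i) - (t i + 1 / real (Suc n) / 2))"
          by simp
        then show "\<bar>t i - of_int (- m i) - (of_int k * a i - 1 / real (Suc n) / 2)\<bar> < 1 / real (Suc n) / 2"
          using km \<open>i < d\<close> by (simp only: abs_minus_cancel)
      qed (rule b)
      then have "measure M (arc_box d (\<lambda>i. of_int k * a i) (\<lambda>i. b i - 1 / real (Suc n))) \<le> measure M (arc_box d t b)"
        by (intro finite_measure_mono sets)
      then show "measure M (arc_box d (\<lambda>_. 0) (\<lambda>i. b i - 1 / real (Suc n))) \<le> measure M (arc_box d t b)"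
        by (simp only: orbit)
    qed
  qed
  define G where "G = (\<lambda>b. measure M (arc_box d (\<lambda>_. 0) b))"
  \<comment> \<open>An arc of length x + y is cut at x. The second piece starts at x instead of 0,
    and by \<open>any\<close> its measure does not depend on that.\<close>
  have split: "G (b(j := x + y)) = G (b(j := x)) + G (b(j := y))"
    if j: "j < d" and b: "\<And>i. i < d \<Longrightarrow> b i \<le> 1" and xy: "0 \<le> x" "0 \<le> y" "x + y \<le> 1" for b j x y
  proof -
    define t where "t = (\<lambda>i. if i = j then x else 0)"
    have fr: "frac (z - x) = (if frac z < x then frac z - x + 1 else frac z - x)" for z
    proof -
      have "z - x = (frac z - x) + of_int \<lfloor>z\<rfloor>" "z - x = (frac z - x + 1) + of_int (\<lfloor>z\<rfloor> - 1)" by (auto simp: frac_def)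
      then have "frac (z - x) = frac (frac z - x)" "frac (z - x) = frac (frac z - x + 1)" by (metis frac_mod_eq)+
      moreover have "frac (frac z - x) = frac z - x" if "\<not> frac z < x"
        using that xy frac_lt_1[of z] by (intro frac_eq[THEN iffD2]) auto
      moreover have "frac (frac z - x + 1) = frac z - x + 1" if "frac z < x"
        unfolding frac_eq using that xy frac_ge_0[of z] by linarith
      ultimately show ?thesis by auto
    qed
    have one: "frac z < x + y \<longleftrightarrow> frac z < x \<or> frac (z - x) < y" "\<not> (frac z < x \<and> frac (z - x) < y)" for z
    proof -
      have "(f < x + y \<longleftrightarrow> f < x \<or> (if f < x then f - x + 1 else f - x) < y) \<and> \<not> (f < x \<and> (if f < x then f - x + 1 else f - x) < y)"
        if "0 \<le> f" for f
        using xy that by auto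
      from this[OF frac_ge_0[of z], folded fr[of z]]
      show "frac z < x + y \<longleftrightarrow> frac z < x \<or> frac (z - x) < y" "\<not> (frac z < x \<and> frac (z - x) < y)"
        by blast+
    qed
    define P where "P = {z \<in> space (torus d). \<forall>i<d. i \<noteq> j \<longrightarrow> frac (z i) < b i}"
    have box: "arc_box d (\<lambda>_. 0) (b(j := c)) = P \<inter> {z. frac (z j) < c}"
      "arc_box d t (b(j := c)) = P \<inter> {z. frac (z j - x) < c}" for c
      unfolding arc_box_update[OF j] P_def t_def by auto
    have un: "arc_box d (\<lambda>_. 0) (b(j := x + y)) = arc_box d (\<lambda>_. 0) (b(j := x)) \<union> arc_box d t (b(j := y))"
    proof -
      have "{z. frac (z j) < x + y} = {z. frac (z j) < x} \<union> {z. frac (z j - x) < y}"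
        by (rule set_eqI) (simp only: mem_Collect_eq Un_iff one(1))
      then show ?thesis by (simp only: box Int_Un_distrib)
    qed
    have "arc_box d (\<lambda>_. 0) (b(j := x)) \<inter> arc_box d t (b(j := y)) = {}"
    proof -
      have "{z. frac (z j) < x} \<inter> {z. frac (z j - x) < y} = {}"
        using one(2) by (simp add: disjoint_iff)
      then show ?thesis unfolding box by blast
    qed
    then have "G (b(j := x + y)) = G (b(j := x)) + measure M (arc_box d t (b(j := y)))"
      unfolding G_def un by (intro finite_measure_Union sets)
    also have "measure M (arc_box d t (b(j := y))) = G (b(j := y))"
      unfolding G_def using b xy by (intro any) auto
    finally show ?thesis .
  qed
  have lin: "G (b(j := c)) = c * G (b(j := 1))" if "j < d" "\<And>i. i < d \<Longrightarrow> b i \<le> 1" "0 \<le> c" "c \<le> 1" for b j c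
    by (rule additive_linear[of "\<lambda>c. G (b(j := c))"]) (use split that in \<open>auto simp: G_def\<close>)
  \<comment> \<open>The sides are set one at a time, starting from the full torus; each contributes
    its length as a factor by \<open>lin\<close>.\<close>
  have prod: "G (\<lambda>i. if i < m then b i else 1) = (\<Prod>i<m. b i)" if "m \<le> d" "\<And>i. i < d \<Longrightarrow> 0 \<le> b i \<and> b i \<le> 1" for m b
    using that(1)
  proof (induction m)
    case 0
    have "arc_box d (\<lambda>_. 0) (\<lambda>_. 1) = space M" by (auto simp: arc_box_def sp frac_lt_1)
    then show ?case by (simp add: G_def prob_space)
  next
    case (Suc m)
    define b' where "b' = (\<lambda>i. if i < m then b i else 1)"
    have "(\<lambda>i. if i < Suc m then b i else 1) = b'(m := b m)" "b'(m := 1) = b'"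
      by (auto simp: b'_def fun_eq_iff)
    then have "G (\<lambda>i. if i < Suc m then b i else 1) = b m * G b'"
      using lin[of m b' "b m"] Suc.prems that(2) by (simp add: b'_def)
    then show ?case using Suc by (simp add: b'_def)
  qed
  show ?thesis
  proof (rule torus_measure_eqI[OF prob_space_axioms prob_space_torus M refl])
    fix q :: "nat \<Rightarrow> real" assume q: "\<And>i. i < d \<Longrightarrow> 0 \<le> q i \<and> q i \<le> 1"
    have "Pi\<^sub>E {..<d} (\<lambda>i. {0..<q i}) = arc_box d (\<lambda>_. 0) (\<lambda>i. if i < d then q i else 1)"
    proof (rule set_eqI)
      fix x :: "nat \<Rightarrow> real"
      have "x i \<in> {0..<q i} \<longleftrightarrow> x i \<in> {0..<1} \<and> frac (x i - 0) < (if i < d then q i else 1)" if "i < d" for i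
        using q[OF that] that frac_eq[of "x i"] by auto
      then show "x \<in> Pi\<^sub>E {..<d} (\<lambda>i. {0..<q i}) \<longleftrightarrow> x \<in> arc_box d (\<lambda>_. 0) (\<lambda>i. if i < d then q i else 1)"
        unfolding arc_box_def space_torus PiE_iff mem_Collect_eq lessThan_iff by blast
    qed
    then have "emeasure M (Pi\<^sub>E {..<d} (\<lambda>i. {0..<q i})) = ennreal (\<Prod>i<d. q i)"
      using prod[of d q] q by (simp add: emeasure_eq_measure G_def)
    also have "\<dots> = (\<Prod>i<d. emeasure lborel {0..<q i})"
      using q by (subst prod_ennreal[symmetric]) simp_all
    also have "\<dots> = emeasure (torus d) (Pi\<^sub>E {..<d} (\<lambda>i. {0..<q i}))"
      using q by (intro emeasure_torus_box[symmetric]) auto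
    finally show "emeasure M (Pi\<^sub>E {..<d} (\<lambda>i. {0..<q i})) = emeasure (torus d) (Pi\<^sub>E {..<d} (\<lambda>i. {0..<q i}))" .
  qed
qed

text \<open>Off a null set the fibres are singletons, so an invariant measure is recovered from its image,
  which is Lebesgue measure; \<open>closed_map\<close> makes the inverse measurable.\<close>

lemma isomorphic_to_torus:
  fixes X :: "'a :: topological_space set" and T :: "'a \<Rightarrow> 'a" and psi :: "'a \<Rightarrow> nat \<Rightarrow> real" and d :: nat and a :: "nat \<Rightarrow> real"
  defines "B \<equiv> restrict_space borel X" and "R \<equiv> torus_translation d a"
  assumes dense: "dense_translation d a"
    and T: "T \<in> measurable B B"
    and psi: "psi \<in> measurable B (torus d)"
    and psi_T: "\<And>x. x \<in> X \<Longrightarrow> psi (T x) = R (psi x)"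
    and onto: "psi ` X = space (torus d)"
    and closed_map: "\<And>C. closed C \<Longrightarrow> psi ` (X \<inter> C) \<in> sets (torus d)"
    and N: "N \<in> null_sets (torus d)"
    and inj: "\<And>x y. x \<in> X \<Longrightarrow> y \<in> X \<Longrightarrow> psi x = psi y \<Longrightarrow> x \<noteq> y \<Longrightarrow> \<exists>n. (R ^^ n) (psi x) \<in> N"
  shows "\<exists>\<mu>. (sets \<mu> = sets B \<and> invariant_prob \<mu> T) \<and>
    (\<forall>\<nu>. sets \<nu> = sets B \<and> invariant_prob \<nu> T \<longrightarrow> \<nu> = \<mu>) \<and>
    measurably_isomorphic \<mu> T (torus d) R"
proof -
  interpret torus: prob_space "torus d" by (rule prob_space_torus)
  have R: "R \<in> measurable (torus d) (torus d)" "distr (torus d) (torus d) R = torus d"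
    unfolding R_def by (rule measurable_torus_translation, rule distr_torus_translation)
  have Rn: "R ^^ n \<in> measurable (torus d) (torus d) \<and> distr (torus d) (torus d) (R ^^ n) = torus d" for n
  proof (induction n)
    case 0
    then show ?case by (simp add: id_def distr_id)
  next
    case (Suc n)
    then have "distr (torus d) (torus d) (R \<circ> R ^^ n) = distr (distr (torus d) (torus d) (R ^^ n)) (torus d) R"
      by (intro distr_distr[symmetric] R) simp
    then show ?case using Suc R measurable_comp[of "R ^^ n" "torus d" "torus d" R "torus d"]
      by (simp only: funpow.simps)
  qed
  have spB: "space B = X" by (simp add: B_def space_restrict_space)
  \<comment> \<open>Avoiding \<open>N\<close> along the entire forward orbit makes this set forward
    invariant; it has full measure because every power of \<open>R\<close> preserves Lebesgue
    measure.\<close>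
  define Y0 where "Y0 = {y \<in> space (torus d). \<forall>n. (R ^^ n) y \<notin> N}"
  define Z where "Z = (\<Union>n. (R ^^ n) -` N \<inter> space (torus d))"
  have "(R ^^ n) -` N \<inter> space (torus d) \<in> null_sets (torus d)" for n
  proof (rule null_setsI)
    show "(R ^^ n) -` N \<inter> space (torus d) \<in> sets (torus d)"
      using Rn[of n] N by (intro measurable_sets[of _ "torus d" "torus d"]) auto
    have "emeasure (distr (torus d) (torus d) (R ^^ n)) N = emeasure (torus d) ((R ^^ n) -` N \<inter> space (torus d))"
      using Rn[of n] N by (intro emeasure_distr) auto
    then show "emeasure (torus d) ((R ^^ n) -` N \<inter> space (torus d)) = 0"
      using Rn[of n] N by (simp add: null_setsD1)
  qed
  then have Z: "Z \<in> null_sets (torus d)" unfolding Z_def by (intro null_sets_UN) simp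
  have Y0: "Y0 = space (torus d) - Z" by (auto simp: Y0_def Z_def)
  have Y0_sets: "Y0 \<in> sets (torus d)" unfolding Y0 using Z by auto
  have Y0_null: "emeasure (torus d) (space (torus d) - Y0) = 0"
  proof -
    have "space (torus d) - Y0 = Z" using sets.sets_into_space[OF null_setsD2[OF Z]] by (auto simp: Y0)
    then show ?thesis using Z by (simp add: null_setsD1)
  qed
  have AE_Y0: "AE y in torus d. y \<in> Y0"
    by (rule AE_I[of _ _ "space (torus d) - Y0"]) (use Y0_sets Y0_null in auto)
  have R_Y0: "R y \<in> Y0" if "y \<in> Y0" for y
  proof -
    have "(R ^^ Suc n) y \<notin> N" for n using that unfolding Y0_def by blast
    then have "(R ^^ n) (R y) \<notin> N" for n by (simp only: funpow_Suc_right o_apply) blast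
    moreover have "R y \<in> space (torus d)" using that measurable_space[OF R(1)] by (simp add: Y0_def)
    ultimately show ?thesis by (simp add: Y0_def)
  qed
  have unique: "x = y" if "x \<in> X" "y \<in> X" "psi x = psi y" "psi x \<in> Y0" for x y
    using inj[of x y] that by (auto simp: Y0_def)
  have "space (torus d) \<noteq> {}" by (rule torus.not_empty)
  then obtain x0 where x0: "x0 \<in> X" using onto by auto
  \<comment> \<open>The inverse of \<open>psi\<close> where fibres are singletons. The default
    \<open>x0\<close> on the null complement keeps the values in \<open>X\<close> and does not
    affect any image measure.\<close>
  define G where "G = (\<lambda>y. if y \<in> Y0 then inv_into X psi y else x0)"
  have GX: "G y \<in> X" for y
    using onto x0 inv_into_into[of y psi X] by (auto simp: G_def Y0_def)
  have psi_G: "psi (G y) = y" if "y \<in> Y0" for y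
    using onto that f_inv_into_f[of y psi X] by (auto simp: G_def Y0_def)
  have G_psi: "G (psi x) = x" if "x \<in> X" "psi x \<in> Y0" for x
    using unique[OF GX that(1), of "psi x"] psi_G[OF that(2)] that by simp
  have G: "G \<in> measurable (torus d) B"
    unfolding B_def
  proof (rule measurable_restrict_space2)
    show "G \<in> borel_measurable (torus d)"
    proof (rule borel_measurableI)
      fix S :: "'a set" assume "open S"
      then have "psi ` (X \<inter> - S) \<in> sets (torus d)" by (intro closed_map) auto
      moreover have "G y \<in> S \<longleftrightarrow> y \<notin> psi ` (X \<inter> - S)" if "y \<in> Y0" for y
      proof
        assume "G y \<in> S"
        show "y \<notin> psi ` (X \<inter> - S)"
        proof
          assume "y \<in> psi ` (X \<inter> - S)"
          then obtain x where "x \<in> X" "x \<notin> S" "y = psi x" by auto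
          then show False using G_psi[of x] that \<open>G y \<in> S\<close> by simp
        qed
      next
        assume "y \<notin> psi ` (X \<inter> - S)"
        then show "G y \<in> S" using psi_G[OF that] GX[of y] by (metis ComplI IntI image_eqI)
      qed
      moreover have "G y = x0" if "y \<notin> Y0" for y using that by (simp add: G_def)
      moreover have "Y0 \<subseteq> space (torus d)" using sets.sets_into_space[OF Y0_sets] .
      moreover define P where "P = psi ` (X \<inter> - S)"
      ultimately have "G -` S \<inter> space (torus d) = (Y0 - P) \<union> (if x0 \<in> S then space (torus d) - Y0 else {})"
        unfolding P_def[symmetric] by (cases "x0 \<in> S") (force | blast)+
      then show "G -` S \<inter> space (torus d) \<in> sets (torus d)"
        using Y0_sets \<open>psi ` (X \<inter> - S) \<in> sets (torus d)\<close> by (simp add: P_def)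
    qed
  qed (use GX in auto)
  define \<mu> where "\<mu> = distr (torus d) B G"
  have sets_mu: "sets \<mu> = sets B" and space_mu: "space \<mu> = X" by (simp_all add: \<mu>_def spB)
  have T_G: "T (G y) = G (R y)" if "y \<in> Y0" for y
  proof -
    have "T (G y) \<in> X" using measurable_space[OF T] GX spB by auto
    moreover have "psi (T (G y)) = R y" using psi_T[OF GX] psi_G[OF that] by simp
    ultimately show ?thesis using G_psi[of "T (G y)"] R_Y0[OF that] by simp
  qed
  have "distr \<mu> B T = distr (torus d) B (T \<circ> G)"
    unfolding \<mu>_def by (rule distr_distr[OF T G])
  also have "\<dots> = distr (torus d) B (G \<circ> R)"
  proof (rule distr_cong_AE)
    show "AE y in torus d. (T \<circ> G) y = (G \<circ> R) y"
      using AE_Y0 by eventually_elim (simp add: T_G)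
  qed (use measurable_comp[OF G T] measurable_comp[OF R(1) G] in auto)
  also have "\<dots> = distr (distr (torus d) (torus d) R) B G"
    by (rule distr_distr[OF G R(1), symmetric])
  also have "\<dots> = \<mu>" by (simp add: R(2) \<mu>_def)
  finally have T_mu: "distr \<mu> B T = \<mu>" .
  have meas_mu: "measurable \<mu> \<mu> = measurable B B" "\<And>M :: (nat \<Rightarrow> real) measure. measurable \<mu> M = measurable B M"
    by (intro measurable_cong_sets sets_mu refl)+
  have inv: "invariant_prob \<mu> T"
    unfolding invariant_prob_def
  proof (intro conjI)
    show "prob_space \<mu>" unfolding \<mu>_def by (rule torus.prob_space_distr[OF G])
    show "T \<in> measurable \<mu> \<mu>" using T meas_mu by simp
    show "distr \<mu> \<mu> T = \<mu>" using T_mu distr_cong[OF refl sets_mu, of \<mu> T T] by simp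
  qed
  have uniq: "\<nu> = \<mu>" if sets: "sets \<nu> = sets B" and "invariant_prob \<nu> T" for \<nu>
  proof -
    interpret nu: prob_space \<nu> using that by (simp add: invariant_prob_def)
    have sp: "space \<nu> = X" using sets_eq_imp_space_eq[OF sets] spB by simp
    have mc: "measurable \<nu> M = measurable B M" for M :: "'b measure" by (intro measurable_cong_sets sets refl)
    have mcT: "T \<in> measurable \<nu> \<nu>" "distr \<nu> \<nu> T = \<nu>" using that(2) by (auto simp: invariant_prob_def)
    have mpsi: "psi \<in> measurable \<nu> (torus d)" using psi measurable_cong_sets[OF sets refl, of "torus d"] by simp
    have "distr (distr \<nu> (torus d) psi) (torus d) R = distr \<nu> (torus d) (R \<circ> psi)"
      by (rule distr_distr[OF R(1) mpsi])
    also have "\<dots> = distr \<nu> (torus d) (psi \<circ> T)"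
      by (rule distr_cong) (auto simp: sp psi_T)
    also have "\<dots> = distr (distr \<nu> \<nu> T) (torus d) psi"
      by (rule distr_distr[OF mpsi mcT(1), symmetric])
    also have "\<dots> = distr \<nu> (torus d) psi" by (simp add: mcT)
    finally have "invariant_prob (distr \<nu> (torus d) psi) R"
      using nu.prob_space_distr[OF mpsi] R(1) distr_cong[of "distr \<nu> (torus d) psi" _ "distr \<nu> (torus d) psi" "torus d" R R]
      by (simp add: invariant_prob_def)
    then have torus: "distr \<nu> (torus d) psi = torus d"
      unfolding R_def by (intro translation_uniquely_ergodic[OF dense]) auto
    have "AE x in \<nu>. psi x \<in> Y0"
      by (rule AE_distrD[OF mpsi, unfolded torus, OF AE_Y0])
    then have AE: "AE x in \<nu>. x = (G \<circ> psi) x"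
      using AE_space by eventually_elim (simp add: sp G_psi)
    have mG: "G \<circ> psi \<in> measurable \<nu> B" by (rule measurable_comp[OF mpsi G])
    have id: "(\<lambda>x. x) \<in> measurable \<nu> B" using measurable_cong_sets[OF sets refl, of B] by simp
    have "\<nu> = distr \<nu> B (\<lambda>x. x)" by (rule distr_id2[OF sets[symmetric], symmetric])
    also have "\<dots> = distr \<nu> B (G \<circ> psi)"
      by (rule distr_cong_AE[OF refl refl AE id mG])
    also have "\<dots> = distr (distr \<nu> (torus d) psi) B G" by (rule distr_distr[OF G mpsi, symmetric])
    also have "\<dots> = \<mu>" by (simp add: torus \<mu>_def)
    finally show ?thesis .
  qed
  define X0 where "X0 = psi -` Y0 \<inter> X"
  have X0_sets: "X0 \<in> sets \<mu>"
    using measurable_sets[OF psi Y0_sets] by (simp add: X0_def sets_mu spB)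
  have mpsi: "psi \<in> measurable \<mu> (torus d)" using psi meas_mu by simp
  have AE_eq: "emeasure \<mu> A = emeasure (torus d) {y \<in> Y0. G y \<in> A}" if "A \<in> sets \<mu>" for A
  proof -
    have A: "A \<in> sets B" using that sets_mu by simp
    have GA: "G -` A \<inter> space (torus d) \<in> sets (torus d)" by (rule measurable_sets[OF G A])
    have eq: "{y \<in> Y0. G y \<in> A} = Y0 \<inter> (G -` A \<inter> space (torus d))" by (auto simp: Y0_def)
    have "emeasure \<mu> A = emeasure (torus d) (G -` A \<inter> space (torus d))"
      unfolding \<mu>_def by (rule emeasure_distr[OF G A])
    also have "\<dots> = emeasure (torus d) {y \<in> Y0. G y \<in> A}"
    proof (rule emeasure_eq_AE)
      show "AE y in torus d. y \<in> G -` A \<inter> space (torus d) \<longleftrightarrow> y \<in> {y \<in> Y0. G y \<in> A}"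
        using AE_Y0 AE_space by eventually_elim auto
    qed (use GA Y0_sets eq in auto)
    finally show ?thesis .
  qed
  have bij: "bij_betw psi X0 Y0"
    unfolding bij_betw_def
  proof
    show "inj_on psi X0" by (rule inj_onI) (auto simp: X0_def intro: unique)
    have "y \<in> psi ` X0" if "y \<in> Y0" for y
      using that psi_G[OF that] GX[of y] by (intro image_eqI[of _ _ "G y"]) (auto simp: X0_def)
    then show "psi ` X0 = Y0" by (auto simp: X0_def)
  qed
  have inv_G: "the_inv_into X0 psi y = G y" if "y \<in> Y0" for y
    using bij that psi_G[OF that] GX[of y] by (intro the_inv_into_f_eq) (auto simp: bij_betw_def X0_def)
  have iso: "measurably_isomorphic \<mu> T (torus d) R"
    unfolding measurably_isomorphic_def
  proof (intro bexI[OF _ X0_sets] bexI[OF _ Y0_sets] exI[of _ psi] conjI ballI)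
    have "space \<mu> - X0 \<in> sets \<mu>" using X0_sets by auto
    then have "emeasure \<mu> (space \<mu> - X0) = emeasure (torus d) {y \<in> Y0. G y \<in> space \<mu> - X0}" by (rule AE_eq)
    also have "{y \<in> Y0. G y \<in> space \<mu> - X0} = {}" using psi_G GX by (auto simp: X0_def)
    finally show "emeasure \<mu> (space \<mu> - X0) = 0" by simp
    show "emeasure (torus d) (space (torus d) - Y0) = 0" by (rule Y0_null)
    show "T ` X0 \<subseteq> X0"
      using measurable_space[OF T] psi_T R_Y0 by (auto simp: X0_def spB)
    show "R ` Y0 \<subseteq> Y0" using R_Y0 by auto
    show "bij_betw psi X0 Y0" by (rule bij)
    show mp: "psi \<in> measurable (restrict_space \<mu> X0) (restrict_space (torus d) Y0)"
      by (intro measurable_restrict_space2 measurable_restrict_space1 mpsi)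
         (auto simp: space_restrict_space X0_def)
    have "G \<in> measurable (restrict_space (torus d) Y0) (restrict_space \<mu> X0)"
    proof (intro measurable_restrict_space2 measurable_restrict_space1)
      show "G \<in> measurable (torus d) \<mu>" using G measurable_cong_sets[OF refl sets_mu, of "torus d"] by simp
      show "G \<in> space (restrict_space (torus d) Y0) \<rightarrow> X0"
        using psi_G GX by (auto simp: space_restrict_space X0_def)
    qed
    moreover have "the_inv_into X0 psi y = G y" if "y \<in> space (restrict_space (torus d) Y0)" for y
      using inv_G that by (simp add: space_restrict_space)
    ultimately show "the_inv_into X0 psi \<in> measurable (restrict_space (torus d) Y0) (restrict_space \<mu> X0)"
      by (subst measurable_cong[of _ _ G]) auto
    show "distr (restrict_space \<mu> X0) (restrict_space (torus d) Y0) psi = restrict_space (torus d) Y0"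
    proof (rule measure_eqI)
      fix A assume "A \<in> sets (distr (restrict_space \<mu> X0) (restrict_space (torus d) Y0) psi)"
      then have A: "A \<in> sets (restrict_space (torus d) Y0)" by simp
      then have A': "A \<in> sets (torus d)" "A \<subseteq> Y0" using Y0_sets by (auto simp: sets_restrict_space_iff)
      have "emeasure (distr (restrict_space \<mu> X0) (restrict_space (torus d) Y0) psi) A =
        emeasure (restrict_space \<mu> X0) (psi -` A \<inter> space (restrict_space \<mu> X0))"
        by (rule emeasure_distr[OF mp A])
      also have "psi -` A \<inter> space (restrict_space \<mu> X0) = psi -` A \<inter> space \<mu>"
        using A'(2) by (auto simp: space_restrict_space X0_def space_mu)
      also have "emeasure (restrict_space \<mu> X0) (psi -` A \<inter> space \<mu>) = emeasure \<mu> (psi -` A \<inter> space \<mu>)"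
        using A'(2) X0_sets by (intro emeasure_restrict_space) (auto simp: X0_def space_mu)
      also have "\<dots> = emeasure (torus d) {y \<in> Y0. G y \<in> psi -` A \<inter> space \<mu>}"
        using measurable_sets[OF mpsi A'(1)] by (rule AE_eq)
      also have "{y \<in> Y0. G y \<in> psi -` A \<inter> space \<mu>} = A"
        using A'(2) psi_G GX by (auto simp: space_mu)
      also have "emeasure (torus d) A = emeasure (restrict_space (torus d) Y0) A"
        using A'(2) Y0_sets by (intro emeasure_restrict_space[symmetric]) auto
      finally show "emeasure (distr (restrict_space \<mu> X0) (restrict_space (torus d) Y0) psi) A = emeasure (restrict_space (torus d) Y0) A" .
    qed simp
    show "psi (T x) = R (psi x)" if "x \<in> X0" for x
      using that psi_T by (simp add: X0_def)
  qed
  show ?thesis using sets_mu inv uniq iso by blast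
qed

section \<open>The factor map\<close>

text \<open>Coordinates with respect to the lattice spanned by \<open>\<alpha>\<^sup>2 - 1\<close> and \<open>\<alpha> - 1\<close>, the projections of the
  differences of the basis vectors; modulo this lattice all letters move the walk by the same vector.\<close>

definition lattice_coord :: "complex \<Rightarrow> nat \<Rightarrow> real" where
  "lattice_coord z i = (if i = 0 then Im (z / (\<alpha> - 1)) / Im \<alpha>
     else Re (z / (\<alpha> - 1)) - Im (z / (\<alpha> - 1)) / Im \<alpha> * (1 + Re \<alpha>))"

definition lattice_point :: "real \<Rightarrow> real \<Rightarrow> complex" where
  "lattice_point x y = x * (\<alpha>^2 - 1) + y * (\<alpha> - 1)"

lemma alpha_ne_1: "\<alpha> - 1 \<noteq> 0"
  using Im_alpha by auto

text \<open>Dividing by \<alpha> - 1 turns the second basis vector into 1, so the imaginary part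
  alone determines the first coordinate. This is the source of the formula in
  \<open>lattice_coord\<close>.\<close>

lemma lattice_point_div: "lattice_point x y / (\<alpha> - 1) = x * (\<alpha> + 1) + y"
proof -
  have "lattice_point x y = (x * (\<alpha> + 1) + y) * (\<alpha> - 1)"
    by (simp add: lattice_point_def algebra_simps power2_eq_square)
  then show ?thesis using alpha_ne_1 by simp
qed

lemma lattice_coord_point: "lattice_coord (lattice_point x y) 0 = x" "lattice_coord (lattice_point x y) (Suc 0) = y"
  using Im_alpha by (simp_all add: lattice_coord_def lattice_point_div algebra_simps)

lemma lattice_point_coord: "lattice_point (lattice_coord z 0) (lattice_coord z (Suc 0)) = z"
proof -
  have "lattice_point (lattice_coord z 0) (lattice_coord z (Suc 0)) / (\<alpha> - 1) = z / (\<alpha> - 1)"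
    unfolding lattice_point_div using Im_alpha
    by (intro complex_eqI) (simp_all add: lattice_coord_def algebra_simps)
  then show ?thesis using alpha_ne_1 by simp
qed

lemma lattice_coord_add: "lattice_coord (z + w) i = lattice_coord z i + lattice_coord w i"
  by (simp add: lattice_coord_def add_divide_distrib algebra_simps)

lemma lattice_point_add: "lattice_point (x + x') (y + y') = lattice_point x y + lattice_point x' y'"
  by (simp add: lattice_point_def algebra_simps)

lemma lattice_coord_real: "lattice_coord (of_real c * z) i = c * lattice_coord z i"
proof -
  have "of_real c * z / (\<alpha> - 1) = of_real c * (z / (\<alpha> - 1))" by simp
  then show ?thesis unfolding lattice_coord_def
    by (simp only: Re_complex_of_real Im_complex_of_real times_complex.sel) (simp add: algebra_simps)
qed

lemma lattice_coord_diff: "lattice_coord (z - w) i = lattice_coord z i - lattice_coord w i"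
  using lattice_coord_add[of "z - w" w i] by simp

lemma lattice_coord_bound: "\<exists>K>0. \<forall>z i. \<bar>lattice_coord z i\<bar> \<le> K * norm z"
proof -
  define c where "c = norm (\<alpha> - 1)"
  define K where "K = 1 / c / Im \<alpha> + 1 / c + 1 / c / Im \<alpha> * \<bar>1 + Re \<alpha>\<bar>"
  have c: "0 < c" using alpha_ne_1 by (simp add: c_def)
  have pos: "0 < 1 / c / Im \<alpha>" "0 < 1 / c" "0 \<le> 1 / c / Im \<alpha> * \<bar>1 + Re \<alpha>\<bar>" using c Im_alpha by simp_all
  then have K: "0 < K" unfolding K_def by linarith
  have "\<bar>lattice_coord z i\<bar> \<le> K * norm z" for z i
  proof -
    define w where "w = z / (\<alpha> - 1)"
    have w: "norm w = 1 / c * norm z" by (simp add: w_def c_def norm_divide)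
    have 1: "\<bar>Im w / Im \<alpha>\<bar> \<le> 1 / c / Im \<alpha> * norm z"
      using divide_right_mono[of "\<bar>Im w\<bar>" "1 / c * norm z" "Im \<alpha>"] abs_Im_le_cmod[of w] Im_alpha w
      by (simp add: abs_divide)
    have 2: "\<bar>Re w\<bar> \<le> 1 / c * norm z" using abs_Re_le_cmod[of w] w by simp
    have 3: "\<bar>Im w / Im \<alpha> * (1 + Re \<alpha>)\<bar> \<le> 1 / c / Im \<alpha> * norm z * \<bar>1 + Re \<alpha>\<bar>"
      unfolding abs_mult by (intro mult_right_mono 1) simp
    have 4: "0 \<le> 1 / c / Im \<alpha> * norm z" "0 \<le> 1 / c * norm z" "0 \<le> 1 / c / Im \<alpha> * norm z * \<bar>1 + Re \<alpha>\<bar>"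
      using c Im_alpha by simp_all
    have "\<bar>lattice_coord z i\<bar> \<le> 1 / c / Im \<alpha> * norm z + 1 / c * norm z + 1 / c / Im \<alpha> * norm z * \<bar>1 + Re \<alpha>\<bar>"
    proof (cases "i = 0")
      case True
      then have "lattice_coord z i = Im w / Im \<alpha>" by (simp add: lattice_coord_def w_def)
      then show ?thesis using 1 4 by linarith
    next
      case False
      then have "lattice_coord z i = Re w - Im w / Im \<alpha> * (1 + Re \<alpha>)" by (simp add: lattice_coord_def w_def)
      then show ?thesis using 2 3 4 by linarith
    qed
    also have "\<dots> = K * norm z" by (simp add: K_def algebra_simps)
    finally show ?thesis .
  qed
  with K show ?thesis by blast
qed

lemma continuous_lattice_coord: "continuous_on UNIV (\<lambda>z. lattice_coord z i)"
  unfolding lattice_coord_def using alpha_ne_1 Im_alpha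
  by (cases "i = 0") (auto intro!: continuous_intros)

definition coord_index :: "vec \<Rightarrow> nat \<Rightarrow> int" where
  "coord_index d i = (case d of (x, y, z) \<Rightarrow> if i = 0 then x else z)"

text \<open>Rewrite x * \<alpha>^2 + z * \<alpha> + y as (x + y + z) + x * (\<alpha>^2 - 1) + z *
  (\<alpha> - 1). The common displacement of all letters modulo the lattice is therefore 1, the
  projection of b.\<close>

lemma lattice_coord_proj:
  assumes "i < 2"
  shows "lattice_coord (proj d) i = of_int (total d) * lattice_coord 1 i + of_int (coord_index d i)"
proof -
  obtain x y z where d: "d = (x, y, z)" by (cases d)
  have "proj d = of_real (of_int (total d)) * 1 + lattice_point (of_int x) (of_int z)"
    by (simp add: d lattice_point_def algebra_simps)
  then have "lattice_coord (proj d) i = of_int (total d) * lattice_coord 1 i + lattice_coord (lattice_point (of_int x) (of_int z)) i"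
    by (simp only: lattice_coord_add lattice_coord_real)
  moreover have "i = 0 \<or> i = Suc 0" using assms by linarith
  ultimately show ?thesis by (auto simp: lattice_coord_point coord_index_def d)
qed

lemma total_unit [simp]: "total (unit l) = 1"
  by (cases l) auto

text \<open>From \<beta>^2 * \<alpha>^2 = - \<alpha> - \<beta> the number \<beta>^2 + \<beta> + 1
  becomes the lattice combination with coefficients - \<beta>^2 and - 1. The two coordinates are
  minus the normalized first and third entries of the right eigenvector (\<beta>^2, \<beta>, 1) of
  \<open>mat\<close>.\<close>

lemma lattice_coord_1:
  "lattice_coord 1 0 = - (\<beta>^2) / (\<beta>^2 + \<beta> + 1)" "lattice_coord 1 (Suc 0) = - 1 / (\<beta>^2 + \<beta> + 1)"
proof -
  define D where "D = \<beta>^2 + \<beta> + 1"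
  have D: "D > 0" unfolding D_def using beta beta_sq by linarith
  have "\<beta>^2 * (2 - \<beta>) = -1" using beta(3) by (simp add: algebra_simps power2_eq_square power3_eq_cube)
  then have b: "complex_of_real \<beta>^2 * (2 - of_real \<beta>) = -1"
    by (metis of_real_1 of_real_diff of_real_minus of_real_mult of_real_numeral of_real_power)
  have b2: "complex_of_real \<beta>^2 * (1 / of_real \<beta>) = \<beta>"
    using beta(1) by (simp add: power2_eq_square)
  have "complex_of_real \<beta>^2 * \<alpha>^2 = (complex_of_real \<beta>^2 * (2 - of_real \<beta>)) * \<alpha> - complex_of_real \<beta>^2 * (1 / of_real \<beta>)"
    unfolding alpha_quadratic by (simp add: algebra_simps)
  then have eq: "complex_of_real \<beta>^2 * \<alpha>^2 = - \<alpha> - \<beta>" unfolding b b2 by simp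
  have "lattice_point (- (\<beta>^2)) (- 1) = of_real D * 1"
    using eq by (simp add: lattice_point_def D_def algebra_simps)
  then have "D * lattice_coord 1 0 = - (\<beta>^2)" "D * lattice_coord 1 (Suc 0) = - 1"
    by (metis lattice_coord_point lattice_coord_real)+
  then show "lattice_coord 1 0 = - (\<beta>^2) / (\<beta>^2 + \<beta> + 1)" "lattice_coord 1 (Suc 0) = - 1 / (\<beta>^2 + \<beta> + 1)"
    using D unfolding D_def by (simp_all add: field_simps)
qed

text \<open>Clearing the denominator turns the relation into the vanishing of the height of an
  integer vector, so \<open>height_eq_zero\<close> applies.\<close>

lemma lattice_coord_independent:
  assumes "of_int k * lattice_coord 1 0 + of_int l * lattice_coord 1 (Suc 0) + of_int m = 0"
  shows "k = 0 \<and> l = 0 \<and> m = (0::int)"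
proof -
  define D where "D = \<beta>^2 + \<beta> + 1"
  have D: "D > 0" unfolding D_def using beta beta_sq by linarith
  have "(of_int k * lattice_coord 1 0 + of_int l * lattice_coord 1 (Suc 0) + of_int m) * D = 0"
    using assms by simp
  then have "- of_int k * \<beta>^2 - of_int l + of_int m * D = 0"
    unfolding lattice_coord_1 D_def[symmetric] using D by (simp add: distrib_right left_diff_distrib)
  then have "height (m - k, m - l, m) = 0" by (simp add: D_def algebra_simps)
  then have "(m - k, m - l, m) = 0" by (rule height_eq_zero)
  then show ?thesis by (simp add: zero_prod_def)
qed

lemma dense_translation_lattice: "dense_translation 2 (lattice_coord 1)"
  unfolding dense_translation_def
proof (intro allI impI)
  fix t :: "nat \<Rightarrow> real" and \<epsilon> :: real assume "0 < \<epsilon>"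
  \<comment> \<open>Kronecker's theorem takes 1 as an additional member of the independent family,
    here at index 2.\<close>
  define \<theta> where "\<theta> = (\<lambda>i::nat. if i = 2 then 1 else lattice_coord 1 i)"
  have set: "{..2::nat} = {0, Suc 0, 2}" by auto
  have dist: "lattice_coord 1 0 \<noteq> lattice_coord 1 (Suc 0)" "lattice_coord 1 0 \<noteq> 1" "lattice_coord 1 (Suc 0) \<noteq> 1"
    using lattice_coord_independent[of 1 "-1" 0] lattice_coord_independent[of 1 0 "-1"]
      lattice_coord_independent[of 0 1 "-1"] by auto
  interpret Modules.module "(\<lambda>r. (*) (real_of_int r))"
    by (simp add: Modules.module.intro distrib_left mult.commute)
  have im: "\<theta> ` {..2} = {lattice_coord 1 0, lattice_coord 1 (Suc 0), 1}" by (simp add: set \<theta>_def)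
  have ind: "independent (\<theta> ` {..2})"
  proof
    assume "dependent (\<theta> ` {..2})"
    then obtain f where f: "\<exists>v\<in>\<theta> ` {..2}. f v \<noteq> 0" "(\<Sum>v\<in>\<theta> ` {..2}. of_int (f v) * v) = 0"
      by (subst (asm) dependent_finite) auto
    have "of_int (f (lattice_coord 1 0)) * lattice_coord 1 0 + of_int (f (lattice_coord 1 (Suc 0))) * lattice_coord 1 (Suc 0) + of_int (f 1) = 0"
      using f(2) dist unfolding im by simp
    from lattice_coord_independent[OF this] f(1) show False unfolding im by blast
  qed
  have inj: "inj_on \<theta> {..2}" unfolding set using dist by (simp add: \<theta>_def)
  obtain k m where km: "\<And>i. i < 2 \<Longrightarrow> \<bar>of_int k * \<theta> i - of_int (m i) - t i\<bar> < \<epsilon>"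
    using Kronecker_thm_2[OF ind inj _ \<open>0 < \<epsilon>\<close>, of t] by (auto simp: \<theta>_def)
  have "\<bar>of_int k * lattice_coord 1 i - of_int (m i) - t i\<bar> < \<epsilon>" if "i < 2" for i
    using km[OF that] that by (simp add: \<theta>_def)
  then show "\<exists>k m. \<forall>i<2. \<bar>of_int k * lattice_coord 1 i - of_int (m i) - t i\<bar> < \<epsilon>" by blast
qed

text \<open>The walk has only nonnegative times. A nonzero multiple \<open>j\<close> that nearly
  returns to 0 is used, up to sign, \<open>\<bar>k\<bar>\<close> times to make the multiplier
  nonnegative at a cost of at most \<epsilon> / 2.\<close>

lemma dense_translation_forward:
  assumes dense: "dense_translation d a" and \<epsilon>: "0 < \<epsilon>" and d: "0 < d"
  shows "\<exists>n::nat. \<exists>m::nat \<Rightarrow> int. \<forall>i<d. \<bar>of_nat n * a i - of_int (m i) - t i\<bar> < \<epsilon>"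
proof -
  obtain k m where km: "\<forall>i<d. \<bar>of_int k * a i - of_int (m i) - t i\<bar> < \<epsilon> / 2"
    using dense[unfolded dense_translation_def, rule_format, of "\<epsilon> / 2" t] \<epsilon> by auto
  define \<delta> where "\<delta> = min (1 / 4) (\<epsilon> / (4 * (\<bar>of_int k\<bar> + 1)))"
  have "0 < \<epsilon> / (4 * (\<bar>of_int k\<bar> + 1))" using \<epsilon> by (intro divide_pos_pos) auto
  then have \<delta>: "0 < \<delta>" "\<delta> \<le> 1 / 4" unfolding \<delta>_def by linarith+
  have "\<delta> \<le> \<epsilon> / (4 * (\<bar>of_int k\<bar> + 1))" by (simp add: \<delta>_def)
  then have k\<delta>: "(\<bar>of_int k\<bar> + 1) * \<delta> * 4 \<le> \<epsilon>" by (simp add: field_simps)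
  \<comment> \<open>Aiming at \<delta> instead of 0 excludes j = 0: an integer would have to lie
    within \<delta> / 2 of - \<delta>, which \<delta> \<le> 1 / 4 forbids.\<close>
  obtain j l where jl: "\<forall>i<d. \<bar>of_int j * a i - of_int (l i) - \<delta>\<bar> < \<delta> / 2"
    using dense[unfolded dense_translation_def, rule_format, of "\<delta> / 2" "\<lambda>_. \<delta>"] \<delta> by auto
  have "j \<noteq> 0"
  proof
    assume "j = 0"
    then have "\<bar>- of_int (l 0) - \<delta>\<bar> < \<delta> / 2" using jl d by auto
    then have "of_int (l 0) < (0::real)" "of_int (l 0) > (-1::real)" using \<delta> by linarith+
    then have "l 0 < 0" "-1 < l 0" by linarith+
    then show False by simp
  qed
  define n where "n = nat (k + \<bar>k\<bar> * \<bar>j\<bar>)"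
  have "\<bar>k\<bar> * 1 \<le> \<bar>k\<bar> * \<bar>j\<bar>" using \<open>j \<noteq> 0\<close> by (intro mult_left_mono) auto
  then have "0 \<le> k + \<bar>k\<bar> * \<bar>j\<bar>" by linarith
  then have n: "real n = of_int k + \<bar>of_int k\<bar> * \<bar>of_int j\<bar>"
    by (simp add: n_def)
  have "\<bar>real n * a i - of_int (m i + \<bar>k\<bar> * sgn j * l i) - t i\<bar> < \<epsilon>" if i: "i < d" for i
  proof -
    have sj: "\<bar>of_int j\<bar> = (of_int (sgn j) * of_int j :: real)" by (metis abs_sgn mult.commute of_int_abs of_int_mult)
    have "\<bar>of_int j * a i - of_int (l i)\<bar> \<le> 2 * \<delta>"
      using jl[rule_format, OF i] \<delta>(1) by linarith
    moreover have "\<bar>of_int (sgn j) :: real\<bar> \<le> 1" by (simp add: sgn_if)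
    ultimately have "\<bar>of_int (sgn j) * (of_int j * a i - of_int (l i))\<bar> \<le> 1 * (2 * \<delta>)"
      unfolding abs_mult by (intro mult_mono) auto
    then have "\<bar>\<bar>of_int k\<bar> * (of_int (sgn j) * (of_int j * a i - of_int (l i)))\<bar> \<le> \<bar>of_int k\<bar> * (2 * \<delta>)"
      unfolding abs_mult abs_abs by (intro mult_left_mono) auto
    also have "\<dots> \<le> \<epsilon> / 2" using k\<delta> \<delta>(1) by (simp add: algebra_simps)
    finally have "\<bar>\<bar>of_int k\<bar> * (of_int (sgn j) * (of_int j * a i - of_int (l i)))\<bar> \<le> \<epsilon> / 2" .
    moreover have "real n * a i - of_int (m i + \<bar>k\<bar> * sgn j * l i) - t i =
      (of_int k * a i - of_int (m i) - t i) + \<bar>of_int k\<bar> * (of_int (sgn j) * (of_int j * a i - of_int (l i)))"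
      unfolding n sj by (simp add: algebra_simps)
    ultimately show ?thesis using km[rule_format, OF i] by linarith
  qed
  then show ?thesis
    by (intro exI[of _ n] exI[of _ "\<lambda>i. m i + \<bar>k\<bar> * sgn j * l i"] allI impI)
qed

section \<open>From the complex plane to the torus\<close>

definition to_torus :: "complex \<Rightarrow> nat \<Rightarrow> real" where
  "to_torus z = (\<lambda>i\<in>{..<2}. frac (lattice_coord z i))"

abbreviation rotation :: "(nat \<Rightarrow> real) \<Rightarrow> nat \<Rightarrow> real" where
  "rotation \<equiv> torus_translation 2 (lattice_coord 1)"

lemma to_torus_space: "to_torus z \<in> space (torus 2)"
  by (simp add: to_torus_def space_torus frac_lt_1)

lemma to_torus_proj: "to_torus (z + proj (unit l)) = rotation (to_torus z)"
proof
  fix i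
  show "to_torus (z + proj (unit l)) i = rotation (to_torus z) i"
  proof (cases "i < 2")
    case True
    have "lattice_coord (z + proj (unit l)) i = (frac (lattice_coord z i) + lattice_coord 1 i) + of_int (coord_index (unit l) i + \<lfloor>lattice_coord z i\<rfloor>)"
      using True by (simp add: lattice_coord_add lattice_coord_proj frac_def)
    then have "frac (lattice_coord (z + proj (unit l)) i) = frac (frac (lattice_coord z i) + lattice_coord 1 i)"
      by (rule frac_mod_eq)
    then show ?thesis using True by (simp add: to_torus_def torus_translation_def)
  qed (simp add: to_torus_def torus_translation_def)
qed

lemma to_torus_walk: "to_torus (z + walk x n) = (rotation ^^ n) (to_torus z)"
proof (induction n)
  case (Suc n)
  have "to_torus (z + walk x (Suc n)) = to_torus ((z + walk x n) + proj (unit (x n)))"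
    by (simp add: walk_Suc add.assoc)
  then show ?case by (simp add: to_torus_proj Suc)
qed simp

text \<open>A lattice vector is lifted to the integer vector whose entries sum to 0. This
  normalization later rules out coincidences between tiles of different index.\<close>

lemma to_torus_eq:
  assumes "to_torus z = to_torus w"
  shows "\<exists>d. total d = 0 \<and> w = z + proj d"
proof -
  have ex: "\<exists>m::int. lattice_coord w i = lattice_coord z i + of_int m" if "i < 2" for i
  proof -
    have "frac (lattice_coord z i) = frac (lattice_coord w i)"
      using fun_cong[OF assms, of i] that by (simp add: to_torus_def)
    then have "lattice_coord w i = lattice_coord z i + of_int (\<lfloor>lattice_coord w i\<rfloor> - \<lfloor>lattice_coord z i\<rfloor>)"
      by (simp add: frac_def)
    then show ?thesis ..
  qed
  obtain m m' :: int where m: "lattice_coord w 0 = lattice_coord z 0 + of_int m"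
    "lattice_coord w (Suc 0) = lattice_coord z (Suc 0) + of_int m'"
    using ex[of 0] ex[of "Suc 0"] by auto
  have "w = lattice_point (lattice_coord w 0) (lattice_coord w (Suc 0))" by (simp only: lattice_point_coord)
  also have "\<dots> = z + lattice_point (of_int m) (of_int m')"
    unfolding m lattice_point_add lattice_point_coord ..
  also have "lattice_point (of_int m) (of_int m') = proj (m, - m - m', m')"
    by (simp add: lattice_point_def algebra_simps)
  finally show ?thesis by (intro exI[of _ "(m, - m - m', m')"]) simp
qed

lemma measure_arc_box_le:
  assumes "0 \<le> b"
  shows "emeasure (torus d) (arc_box d t (\<lambda>_. b)) \<le> ennreal (b ^ d)"
proof -
  have fm: "{x \<in> {0..<1}. frac (x - t i) < b} \<in> sets borel" for i
    by (simp add: frac_def)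
  have le: "emeasure lborel {x \<in> {0..<1}. frac (x - t i) < b} \<le> ennreal b" for i
  proof -
    have "emeasure lborel {x \<in> {0..<1}. frac (x - t i) < b} \<le> emeasure lborel {x \<in> {0..<1}. frac (x + (- t i)) < min b 1}"
    proof (rule emeasure_mono)
      show "{x \<in> {0..<1}. frac (x - t i) < b} \<subseteq> {x \<in> {0..<1}. frac (x + (- t i)) < min b 1}"
        by (simp add: subset_eq frac_lt_1)
    qed (simp add: frac_def)
    also have "\<dots> = ennreal (min b 1)" using assms by (intro lborel_frac_translate) auto
    also have "\<dots> \<le> ennreal b" by (rule ennreal_leI) simp
    finally show ?thesis .
  qed
  have prod_le: "(\<Prod>i<n. emeasure lborel {x \<in> {0..<1}. frac (x - t i) < b}) \<le> (\<Prod>i<n. ennreal b)" for n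
  proof (induction n)
    case (Suc n)
    show ?case unfolding prod.lessThan_Suc by (intro mult_mono Suc le) simp_all
  qed simp
  have "arc_box d t (\<lambda>_. b) = Pi\<^sub>E {..<d} (\<lambda>i. {x \<in> {0..<1}. frac (x - t i) < b})"
    unfolding arc_box_def space_torus set_eq_iff mem_Collect_eq PiE_iff by blast
  then have "emeasure (torus d) (arc_box d t (\<lambda>_. b)) = (\<Prod>i<d. emeasure lborel {x \<in> {0..<1}. frac (x - t i) < b})"
    using fm by (simp only:) (intro emeasure_torus_box, auto)
  also have "\<dots> \<le> (\<Prod>i<d. ennreal b)" by (rule prod_le)
  also have "\<dots> = ennreal (b ^ d)" using assms by (simp add: ennreal_power)
  finally show ?thesis .
qed

text \<open>The discs of \<open>bad_cover_small\<close> are mapped into boxes of arcs. Intersecting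
  such covers of measure at most 1 / (n + 1) yields a measurable null set around the image.\<close>

lemma bad_null:
  assumes s: "directive s"
  shows "\<exists>N \<in> null_sets (torus 2). to_torus ` bad s \<subseteq> N"
proof -
  obtain K where K: "0 < K" "\<And>z i. \<bar>lattice_coord z i\<bar> \<le> K * norm z" using lattice_coord_bound by blast
  have ex: "\<exists>A \<in> sets (torus 2). to_torus ` bad s \<subseteq> A \<and> emeasure (torus 2) A \<le> ennreal (1 / real (Suc n))" for n
  proof -
    define \<epsilon> where "\<epsilon> = 1 / real (Suc n) / (3 * K)\<^sup>2"
    have \<epsilon>: "0 < \<epsilon>" using K(1) by (simp add: \<epsilon>_def)
    obtain C r where C: "finite C" "0 < r" "real (card C) * r\<^sup>2 \<le> \<epsilon>" "bad s \<subseteq> (\<Union>e\<in>C. cball e r)"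
      using bad_cover_small[OF s \<epsilon>] by (elim exE conjE)
    \<comment> \<open>On the disc around \<open>e\<close> each coordinate varies by at most K * r on
      either side; the length 3 * K * r leaves room for the strict inequality in
      \<open>arc_box\<close>.\<close>
    define box where "box = (\<lambda>e. arc_box 2 (\<lambda>i. lattice_coord e i - K * r) (\<lambda>_. 3 * K * r))"
    define A where "A = (\<Union>e\<in>C. box e)"
    have "A \<in> sets (torus 2)" using C(1) sets_arc_box by (auto simp: A_def box_def)
    moreover have "to_torus ` bad s \<subseteq> A"
    proof
      fix y assume "y \<in> to_torus ` bad s"
      then obtain z where z: "y = to_torus z" "z \<in> bad s" by blast
      then obtain e where e: "e \<in> C" "dist e z \<le> r" using C(4) by auto
      have "frac (y i - (lattice_coord e i - K * r)) < 3 * K * r" if i: "i < 2" for i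
      proof -
        define v where "v = lattice_coord z i - (lattice_coord e i - K * r)"
        have "\<bar>lattice_coord (z - e) i\<bar> \<le> K * norm (z - e)" by (rule K(2))
        also have "\<dots> \<le> K * r" using e(2) K(1) by (simp add: dist_norm norm_minus_commute)
        finally have "\<bar>lattice_coord z i - lattice_coord e i\<bar> \<le> K * r" by (simp add: lattice_coord_diff)
        then have v: "0 \<le> v" "v \<le> 2 * (K * r)" unfolding v_def by linarith+
        have "y i - (lattice_coord e i - K * r) = v + of_int (- \<lfloor>lattice_coord z i\<rfloor>)"
          using i by (simp add: z(1) to_torus_def frac_def v_def)
        then have "frac (y i - (lattice_coord e i - K * r)) = frac v" by (rule frac_mod_eq)
        also have "frac v \<le> v" using v(1) by (simp add: frac_def)
        also have "v < 3 * K * r" using v(2) mult_pos_pos[OF K(1) C(2)] by linarith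
        finally show ?thesis .
      qed
      then have "y \<in> box e" using z(1) to_torus_space by (simp add: box_def arc_box_def)
      then show "y \<in> A" using e(1) by (auto simp: A_def)
    qed
    moreover have "emeasure (torus 2) A \<le> ennreal (1 / real (Suc n))"
    proof -
      have "emeasure (torus 2) A \<le> (\<Sum>e\<in>C. emeasure (torus 2) (box e))"
        unfolding A_def by (rule emeasure_subadditive_finite[OF C(1)]) (auto simp: box_def sets_arc_box)
      also have "\<dots> \<le> (\<Sum>e\<in>C. ennreal ((3 * K * r)\<^sup>2))"
        unfolding box_def using K(1) C(2) by (intro sum_mono measure_arc_box_le) simp
      also have "\<dots> = ennreal (real (card C) * (3 * K * r)\<^sup>2)"
        by (simp add: ennreal_mult' ennreal_of_nat_eq_real_of_nat)
      also have "\<dots> \<le> ennreal (1 / real (Suc n))"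
      proof (rule ennreal_leI)
        have "real (card C) * (3 * K * r)\<^sup>2 = (real (card C) * r\<^sup>2) * (3 * K)\<^sup>2" by (simp add: power_mult_distrib)
        also have "\<dots> \<le> \<epsilon> * (3 * K)\<^sup>2" using C(3) by (intro mult_right_mono) auto
        also have "\<dots> = 1 / real (Suc n)" using K(1) by (simp add: \<epsilon>_def)
        finally show "real (card C) * (3 * K * r)\<^sup>2 \<le> 1 / real (Suc n)" .
      qed
      finally show ?thesis .
    qed
    ultimately show ?thesis by blast
  qed
  define A where "A = (\<lambda>n. SOME A. A \<in> sets (torus 2) \<and> to_torus ` bad s \<subseteq> A \<and> emeasure (torus 2) A \<le> ennreal (1 / real (Suc n)))"
  have "A n \<in> sets (torus 2) \<and> to_torus ` bad s \<subseteq> A n \<and> emeasure (torus 2) (A n) \<le> ennreal (1 / real (Suc n))" for n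
    unfolding A_def by (rule someI_ex, rule ex[unfolded Bex_def])
  then have A: "\<And>n. A n \<in> sets (torus 2)" "\<And>n. to_torus ` bad s \<subseteq> A n"
    "\<And>n. emeasure (torus 2) (A n) \<le> ennreal (1 / real (Suc n))" by simp_all
  define N where "N = (\<Inter>n. A n)"
  have Ns: "N \<in> sets (torus 2)" unfolding N_def by (intro sets.countable_INT) (use A(1) in auto)
  have le: "emeasure (torus 2) N \<le> ennreal (1 / real (Suc n))" for n
    by (rule order_trans[OF emeasure_mono A(3)]) (auto simp: N_def A(1))
  have "emeasure (torus 2) N \<le> 0"
  proof (rule ennreal_le_epsilon)
    fix e :: real assume e: "0 < e"
    obtain n where n: "1 / real (Suc n) < e" by (rule nat_approx_posE[OF e])
    have "emeasure (torus 2) N \<le> ennreal e"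
      by (rule order_trans[OF le[of n] ennreal_leI]) (use n in linarith)
    then show "emeasure (torus 2) N \<le> 0 + ennreal e" by simp
  qed
  then have "N \<in> null_sets (torus 2)" using Ns by (intro null_setsI) simp_all
  moreover have "to_torus ` bad s \<subseteq> N" unfolding N_def using A(2) by blast
  ultimately show ?thesis by blast
qed

text \<open>Let the \<open>n\<close>-th tile of \<open>x\<close> be the one in which
  \<open>y\<close> begins. If these two tiles coincide, then d is the abelianized prefix of length
  \<open>n\<close>; its entries sum to 0, so n = 0 and d = 0. Both words then start at the same
  point, and their first differing letters give the required overlap.\<close>

lemma distinct_meeting_aux:
  assumes h: "(x, z) \<in> ext_hull s" "(y, z + proj d) \<in> ext_hull s" and tot: "total d = 0" and ne: "x \<noteq> y"
    and pos: "0 \<le> height d"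
  shows "\<exists>n. z + walk x n \<in> bad s"
proof -
  define H where "H = (\<lambda>n. height (abel (pre x n)))"
  have H_Suc: "H (Suc n) = H n + width (x n)" for n by (simp add: H_def pre_Suc height_add)
  have ex: "\<exists>n. height d < H (Suc n)"
  proof -
    obtain n where "height d < real n" using reals_Archimedean2 by blast
    also have "real n \<le> H (Suc n)" using height_abel_ge[of "pre x (Suc n)"] by (simp add: H_def)
    finally show ?thesis ..
  qed
  define n where "n = (LEAST n. height d < H (Suc n))"
  have n: "height d < H (Suc n)" unfolding n_def by (rule LeastI_ex[OF ex])
  have n': "H n \<le> height d"
  proof (cases n)
    case 0
    then show ?thesis using pos by (simp add: H_def pre_def)
  next
    case (Suc k)
    then have "\<not> height d < H (Suc k)" using not_less_Least[of k "\<lambda>n. height d < H (Suc n)"] by (simp add: n_def)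
    then show ?thesis using Suc by simp
  qed
  define d' where "d' = d - abel (pre x n)"
  have hd': "0 \<le> height d'" "height d' < width (x n)"
    using n n' H_Suc[of n] by (simp_all add: d'_def height_diff H_def)
  have pos_overlap: "0 < overlap (Ov d' (x n) (y 0))"
    using hd' width_pos[of "y 0"] by (simp add: seg_def)
  have pd: "z + walk x n + proj d' = z + proj d" by (simp add: d'_def proj_diff walk_def)
  have x0: "((left_shift ^^ m) v) 0 = v m" for m v by (simp add: shift_funpow)
  show ?thesis
  proof (cases "coincident (Ov d' (x n) (y 0))")
    case False
    then have "meeting s d' (z + walk x n) ((left_shift ^^ n) x) y"
      unfolding meeting_def x0 pd using hull_shift[OF h(1), of n] h(2) pos_overlap by (intro conjI)
    then show ?thesis unfolding bad_def by blast
  next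
    case True
    then have d'0: "d' = 0" by simp
    then have "total d' = 0" by (simp add: zero_prod_def)
    then have "n = 0" using tot by (simp add: d'_def total_diff)
    then have "d = 0" using d'0 by (simp add: d'_def pre_def)
    define m where "m = (LEAST m. x m \<noteq> y m)"
    have m: "x m \<noteq> y m" unfolding m_def by (rule LeastI_ex) (use ne in \<open>simp add: fun_eq_iff\<close>)
    have "x i = y i" if "i < m" for i using not_less_Least[of i "\<lambda>m. x m \<noteq> y m"] that by (simp add: m_def)
    then have "pre x m = pre y m" by (rule pre_cong)
    then have w: "walk x m = walk y m" by (simp add: walk_def)
    have "meeting s 0 (z + walk x m) ((left_shift ^^ m) x) ((left_shift ^^ m) y)"
      unfolding meeting_def x0
    proof (intro conjI)
      show "((left_shift ^^ m) x, z + walk x m) \<in> ext_hull s" by (rule hull_shift[OF h(1)])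
      show "((left_shift ^^ m) y, z + walk x m + proj 0) \<in> ext_hull s"
        using hull_shift[OF h(2), of m] \<open>d = 0\<close> w by simp
      show "0 < overlap (Ov 0 (x m) (y m))" using width_pos by (simp add: seg_def)
      show "\<not> coincident (Ov 0 (x m) (y m))" using m by simp
    qed
    then show ?thesis unfolding bad_def by blast
  qed
qed

lemma distinct_meeting:
  assumes h: "(x, z) \<in> ext_hull s" "(y, w) \<in> ext_hull s" and eq: "to_torus z = to_torus w" and ne: "x \<noteq> y"
  shows "\<exists>n. (rotation ^^ n) (to_torus z) \<in> to_torus ` bad s"
proof -
  obtain d where d: "total d = 0" "w = z + proj d" using to_torus_eq[OF eq] by blast
  have "\<exists>n. z + walk x n \<in> bad s \<or> w + walk y n \<in> bad s"
  proof (cases "0 \<le> height d")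
    case True
    then show ?thesis using distinct_meeting_aux[OF h(1) _ d(1) ne] h(2) d(2) by blast
  next
    case False
    have "total (- d) = 0" using d(1) by (cases d) simp
    moreover have "z = w + proj (- d)" by (simp add: d(2) proj_minus)
    moreover have "0 \<le> height (- d)" using False by (simp add: height_minus)
    ultimately show ?thesis using distinct_meeting_aux[OF h(2), of x "- d"] h(1) ne by metis
  qed
  then obtain n where "z + walk x n \<in> bad s \<or> w + walk y n \<in> bad s" ..
  then show ?thesis
    using to_torus_walk[of z x n] to_torus_walk[of w y n] eq by (metis imageI)
qed

lemma fst_hull:
  assumes "directive s"
  shows "fst ` ext_hull s = orbit_closure (limit_word s)"
proof
  have "closed ((fst :: (nat \<Rightarrow> letter) \<times> complex \<Rightarrow> _) -` orbit_closure (limit_word s))"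
    by (intro closed_vimage continuous_on_fst continuous_on_id) (simp add: orbit_closure_def)
  then have "ext_hull s \<subseteq> fst -` orbit_closure (limit_word s)"
  proof (rule hull_subset_closed)
    fix n
    have "(left_shift ^^ n) (limit_word s) \<in> orbit_closure (limit_word s)"
      unfolding orbit_closure_def by (rule subsetD[OF closure_subset rangeI])
    then show "((left_shift ^^ n) (limit_word s), walk (limit_word s) n) \<in> fst -` orbit_closure (limit_word s)"
      by simp
  qed
  then show "fst ` ext_hull s \<subseteq> orbit_closure (limit_word s)" by blast
  have "compact (fst ` ext_hull s)"
    by (intro compact_continuous_image compact_hull assms continuous_on_fst continuous_on_id)
  then have "closed (fst ` ext_hull s)" by (rule compact_imp_closed)
  moreover have "range (\<lambda>n. (left_shift ^^ n) (limit_word s)) \<subseteq> fst ` ext_hull s"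
  proof
    fix x assume "x \<in> range (\<lambda>n. (left_shift ^^ n) (limit_word s))"
    then obtain n where "x = (left_shift ^^ n) (limit_word s)" by blast
    then show "x \<in> fst ` ext_hull s" using hull_orbit[of n s] by (intro image_eqI[OF _ hull_orbit]) simp
  qed
  ultimately show "orbit_closure (limit_word s) \<subseteq> fst ` ext_hull s"
    unfolding orbit_closure_def by (intro closure_minimal)
qed

section \<open>The factor map on the subshift\<close>

definition coding :: "(nat \<Rightarrow> substitution) \<Rightarrow> (nat \<Rightarrow> letter) \<Rightarrow> complex" where
  "coding s x = (THE z. (x, z) \<in> ext_hull s)"

lemma coding_eq: "directive s \<Longrightarrow> (x, z) \<in> ext_hull s \<Longrightarrow> coding s x = z"
  unfolding coding_def using hull_unique by (intro the_equality) auto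

lemma coding_hull:
  assumes "directive s" "x \<in> orbit_closure (limit_word s)"
  shows "(x, coding s x) \<in> ext_hull s"
proof -
  obtain z where "(x, z) \<in> ext_hull s" using assms(2) fst_hull[OF assms(1)] by force
  then show ?thesis using coding_eq[OF assms(1)] by simp
qed

lemma coding_image:
  assumes s: "directive s"
  shows "coding s ` (orbit_closure (limit_word s) \<inter> C) = snd ` (ext_hull s \<inter> C \<times> UNIV)"
proof
  show "coding s ` (orbit_closure (limit_word s) \<inter> C) \<subseteq> snd ` (ext_hull s \<inter> C \<times> UNIV)"
  proof clarify
    fix x assume "x \<in> orbit_closure (limit_word s)" "x \<in> C"
    then show "coding s x \<in> snd ` (ext_hull s \<inter> C \<times> UNIV)"
      using coding_hull[OF s] by (intro image_eqI[of _ _ "(x, coding s x)"]) auto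
  qed
  show "snd ` (ext_hull s \<inter> C \<times> UNIV) \<subseteq> coding s ` (orbit_closure (limit_word s) \<inter> C)"
  proof clarify
    fix x z assume xz: "(x, z) \<in> ext_hull s" "x \<in> C"
    then have "x \<in> orbit_closure (limit_word s)" using fst_hull[OF s] by force
    then show "snd (x, z) \<in> coding s ` (orbit_closure (limit_word s) \<inter> C)"
      using coding_eq[OF s xz(1)] xz(2) by (intro image_eqI[of _ _ x]) simp_all
  qed
qed

text \<open>The hull is a compact graph, so the preimage of a closed set is the projection of a
  compact set, hence closed.\<close>

lemma measurable_coding:
  assumes s: "directive s"
  shows "coding s \<in> borel_measurable (restrict_space borel (orbit_closure (limit_word s)))"
proof (rule borel_measurableI)
  let ?X = "orbit_closure (limit_word s)"
  fix S :: "complex set" assume "open S"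
  define F where "F = fst ` (ext_hull s \<inter> UNIV \<times> (- S))"
  have "compact (ext_hull s \<inter> UNIV \<times> (- S))"
    using \<open>open S\<close> by (intro compact_Int_closed compact_hull s closed_Times) auto
  then have "compact F" unfolding F_def by (intro compact_continuous_image continuous_on_fst continuous_on_id)
  then have F: "F \<in> sets borel" by (intro borel_closed compact_imp_closed)
  have "x \<in> F \<longleftrightarrow> coding s x \<notin> S" if "x \<in> ?X" for x
  proof
    assume "x \<in> F"
    then obtain z where "(x, z) \<in> ext_hull s" "z \<notin> S" by (auto simp: F_def)
    then show "coding s x \<notin> S" using coding_eq[OF s] by simp
  next
    assume "coding s x \<notin> S"
    then show "x \<in> F" unfolding F_def using coding_hull[OF s that] by (intro image_eqI[of _ _ "(x, coding s x)"]) auto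
  qed
  then have "coding s -` S \<inter> space (restrict_space borel ?X) = ?X \<inter> - F"
    by (auto simp: space_restrict_space)
  also have "\<dots> \<in> sets (restrict_space borel ?X)"
    using F by (auto simp: sets_restrict_space)
  finally show "coding s -` S \<inter> space (restrict_space borel ?X) \<in> sets (restrict_space borel ?X)" .
qed

lemma coding_shift:
  assumes s: "directive s" and x: "x \<in> orbit_closure (limit_word s)"
  shows "left_shift x \<in> orbit_closure (limit_word s)" "coding s (left_shift x) = coding s x + proj (unit (x 0))"
proof -
  have *: "(left_shift x, coding s x + proj (unit (x 0))) \<in> ext_hull s"
    by (rule hull_left_shift[OF coding_hull[OF s x]])
  then show "left_shift x \<in> orbit_closure (limit_word s)" using fst_hull[OF s] by force
  show "coding s (left_shift x) = coding s x + proj (unit (x 0))" by (rule coding_eq[OF s *])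
qed

text \<open>Modulo the lattice the walk at time \<open>n\<close> is \<open>n\<close> times the
  translation vector, so forward density gives orbit points of the hull whose images approach y.
  Compactness of the hull provides a limit.\<close>

lemma to_torus_limit:
  assumes s: "directive s" and y: "y \<in> space (torus 2)"
  shows "\<exists>x z. (x, z) \<in> ext_hull s \<and> to_torus z = y"
proof -
  define u where "u = limit_word s"
  have "\<exists>n::nat. \<exists>m::nat \<Rightarrow> int. \<forall>i<2. \<bar>of_nat n * lattice_coord 1 i - of_int (m i) - y i\<bar> < 1 / real (Suc k)" for k
    by (rule dense_translation_forward[OF dense_translation_lattice]) auto
  then obtain n :: "nat \<Rightarrow> nat" and m :: "nat \<Rightarrow> nat \<Rightarrow> int" where
    nm: "\<And>k i. i < 2 \<Longrightarrow> \<bar>of_nat (n k) * lattice_coord 1 i - of_int (m k i) - y i\<bar> < 1 / real (Suc k)"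
    by metis
  define p where "p = (\<lambda>k. ((left_shift ^^ n k) u, walk u (n k)))"
  have "\<forall>k. p k \<in> ext_hull s" unfolding p_def u_def using hull_orbit by blast
  moreover have "seq_compact (ext_hull s)" by (rule compact_imp_seq_compact[OF compact_hull[OF s]])
  ultimately obtain l r where l: "l \<in> ext_hull s" "strict_mono r" "(p \<circ> r) \<longlonglongrightarrow> l"
    unfolding seq_compact_def by metis
  define z where "z = snd l"
  have z_lim: "(\<lambda>k. walk u (n (r k))) \<longlonglongrightarrow> z"
    using tendsto_snd[OF l(3)] by (simp add: z_def p_def)
  have "frac (lattice_coord z i) = y i" if i: "i < 2" for i
  proof -
    define M where "M = (\<lambda>k. m (r k) i + coord_index (abel (pre u (n (r k)))) i)"
    have 1: "(\<lambda>k. lattice_coord (walk u (n (r k))) i) \<longlonglongrightarrow> lattice_coord z i"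
      using continuous_on_tendsto_compose[OF continuous_lattice_coord z_lim] by simp
    have "lattice_coord (walk u (n k)) i = of_nat (n k) * lattice_coord 1 i + of_int (coord_index (abel (pre u (n k))) i)" for k
      using lattice_coord_proj[OF i, of "abel (pre u (n k))"] by (simp add: walk_def)
    then have "lattice_coord (walk u (n (r k))) i - of_int (M k) - y i = of_nat (n (r k)) * lattice_coord 1 i - of_int (m (r k) i) - y i" for k
      by (simp add: M_def)
    then have bnd: "\<bar>lattice_coord (walk u (n (r k))) i - of_int (M k) - y i\<bar> \<le> 1 / real (Suc k)" for k
    proof -
      have "k \<le> r k" by (rule seq_suble[OF l(2)])
      then have "1 / real (Suc (r k)) \<le> 1 / real (Suc k)" by (intro frac_le) auto
      then show ?thesis using nm[OF i, of "r k"] \<open>lattice_coord (walk u (n (r k))) i - of_int (M k) - y i = _\<close> by linarith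
    qed
    have 2: "(\<lambda>k. lattice_coord (walk u (n (r k))) i - of_int (M k) - y i) \<longlonglongrightarrow> 0"
      by (rule Lim_null_comparison[OF _ LIMSEQ_Suc[OF lim_1_over_n]]) (use bnd in \<open>simp add: always_eventually\<close>)
    have "(\<lambda>k. lattice_coord (walk u (n (r k))) i - (lattice_coord (walk u (n (r k))) i - of_int (M k) - y i) - y i) \<longlonglongrightarrow> lattice_coord z i - 0 - y i"
      by (intro tendsto_diff 1 2 tendsto_const)
    then have "(\<lambda>k. of_int (M k) :: real) \<longlonglongrightarrow> lattice_coord z i - y i" by simp
    \<comment> \<open>Since \<open>frac\<close> is discontinuous, the limit is taken before reducing
      modulo 1: a limit of integers is an integer.\<close>
    then have "lattice_coord z i - y i \<in> \<int>"
      by (rule closed_sequentially[OF closed_Ints, rotated]) simp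
    then obtain j :: int where "lattice_coord z i = y i + of_int j"
      by (auto elim!: Ints_cases simp: algebra_simps)
    then have "frac (lattice_coord z i) = frac (y i)" by (rule frac_mod_eq)
    also have "frac (y i) = y i" using y i by (simp add: space_torus PiE_iff frac_eq)
    finally show ?thesis .
  qed
  then have "to_torus z = y"
    using y by (intro ext) (simp add: to_torus_def space_torus PiE_iff extensional_def)
  then show ?thesis using l(1) by (intro exI[of _ "fst l"] exI[of _ z]) (simp add: z_def)
qed

text \<open>Reduction modulo the lattice is discontinuous on the fundamental domain, so the image
  need not be closed there. It is the union, over the countably many lattice translations, of
  preimages of \<open>K\<close> under measurable maps.\<close>

lemma to_torus_closed_image:
  assumes "compact K"
  shows "to_torus ` K \<in> sets (torus 2)"
proof -
  define f where "f = (\<lambda>(k :: int \<times> int) y. lattice_point (y 0 + of_int (fst k)) (y (Suc 0) + of_int (snd k)))"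
  have f: "f k \<in> borel_measurable (torus 2)" for k
  proof -
    have "(\<lambda>y. y 0) \<in> borel_measurable (torus 2)" "(\<lambda>y. y (Suc 0)) \<in> borel_measurable (torus 2)"
      by (rule measurable_torus_component; simp)+
    then show ?thesis unfolding f_def lattice_point_def by measurable
  qed
  have "to_torus ` K = (\<Union>k. f k -` K \<inter> space (torus 2))"
  proof
    show "to_torus ` K \<subseteq> (\<Union>k. f k -` K \<inter> space (torus 2))"
    proof clarify
      fix z assume "z \<in> K"
      have "f (\<lfloor>lattice_coord z 0\<rfloor>, \<lfloor>lattice_coord z (Suc 0)\<rfloor>) (to_torus z) = z"
        by (simp add: f_def to_torus_def frac_def lattice_point_coord)
      then show "to_torus z \<in> (\<Union>k. f k -` K \<inter> space (torus 2))"
        using \<open>z \<in> K\<close> to_torus_space by (intro UN_I[of "(\<lfloor>lattice_coord z 0\<rfloor>, \<lfloor>lattice_coord z (Suc 0)\<rfloor>)"]) simp_all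
    qed
    show "(\<Union>k. f k -` K \<inter> space (torus 2)) \<subseteq> to_torus ` K"
    proof clarify
      fix a b y assume y: "f (a, b) y \<in> K" "y \<in> space (torus 2)"
      have "frac (lattice_coord (f (a, b) y) i) = y i" if "i < 2" for i
      proof -
        have "i = 0 \<or> i = Suc 0" using that by linarith
        then have "lattice_coord (f (a, b) y) i = y i + of_int (if i = 0 then a else b)"
          by (auto simp: f_def lattice_coord_point)
        then have "frac (lattice_coord (f (a, b) y) i) = frac (y i)" by (rule frac_mod_eq)
        also have "frac (y i) = y i" using y that by (simp add: space_torus PiE_iff frac_eq)
        finally show ?thesis .
      qed
      then have "to_torus (f (a, b) y) = y"
        using y by (intro ext) (simp add: to_torus_def space_torus PiE_iff extensional_def)
      then show "y \<in> to_torus ` K" using y(1) by (metis imageI)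
    qed
  qed
  moreover have "f k -` K \<inter> space (torus 2) \<in> sets (torus 2)" for k
    using f[of k] assms by (intro measurable_sets) (auto simp: borel_compact)
  moreover have "(\<Union>k. f k -` K \<inter> space (torus 2)) \<in> sets (torus 2)"
    by (intro sets.countable_UN) (use calculation(2) in blast)
  ultimately show ?thesis by (simp only:)
qed

no_notation alpha ("\<alpha>")

theorem theorem7p1:
  fixes s :: "nat \<Rightarrow> substitution" and u :: "nat \<Rightarrow> letter"
  assumes "\<And>n. s n \<in> {sigma_subst, tau_subst}"
    and "words_tendsto (\<lambda>n. comp_subst s n [La]) u"
  shows "\<exists>\<mu>. shift_invariant_prob_on (orbit_closure u) \<mu> \<and>
           (\<forall>\<nu>. shift_invariant_prob_on (orbit_closure u) \<nu> \<longrightarrow> \<nu> = \<mu>) \<and>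
           (\<exists>d \<alpha>. d \<ge> 1 \<and>
              measurably_isomorphic \<mu> left_shift (torus d) (torus_translation d \<alpha>))"
proof -
  have s: "directive s" using assms(1) by (simp only: directive_def) blast
  have u: "limit_word s = u" by (rule limit_word_unique[OF s assms(2), symmetric])
  define X where "X = orbit_closure u"
  have X: "X = orbit_closure (limit_word s)" by (simp only: X_def u)
  define B where "B = restrict_space borel X"
  define psi where "psi = (\<lambda>x. to_torus (coding s x))"
  obtain N where N: "N \<in> null_sets (torus 2)" "to_torus ` bad s \<subseteq> N" using bad_null[OF s] by blast
  have coding_meas: "coding s \<in> borel_measurable B"
    unfolding B_def X by (rule measurable_coding[OF s])
  have "\<exists>\<mu>. (sets \<mu> = sets B \<and> invariant_prob \<mu> left_shift) \<and>
    (\<forall>\<nu>. sets \<nu> = sets B \<and> invariant_prob \<nu> left_shift \<longrightarrow> \<nu> = \<mu>) \<and>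
    measurably_isomorphic \<mu> left_shift (torus 2) rotation"
    unfolding B_def
  proof (rule isomorphic_to_torus[OF dense_translation_lattice])
    have "left_shift \<in> borel_measurable borel"
      using continuous_left_shift[of 1] by (intro borel_measurable_continuous_onI) simp
    then show "left_shift \<in> measurable (restrict_space borel X) (restrict_space borel X)"
      using coding_shift(1)[OF s] by (intro measurable_restrict_space2 measurable_restrict_space1)
        (auto simp: space_restrict_space X)
    show "psi \<in> measurable (restrict_space borel X) (torus 2)"
      unfolding psi_def to_torus_def B_def[symmetric]
      by (intro measurable_torusI borel_measurable_frac measurable_compose[OF coding_meas]
          borel_measurable_continuous_onI continuous_lattice_coord) (simp add: frac_lt_1)
    show "psi (left_shift x) = rotation (psi x)" if "x \<in> X" for x
      using coding_shift(2)[OF s] that by (simp add: psi_def X to_torus_proj)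
    show "psi ` X = space (torus 2)"
    proof
      show "psi ` X \<subseteq> space (torus 2)" using to_torus_space by (auto simp: psi_def)
      show "space (torus 2) \<subseteq> psi ` X"
      proof
        fix y assume "y \<in> space (torus 2)"
        then obtain x z where xz: "(x, z) \<in> ext_hull s" "to_torus z = y" using to_torus_limit[OF s] by blast
        have "x \<in> X" using xz(1) fst_hull[OF s] unfolding X by force
        then show "y \<in> psi ` X" using coding_eq[OF s xz(1)] xz(2) by (intro image_eqI[of _ _ x]) (simp_all add: psi_def)
      qed
    qed
    show "psi ` (X \<inter> C) \<in> sets (torus 2)" if "closed C" for C
    proof -
      have "compact (ext_hull s \<inter> C \<times> UNIV)"
        using that by (intro compact_Int_closed compact_hull s closed_Times) auto
      then have "compact (coding s ` (X \<inter> C))"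
        unfolding X coding_image[OF s] by (intro compact_continuous_image continuous_on_snd continuous_on_id)
      then have "to_torus ` coding s ` (X \<inter> C) \<in> sets (torus 2)" by (rule to_torus_closed_image)
      then show ?thesis by (simp add: psi_def image_image)
    qed
    show "N \<in> null_sets (torus 2)" by (rule N)
    show "\<exists>n. (rotation ^^ n) (psi x) \<in> N" if "x \<in> X" "y \<in> X" "psi x = psi y" "x \<noteq> y" for x y
    proof -
      have "\<exists>n. (rotation ^^ n) (to_torus (coding s x)) \<in> to_torus ` bad s"
        using that by (intro distinct_meeting[OF coding_hull[OF s] coding_hull[OF s]]) (simp_all add: X psi_def)
      then show ?thesis using N(2) unfolding psi_def by blast
    qed
  qed
  then obtain \<mu> where mu: "sets \<mu> = sets B" "invariant_prob \<mu> left_shift"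
    "\<forall>\<nu>. sets \<nu> = sets B \<and> invariant_prob \<nu> left_shift \<longrightarrow> \<nu> = \<mu>"
    "measurably_isomorphic \<mu> left_shift (torus 2) rotation" by (elim exE conjE)
  show ?thesis
    unfolding shift_invariant_prob_on_def X_def[symmetric] B_def[symmetric]
  proof (intro exI[of _ \<mu>] conjI mu(1-3))
    show "\<exists>d \<alpha>. 1 \<le> d \<and> measurably_isomorphic \<mu> left_shift (torus d) (torus_translation d \<alpha>)"
      using mu(4) by (intro exI[of _ 2] exI[of _ "lattice_coord 1"]) simp
  qed
qed

end
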